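(* Let $(\phi,\xi,\eta,g)$ be a contact metric structure on $M^{2n+1}$, with contact subbundle $\mathcal D=\operatorname{im}\phi$ and $J=\phi|_{\mathcal D}$. The structure verifies the second harmonic section equation $[\bar\nabla^*\bar\nabla J,J]=0$ if and only if the $*$-Ricci curvature $\bar\rho^*$ of $\mathcal D$ is symmetric (or, equivalently, $J$-invariant).
   Context: An almost contact metric structure on a Riemannian manifold $(M^{2n+1},g)$ consists of a $(1,1)$-tensor $\phi$, a unit vector field $\xi$ and its dual $1$-form $\eta=g(\xi,\cdot)$, with $\phi^2=-I+\eta\otimes\xi$ and $g(\phi X,\phi Y)=g(X,Y)-\eta(X)\eta(Y)$. It is a contact metric structure if $d\eta=\Phi$, where $\Phi(X,Y)=g(X,\phi Y)$ and $d\eta(X,Y)=\tfrac12\big(X\eta(Y)-Y\eta(X)-\eta([X,Y])\big)$. Everything is smooth. $\nabla$ is the Levi-Civita connection; $\mathcal{D}=\operatorname{im}\phi=\ker\eta$; $\bar\nabla$ is the connection in $\mathcal{D}\to M$ given by $\bar\nabla_XY=(\nabla_XY)_{\mathcal D}$ (orthogonal projection), $X\in TM$, $Y$ a section of $\mathcal D$. $\bar\nabla^2_{X,Y}=\bar\nabla_X\bar\nabla_Y-\bar\nabla_{\nabla_XY}$, and $\bar\nabla^*\bar\nabla J=-\sum_i\bar\nabla^2_{E_i,E_i}J$ for a local orthonormal frame $(E_i)$ of $TM$; $[\cdot,\cdot]$ is the commutator of endomorphisms of $\mathcal D$. The curvature of $(\mathcal D,\bar\nabla)$ is $\bar R(X,Y)=\bar\nabla^2_{X,Y}-\bar\nabla^2_{Y,X}$,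 and the $*$-Ricci curvature of $\mathcal D$ is $\bar\rho^*(X,Y)=\sum_i g(\bar R(X,F_i)JF_i,JY)$ for $X,Y\in\mathcal D$, where $(F_i)$ is a local orthonormal frame of $\mathcal D$. Symmetric means $\bar\rho^*(X,Y)=\bar\rho^*(Y,X)$, and $J$-invariant means $\bar\rho^*(JX,JY)=\bar\rho^*(X,Y)$, for all $X,Y\in\mathcal D$.
   Formalization: The parenthetical "equivalently, J-invariant" fails for n ≥ 2 (e.g. the unit tangent bundle of flat space); formally J-invariant implies symmetric always, and symmetric implies J-invariant only when n ≤ 1 or ξ is Killing. *)

theory Defs
  imports "HOL-Analysis.Analysis" "HOL-Library.Function_Algebras"
begin

section \<open>Smooth manifolds\<close>

fun Ck_on :: "nat \<Rightarrow> 'e::euclidean_space set \<Rightarrow> ('e \<Rightarrow> 'f::real_normed_vector) \<Rightarrow> bool" where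
  "Ck_on 0 S f \<longleftrightarrow> continuous_on S f"
| "Ck_on (Suc k) S f \<longleftrightarrow> (\<forall>x\<in>S. f differentiable (at x)) \<and>
     (\<forall>v. Ck_on k S (\<lambda>x. frechet_derivative f (at x) v))"

text \<open>Only used for open sets \<open>S\<close>.\<close>
definition smooth_on :: "'e::euclidean_space set \<Rightarrow> ('e \<Rightarrow> 'f::real_normed_vector) \<Rightarrow> bool" where
  "smooth_on S f \<longleftrightarrow> (\<forall>k. Ck_on k S f)"

text \<open>The underlying set of the manifold is the whole type \<open>'a\<close>; the Hausdorff and second
  countability axioms are carried by its type classes in the theorem. The atlas need not be maximal;
  the dimension is \<open>DIM('e)\<close>.\<close>

type_synonym ('a, 'e) chart = "'a set \<times> ('a \<Rightarrow> 'e)"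

definition smooth_atlas :: "('a::topological_space, 'e::euclidean_space) chart set \<Rightarrow> bool" where
  "smooth_atlas \<A> \<longleftrightarrow>
     (\<forall>(U, \<kappa>)\<in>\<A>. open U \<and> open (\<kappa> ` U) \<and> homeomorphism U (\<kappa> ` U) \<kappa> (inv_into U \<kappa>)) \<and>
     (\<Union>(U, \<kappa>)\<in>\<A>. U) = UNIV \<and>
     (\<forall>(U, \<kappa>)\<in>\<A>. \<forall>(V, \<mu>)\<in>\<A>. smooth_on (\<kappa> ` (U \<inter> V)) (\<mu> \<circ> inv_into U \<kappa>))"

definition smooth_fun :: "('a::topological_space, 'e::euclidean_space) chart set \<Rightarrow> ('a \<Rightarrow> real) \<Rightarrow> bool" where
  "smooth_fun \<A> f \<longleftrightarrow> (\<forall>(U, \<kappa>)\<in>\<A>. smooth_on (\<kappa> ` U) (f \<circ> inv_into U \<kappa>))"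

text \<open>Tangent vectors at \<open>p\<close> are the derivations at \<open>p\<close> of the algebra of smooth functions. They are
  set to \<open>0\<close> on non-smooth functions, so that equality of tangent vectors is equality in HOL.
  Sums, differences and \<open>0\<close> of tangent vectors and of vector fields are pointwise
  (theory \<open>Function_Algebras\<close>).\<close>

type_synonym 'a tvec = "('a \<Rightarrow> real) \<Rightarrow> real"
type_synonym 'a vfield = "'a \<Rightarrow> 'a tvec"

definition tscale :: "real \<Rightarrow> 'a tvec \<Rightarrow> 'a tvec" (infixr "*\<^sub>T" 75) where
  "c *\<^sub>T v = (\<lambda>f. c * v f)"

definition fscale :: "('a \<Rightarrow> real) \<Rightarrow> 'a vfield \<Rightarrow> 'a vfield" (infixr "*\<^sub>F" 75) where
  "f *\<^sub>F X = (\<lambda>p. f p *\<^sub>T X p)"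

definition tangent_space :: "('a::topological_space, 'e::euclidean_space) chart set \<Rightarrow> 'a \<Rightarrow> 'a tvec set" where
  "tangent_space \<A> p = {v.
     (\<forall>f. \<not> smooth_fun \<A> f \<longrightarrow> v f = 0) \<and>
     (\<forall>f h. smooth_fun \<A> f \<longrightarrow> smooth_fun \<A> h \<longrightarrow> v (\<lambda>x. f x + h x) = v f + v h) \<and>
     (\<forall>c f. smooth_fun \<A> f \<longrightarrow> v (\<lambda>x. c * f x) = c * v f) \<and>
     (\<forall>f h. smooth_fun \<A> f \<longrightarrow> smooth_fun \<A> h \<longrightarrow> v (\<lambda>x. f x * h x) = f p * v h + h p * v f)}"

definition vector_field :: "('a::topological_space, 'e::euclidean_space) chart set \<Rightarrow> 'a vfield \<Rightarrow> bool" where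
  "vector_field \<A> X \<longleftrightarrow> (\<forall>p. X p \<in> tangent_space \<A> p) \<and>
     (\<forall>f. smooth_fun \<A> f \<longrightarrow> smooth_fun \<A> (\<lambda>p. X p f))"

text \<open>Smooth global sections of a subbundle \<open>B\<close> of the tangent bundle.\<close>
definition sections ::
  "('a::topological_space, 'e::euclidean_space) chart set \<Rightarrow> ('a \<Rightarrow> 'a tvec set) \<Rightarrow> 'a vfield set" where
  "sections \<A> B = {X. vector_field \<A> X \<and> (\<forall>p. X p \<in> B p)}"

text \<open>For non-smooth \<open>f\<close> the bracket vanishes, since then \<open>X q f = Y q f = 0\<close> for all \<open>q\<close>.\<close>
definition lie_bracket :: "'a vfield \<Rightarrow> 'a vfield \<Rightarrow> 'a vfield" where
  "lie_bracket X Y = (\<lambda>p f. X p (\<lambda>q. Y q f) - Y p (\<lambda>q. X q f))"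


section \<open>Riemannian metrics and the Levi-Civita connection\<close>

type_synonym 'a metric = "'a \<Rightarrow> 'a tvec \<Rightarrow> 'a tvec \<Rightarrow> real"

definition riemannian_metric ::
  "('a::topological_space, 'e::euclidean_space) chart set \<Rightarrow> 'a metric \<Rightarrow> bool" where
  "riemannian_metric \<A> g \<longleftrightarrow>
     (\<forall>p. \<forall>u\<in>tangent_space \<A> p. \<forall>v\<in>tangent_space \<A> p.
        g p u v = g p v u \<and>
        (\<forall>w\<in>tangent_space \<A> p. g p (u + v) w = g p u w + g p v w) \<and>
        (\<forall>c. g p (c *\<^sub>T u) v = c * g p u v)) \<and>
     (\<forall>p. \<forall>v\<in>tangent_space \<A> p. v \<noteq> 0 \<longrightarrow> g p v v > 0) \<and>
     (\<forall>X Y. vector_field \<A> X \<longrightarrow> vector_field \<A> Y \<longrightarrow> smooth_fun \<A> (\<lambda>p. g p (X p) (Y p)))"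

type_synonym 'a conn = "'a vfield \<Rightarrow> 'a vfield \<Rightarrow> 'a vfield"

definition affine_connection ::
  "('a::topological_space, 'e::euclidean_space) chart set \<Rightarrow> 'a conn \<Rightarrow> bool" where
  "affine_connection \<A> D \<longleftrightarrow>
     (\<forall>X Y. vector_field \<A> X \<longrightarrow> vector_field \<A> Y \<longrightarrow> vector_field \<A> (D X Y)) \<and>
     (\<forall>X X' Y. vector_field \<A> X \<longrightarrow> vector_field \<A> X' \<longrightarrow> vector_field \<A> Y \<longrightarrow>
        D (X + X') Y = D X Y + D X' Y) \<and>
     (\<forall>f X Y. smooth_fun \<A> f \<longrightarrow> vector_field \<A> X \<longrightarrow> vector_field \<A> Y \<longrightarrow>
        D (f *\<^sub>F X) Y = f *\<^sub>F D X Y) \<and>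
     (\<forall>X Y Y'. vector_field \<A> X \<longrightarrow> vector_field \<A> Y \<longrightarrow> vector_field \<A> Y' \<longrightarrow>
        D X (Y + Y') = D X Y + D X Y') \<and>
     (\<forall>f X Y. smooth_fun \<A> f \<longrightarrow> vector_field \<A> X \<longrightarrow> vector_field \<A> Y \<longrightarrow>
        D X (f *\<^sub>F Y) = (\<lambda>p. X p f) *\<^sub>F Y + f *\<^sub>F D X Y)"

definition levi_civita ::
  "('a::topological_space, 'e::euclidean_space) chart set \<Rightarrow> 'a metric \<Rightarrow> 'a conn \<Rightarrow> bool" where
  "levi_civita \<A> g D \<longleftrightarrow> affine_connection \<A> D \<and>
     (\<forall>X Y. vector_field \<A> X \<longrightarrow> vector_field \<A> Y \<longrightarrow> D X Y - D Y X = lie_bracket X Y) \<and>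
     (\<forall>X Y Z. vector_field \<A> X \<longrightarrow> vector_field \<A> Y \<longrightarrow> vector_field \<A> Z \<longrightarrow>
        (\<forall>p. X p (\<lambda>q. g q (Y q) (Z q)) = g p (D X Y p) (Z p) + g p (Y p) (D X Z p)))"

text \<open>A local orthonormal frame, around \<open>p\<close>, of the subbundle \<open>B\<close>. It is given by global sections of \<open>B\<close>
  which form an orthonormal frame on some neighbourhood \<open>U\<close> of \<open>p\<close>; every frame defined only locally
  around \<open>p\<close> agrees near \<open>p\<close> with one of this kind (multiply it by a bump function).\<close>
definition local_orthonormal_frame ::
  "('a::topological_space, 'e::euclidean_space) chart set \<Rightarrow> 'a metric \<Rightarrow> ('a \<Rightarrow> 'a tvec set) \<Rightarrow>
    'a \<Rightarrow> 'a vfield set \<Rightarrow> bool" where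
  "local_orthonormal_frame \<A> g B p S \<longleftrightarrow> finite S \<and> S \<subseteq> sections \<A> B \<and>
     (\<exists>U. open U \<and> p \<in> U \<and> (\<forall>q\<in>U.
        (\<forall>E\<in>S. \<forall>F\<in>S. g q (E q) (F q) = (if E = F then 1 else 0)) \<and>
        (\<forall>v\<in>B q. \<exists>c. v = (\<Sum>E\<in>S. c E *\<^sub>T E q))))"

text \<open>The choice of frame is immaterial for traces of tensors.\<close>
definition some_frame ::
  "('a::topological_space, 'e::euclidean_space) chart set \<Rightarrow> 'a metric \<Rightarrow> ('a \<Rightarrow> 'a tvec set) \<Rightarrow>
    'a \<Rightarrow> 'a vfield set" where
  "some_frame \<A> g B p = (SOME S. local_orthonormal_frame \<A> g B p S)"

definition orth_proj :: "'a metric \<Rightarrow> ('a \<Rightarrow> 'a tvec set) \<Rightarrow> 'a \<Rightarrow> 'a tvec \<Rightarrow> 'a tvec" where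
  "orth_proj g B p v = (THE w. w \<in> B p \<and> (\<forall>u\<in>B p. g p (v - w) u = 0))"

definition killing_field ::
  "('a::topological_space, 'e::euclidean_space) chart set \<Rightarrow> 'a metric \<Rightarrow> 'a vfield \<Rightarrow> bool" where
  "killing_field \<A> g K \<longleftrightarrow> (\<forall>X Y. vector_field \<A> X \<longrightarrow> vector_field \<A> Y \<longrightarrow>
     (\<forall>p. K p (\<lambda>q. g q (X q) (Y q)) = g p (lie_bracket K X p) (Y p) + g p (X p) (lie_bracket K Y p)))"


section \<open>Contact metric structures\<close>

type_synonym 'a endo = "'a \<Rightarrow> 'a tvec \<Rightarrow> 'a tvec"

definition tensor11 :: "('a::topological_space, 'e::euclidean_space) chart set \<Rightarrow> 'a endo \<Rightarrow> bool" where
  "tensor11 \<A> \<phi> \<longleftrightarrow>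
     (\<forall>p. \<forall>u\<in>tangent_space \<A> p. \<phi> p u \<in> tangent_space \<A> p \<and>
        (\<forall>v\<in>tangent_space \<A> p. \<phi> p (u + v) = \<phi> p u + \<phi> p v) \<and>
        (\<forall>c. \<phi> p (c *\<^sub>T u) = c *\<^sub>T \<phi> p u)) \<and>
     (\<forall>X. vector_field \<A> X \<longrightarrow> vector_field \<A> (\<lambda>p. \<phi> p (X p)))"

definition dual_form :: "'a metric \<Rightarrow> 'a vfield \<Rightarrow> 'a \<Rightarrow> 'a tvec \<Rightarrow> real" where
  "dual_form g \<xi> p v = g p (\<xi> p) v"

definition almost_contact_metric ::
  "('a::topological_space, 'e::euclidean_space) chart set \<Rightarrow> 'a metric \<Rightarrow> 'a endo \<Rightarrow> 'a vfield \<Rightarrow>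
    ('a \<Rightarrow> 'a tvec \<Rightarrow> real) \<Rightarrow> bool" where
  "almost_contact_metric \<A> g \<phi> \<xi> \<eta> \<longleftrightarrow>
     riemannian_metric \<A> g \<and> tensor11 \<A> \<phi> \<and> vector_field \<A> \<xi> \<and>
     (\<forall>p. g p (\<xi> p) (\<xi> p) = 1) \<and> \<eta> = dual_form g \<xi> \<and>
     (\<forall>p. \<forall>u\<in>tangent_space \<A> p. \<phi> p (\<phi> p u) = - u + \<eta> p u *\<^sub>T \<xi> p) \<and>
     (\<forall>p. \<forall>u\<in>tangent_space \<A> p. \<forall>v\<in>tangent_space \<A> p.
        g p (\<phi> p u) (\<phi> p v) = g p u v - \<eta> p u * \<eta> p v)"

definition ext_deriv :: "('a \<Rightarrow> 'a tvec \<Rightarrow> real) \<Rightarrow> 'a vfield \<Rightarrow> 'a vfield \<Rightarrow> 'a \<Rightarrow> real" where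
  "ext_deriv \<eta> X Y p =
     (X p (\<lambda>q. \<eta> q (Y q)) - Y p (\<lambda>q. \<eta> q (X q)) - \<eta> p (lie_bracket X Y p)) / 2"

definition contact_metric ::
  "('a::topological_space, 'e::euclidean_space) chart set \<Rightarrow> 'a metric \<Rightarrow> 'a endo \<Rightarrow> 'a vfield \<Rightarrow>
    ('a \<Rightarrow> 'a tvec \<Rightarrow> real) \<Rightarrow> bool" where
  "contact_metric \<A> g \<phi> \<xi> \<eta> \<longleftrightarrow> almost_contact_metric \<A> g \<phi> \<xi> \<eta> \<and>
     (\<forall>X Y. vector_field \<A> X \<longrightarrow> vector_field \<A> Y \<longrightarrow>
        (\<forall>p. ext_deriv \<eta> X Y p = g p (X p) (\<phi> p (Y p))))"

definition contact_bundle ::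
  "('a::topological_space, 'e::euclidean_space) chart set \<Rightarrow> 'a endo \<Rightarrow> 'a \<Rightarrow> 'a tvec set" where
  "contact_bundle \<A> \<phi> p = \<phi> p ` tangent_space \<A> p"


section \<open>Calculus in the contact subbundle\<close>

text \<open>Endomorphism fields of the contact subbundle \<open>\<D>\<close> are represented by their action on sections of
  \<open>\<D>\<close>; below, \<open>nb\<close> is a connection in \<open>\<D>\<close> and \<open>D\<close> an affine connection.\<close>

definition J_op :: "'a endo \<Rightarrow> 'a vfield \<Rightarrow> 'a vfield" where
  "J_op \<phi> Y = (\<lambda>p. \<phi> p (Y p))"

definition bar_conn ::
  "('a::topological_space, 'e::euclidean_space) chart set \<Rightarrow> 'a metric \<Rightarrow> 'a endo \<Rightarrow> 'a conn \<Rightarrow> 'a conn" where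
  "bar_conn \<A> g \<phi> D X Y = (\<lambda>p. orth_proj g (contact_bundle \<A> \<phi>) p (D X Y p))"

text \<open>The induced connection on endomorphism fields.\<close>
definition end_conn ::
  "'a conn \<Rightarrow> 'a vfield \<Rightarrow> ('a vfield \<Rightarrow> 'a vfield) \<Rightarrow> ('a vfield \<Rightarrow> 'a vfield)" where
  "end_conn nb X T = (\<lambda>Y. nb X (T Y) - T (nb X Y))"

text \<open>Used both for sections of \<open>\<D>\<close> and, with \<open>end_conn\<close>, for endomorphism fields of \<open>\<D>\<close>.\<close>
definition second_cov ::
  "'a conn \<Rightarrow> ('a vfield \<Rightarrow> 's \<Rightarrow> 's::minus) \<Rightarrow> 'a vfield \<Rightarrow> 'a vfield \<Rightarrow> 's \<Rightarrow> 's" where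
  "second_cov D nb X Y s = nb X (nb Y s) - nb (D X Y) s"

definition bar_curv :: "'a conn \<Rightarrow> 'a conn \<Rightarrow> 'a vfield \<Rightarrow> 'a vfield \<Rightarrow> 'a vfield \<Rightarrow> 'a vfield" where
  "bar_curv D nb X Y Z = second_cov D nb X Y Z - second_cov D nb Y X Z"

definition rough_laplacian ::
  "('a::topological_space, 'e::euclidean_space) chart set \<Rightarrow> 'a metric \<Rightarrow> 'a conn \<Rightarrow> 'a conn \<Rightarrow>
    ('a vfield \<Rightarrow> 'a vfield) \<Rightarrow> ('a vfield \<Rightarrow> 'a vfield)" where
  "rough_laplacian \<A> g D nb T = (\<lambda>Z p.
     - (\<Sum>E\<in>some_frame \<A> g (tangent_space \<A>) p. second_cov D (end_conn nb) E E T Z p))"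

definition commutator ::
  "('a vfield \<Rightarrow> 'a vfield) \<Rightarrow> ('a vfield \<Rightarrow> 'a vfield) \<Rightarrow> ('a vfield \<Rightarrow> 'a vfield)" where
  "commutator S T = (\<lambda>Z. S (T Z) - T (S Z))"

definition second_harmonic_section_eq ::
  "('a::topological_space, 'e::euclidean_space) chart set \<Rightarrow> 'a metric \<Rightarrow> 'a endo \<Rightarrow> 'a conn \<Rightarrow> bool" where
  "second_harmonic_section_eq \<A> g \<phi> D \<longleftrightarrow>
     (\<forall>Z\<in>sections \<A> (contact_bundle \<A> \<phi>).
        commutator (rough_laplacian \<A> g D (bar_conn \<A> g \<phi> D) (J_op \<phi>)) (J_op \<phi>) Z = 0)"

definition star_ricci ::
  "('a::topological_space, 'e::euclidean_space) chart set \<Rightarrow> 'a metric \<Rightarrow> 'a endo \<Rightarrow> 'a conn \<Rightarrow>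
    'a vfield \<Rightarrow> 'a vfield \<Rightarrow> 'a \<Rightarrow> real" where
  "star_ricci \<A> g \<phi> D X Y p =
     (\<Sum>F\<in>some_frame \<A> g (contact_bundle \<A> \<phi>) p.
        g p (bar_curv D (bar_conn \<A> g \<phi> D) X F (J_op \<phi> F) p) (J_op \<phi> Y p))"

text \<open>Every vector of \<open>\<D>\<close> at a point is the value of a global section of \<open>\<D>\<close>.\<close>

definition star_ricci_symmetric ::
  "('a::topological_space, 'e::euclidean_space) chart set \<Rightarrow> 'a metric \<Rightarrow> 'a endo \<Rightarrow> 'a conn \<Rightarrow> bool" where
  "star_ricci_symmetric \<A> g \<phi> D \<longleftrightarrow>
     (\<forall>X\<in>sections \<A> (contact_bundle \<A> \<phi>). \<forall>Y\<in>sections \<A> (contact_bundle \<A> \<phi>). \<forall>p.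
        star_ricci \<A> g \<phi> D X Y p = star_ricci \<A> g \<phi> D Y X p)"

text \<open>\<open>J\<close>-invariance implies symmetry. The converse holds in dimension at most 3 and when \<open>\<xi>\<close> is Killing,
  but not in general: with \<open>h\<close> half the Lie derivative of \<open>\<phi>\<close> along \<open>\<xi>\<close>, writing \<open>\<rho>\<close> for the
  star-Ricci curvature, \<open>\<rho>(JX,JY) = \<rho>(Y,X) - 4(n-1) g(hX,Y)\<close>. For the standard contact metric structure
  on the tangent sphere bundle of flat \<open>(n+1)\<close>-space, \<open>n \<ge> 2\<close>, \<open>J\<close> is parallel and \<open>\<rho>\<close> is symmetric but
  not \<open>J\<close>-invariant.\<close>

definition star_ricci_J_invariant ::
  "('a::topological_space, 'e::euclidean_space) chart set \<Rightarrow> 'a metric \<Rightarrow> 'a endo \<Rightarrow> 'a conn \<Rightarrow> bool" where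
  "star_ricci_J_invariant \<A> g \<phi> D \<longleftrightarrow>
     (\<forall>X\<in>sections \<A> (contact_bundle \<A> \<phi>). \<forall>Y\<in>sections \<A> (contact_bundle \<A> \<phi>). \<forall>p.
        star_ricci \<A> g \<phi> D (J_op \<phi> X) (J_op \<phi> Y) p = star_ricci \<A> g \<phi> D X Y p)"

end

theory Submission
  imports Defs "HOL-Real_Asymp.Real_Asymp"
begin

text \<open>Write \<open>S X = \<nabla>\<^sub>X \<xi>\<close> and let \<open>A\<close> be the rough Laplacian of \<open>J\<close>. Since \<open>\<Phi> = d\<eta>\<close> is closed,
  \<open>\<nabla>\<^sub>\<xi> J = 0\<close>, the symmetric part of \<open>S\<close> anticommutes with \<open>J\<close>, and both \<open>g(Y, (\<nabla>\<^sub>X J) Z)\<close> and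
  \<open>g(Y, (\<nabla>\<^sup>2\<^sub>V\<^sub>,\<^sub>X J) Z)\<close> have vanishing cyclic sums and traces over the contact subbundle. The cyclic
  identity and an exchange of derivatives turn \<open>A\<close> into Ricci and star-Ricci traces of the curvature
  of the subbundle. The Gauss equation for the subbundle, together with the symmetries of the
  Riemann tensor, shows that the skew part of the Ricci trace is \<open>J\<close>-invariant, so it drops out of
  \<open>[A, J]\<close>, and that the star-Ricci curvature \<open>\<rho>\<close> has \<open>\<rho>(JX, JY) - \<rho>(Y, X)\<close> symmetric in
  \<open>X\<close>, \<open>Y\<close>. Hence \<open>g(Y, [A, J] Z)\<close> is \<open>-2\<close> times \<open>\<rho>(Y, Z) - \<rho>(Z, Y)\<close>.\<close>

section \<open>Smooth functions on open subsets of a Euclidean space\<close>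

text \<open>All operators act on global fields, and the frames behind the two traces are arbitrary
  choices, made anew at each point. Such traces can be compared only through function-linearity in
  the fields; cutoff functions and Hadamard's expansion supply enough global fields and show that a
  function-linear functional sees only values at a point. On the contact subbundle D one has S = P -
  J, with P symmetric and PJ = -JP: the skew part -J is the condition that the exterior derivative
  of \<eta> is the fundamental form, and P = -Jh in the usual notation. Hence S S = P P - I is
  symmetric, so only the trace term of the Gauss equation contributes to the skew part of the Ricci
  trace, as a multiple of the fundamental form. The product of S with J has trace of absolute value
  2n, the rank of D. Together with a -2 from the term S J S this gives the factor 2n - 2 in the
  comparison of \<rho>(JX, JY) with \<rho>(Y, X). The form it multiplies is -2 g(hX, Y): being
  symmetric it is invisible to the commutator, yet it is exactly what separates symmetry from
  J-invariance.\<close>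

lemma Ck_on_cong:
  assumes "open S" "\<And>x. x \<in> S \<Longrightarrow> f x = h x" "Ck_on k S f"
  shows "Ck_on k S h"
  using assms(2,3)
proof (induction k arbitrary: f h)
  case 0
  then show ?case using continuous_on_cong[of S S f h] by simp
next
  case (Suc k)
  have D: "(h has_derivative frechet_derivative f (at x)) (at x)" if "x \<in> S" for x
  proof -
    have "(f has_derivative frechet_derivative f (at x)) (at x)"
      using Suc.prems(2) that frechet_derivative_works by auto
    then show ?thesis
      using has_derivative_transform_within_open[OF _ assms(1) that] Suc.prems(1) by metis
  qed
  have "frechet_derivative h (at x) = frechet_derivative f (at x)" if "x \<in> S" for x
    using frechet_derivative_at[OF D[OF that]] by simp
  then have "Ck_on k S (\<lambda>x. frechet_derivative h (at x) v)" for v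
    using Suc.IH[of "\<lambda>x. frechet_derivative f (at x) v" "\<lambda>x. frechet_derivative h (at x) v"] Suc.prems(2)
    by simp
  then show ?case using D by (auto simp: differentiable_def)
qed

lemma smooth_on_cong:
  "open S \<Longrightarrow> (\<And>x. x \<in> S \<Longrightarrow> f x = h x) \<Longrightarrow> smooth_on S f \<Longrightarrow> smooth_on S h"
  unfolding smooth_on_def using Ck_on_cong by metis

lemma Ck_on_continuous: "Ck_on k S f \<Longrightarrow> continuous_on S f"
  by (cases k) (auto simp: continuous_at_imp_continuous_on differentiable_imp_continuous_within)

lemma smooth_on_continuous: "smooth_on S f \<Longrightarrow> continuous_on S f"
  unfolding smooth_on_def using Ck_on_continuous by blast

text \<open>\<open>Ck_on\<close> recurses through directional derivatives, so smoothness is a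
  greatest fixed point: any class of differentiable functions closed under directional derivatives
  consists of smooth functions. This replaces an induction on the order for each
  construction.\<close>

lemma smooth_on_coinduct:
  assumes "open S" "P f"
    and step: "\<And>f. P f \<Longrightarrow> \<exists>f'. (\<forall>x\<in>S. (f has_derivative f' x) (at x)) \<and> (\<forall>v. P (\<lambda>x. f' x v))"
  shows "smooth_on S f"
proof -
  have "Ck_on k S f" if "P f" for k f
    using that
  proof (induction k arbitrary: f)
    case 0
    obtain f' where "\<forall>x\<in>S. (f has_derivative f' x) (at x)" using step[OF 0] by blast
    then show ?case
      by (auto intro!: continuous_at_imp_continuous_on has_derivative_continuous)
  next
    case (Suc k)
    obtain f' where f': "\<forall>x\<in>S. (f has_derivative f' x) (at x)" "\<And>v. P (\<lambda>x. f' x v)"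
      using step[OF Suc.prems] by blast
    have eq: "f' x v = frechet_derivative f (at x) v" if "x \<in> S" for x v
      using frechet_derivative_at f'(1) that by metis
    have "Ck_on k S (\<lambda>x. frechet_derivative f (at x) v)" for v
      using Ck_on_cong[OF assms(1) eq Suc.IH[OF f'(2)]] .
    then show ?case using f'(1) by (auto simp: differentiable_def)
  qed
  then show ?thesis using assms(2) by (simp add: smooth_on_def)
qed

lemma smooth_on_has_derivative:
  assumes "smooth_on S f" "x \<in> S"
  shows "(f has_derivative frechet_derivative f (at x)) (at x)"
proof -
  have "Ck_on (Suc 0) S f" using assms(1) unfolding smooth_on_def by blast
  then show ?thesis using assms(2) frechet_derivative_works by auto
qed

lemma smooth_on_frechet_derivative:
  assumes "smooth_on S f"
  shows "smooth_on S (\<lambda>x. frechet_derivative f (at x) v)"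
  unfolding smooth_on_def
proof
  fix k
  have "Ck_on (Suc k) S f" using assms unfolding smooth_on_def by blast
  then show "Ck_on k S (\<lambda>x. frechet_derivative f (at x) v)" by simp
qed

lemma smooth_on_subset: "smooth_on S f \<Longrightarrow> T \<subseteq> S \<Longrightarrow> smooth_on T f"
proof -
  have "Ck_on k S f \<Longrightarrow> T \<subseteq> S \<Longrightarrow> Ck_on k T f" for k
    by (induction k arbitrary: f) (auto intro: continuous_on_subset)
  then show "smooth_on S f \<Longrightarrow> T \<subseteq> S \<Longrightarrow> smooth_on T f" by (auto simp: smooth_on_def)
qed

lemma smooth_on_Un:
  assumes "open S" "open T" "smooth_on S f" "smooth_on T f"
  shows "smooth_on (S \<union> T) f"
proof -
  have "Ck_on k S f \<Longrightarrow> Ck_on k T f \<Longrightarrow> Ck_on k (S \<union> T) f" for k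
    by (induction k arbitrary: f) (auto intro: continuous_on_open_Un assms)
  then show ?thesis using assms by (auto simp: smooth_on_def)
qed

lemma smooth_on_const: "smooth_on S (\<lambda>x. c)"
proof -
  have "Ck_on k S (\<lambda>x. c)" for k
    by (induction k arbitrary: c) (auto simp: frechet_derivative_const)
  then show ?thesis by (auto simp: smooth_on_def)
qed

lemma smooth_on_inner_const:
  fixes h :: "'e::euclidean_space \<Rightarrow> 'f::real_inner"
  assumes "open S" "smooth_on S h"
  shows "smooth_on S (\<lambda>x. h x \<bullet> b)"
proof (rule smooth_on_coinduct[where P="\<lambda>f. \<exists>h :: 'e \<Rightarrow> 'f. smooth_on S h \<and> f = (\<lambda>x. h x \<bullet> b)"])
  fix f assume "\<exists>h :: 'e \<Rightarrow> 'f. smooth_on S h \<and> f = (\<lambda>x. h x \<bullet> b)"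
  then obtain h :: "'e \<Rightarrow> 'f" where h: "smooth_on S h" "f = (\<lambda>x. h x \<bullet> b)" by blast
  show "\<exists>f'. (\<forall>x\<in>S. (f has_derivative f' x) (at x)) \<and>
     (\<forall>v. \<exists>h :: 'e \<Rightarrow> 'f. smooth_on S h \<and> (\<lambda>x. f' x v) = (\<lambda>x. h x \<bullet> b))"
    by (rule exI[of _ "\<lambda>x v. frechet_derivative h (at x) v \<bullet> b"])
       (auto simp: h(2) intro!: has_derivative_inner_left smooth_on_has_derivative[OF h(1)]
         intro: smooth_on_frechet_derivative[OF h(1)])
qed (use assms in auto)

lemma smooth_on_linear:
  assumes "bounded_linear l"
  shows "smooth_on UNIV l"
proof (rule smooth_on_coinduct[where P="\<lambda>f. f = l \<or> (\<exists>c. f = (\<lambda>x. c))"])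
  fix f assume "f = l \<or> (\<exists>c. f = (\<lambda>x. c))"
  then show "\<exists>f'. (\<forall>x\<in>UNIV. (f has_derivative f' x) (at x)) \<and>
      (\<forall>v. (\<lambda>x. f' x v) = l \<or> (\<exists>c. (\<lambda>x. f' x v) = (\<lambda>x. c)))"
  proof
    assume "f = l"
    then show ?thesis
      using bounded_linear_imp_has_derivative[OF assms] by (intro exI[of _ "\<lambda>x. l"]) auto
  next
    assume "\<exists>c. f = (\<lambda>x. c)"
    then show ?thesis by (intro exI[of _ "\<lambda>x v. 0"]) auto
  qed
qed auto

section \<open>Flat functions\<close>

definition flat :: "nat \<Rightarrow> real \<Rightarrow> real" where
  "flat k t = (if t \<le> 0 then 0 else exp (- 1 / t) / t ^ k)"

lemma flat_pos: "t > 0 \<Longrightarrow> flat k t > 0" and flat_zero: "t \<le> 0 \<Longrightarrow> flat k t = 0"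
  by (auto simp: flat_def)

lemma flat_nonneg: "flat k t \<ge> 0"
  by (auto simp: flat_def)

lemma flat_tendsto_0: "(flat k \<longlongrightarrow> 0) (at 0)"
proof -
  have "((\<lambda>t::real. exp (- 1 / t) / t ^ k) \<longlongrightarrow> 0) (at_right 0)"
    by real_asymp
  then have "(flat k \<longlongrightarrow> 0) (at_right 0)"
    by (rule Lim_transform_eventually)
       (auto simp: flat_def eventually_at_filter)
  moreover have "(flat k \<longlongrightarrow> 0) (at_left 0)"
    by (rule Lim_transform_eventually[OF tendsto_const])
       (auto simp: flat_def eventually_at_filter)
  ultimately show ?thesis by (simp add: filterlim_at_split)
qed

text \<open>The exponent \<open>k\<close> exists for this formula: differentiation stays in the span
  of the family, so the whole family is smooth at once.\<close>

lemma DERIV_flat: "(flat k has_real_derivative flat (k + 2) t - real k * flat (k + 1) t) (at t)"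
proof -
  consider "t < 0" | "t = 0" | "t > 0" by linarith
  then show ?thesis
  proof cases
    case 1
    have "((\<lambda>t. 0) has_real_derivative 0) (at t)" by simp
    then have "(flat k has_real_derivative 0) (at t)"
      by (rule has_field_derivative_transform_within_open[where S="{..<0}"])
         (use 1 in \<open>auto simp: flat_def\<close>)
    then show ?thesis using 1 by (simp add: flat_def)
  next
    case 2
    \<comment> \<open>Away from 0 the difference quotient of \<open>flat k\<close> at 0 is
      \<open>flat (k + 1)\<close>, which tends to 0.\<close>
    have "((\<lambda>x. (flat k x - flat k 0) / (x - 0)) \<longlongrightarrow> 0) (at 0)"
      by (rule Lim_transform_eventually[OF flat_tendsto_0[of "k + 1"]])
         (auto simp: flat_def eventually_at_filter)
    then show ?thesis using 2 by (simp add: has_field_derivative_iff flat_def)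
  next
    case 3
    have "((\<lambda>t. exp (- 1 / t) / t ^ k) has_real_derivative flat (k + 2) t - real k * flat (k + 1) t) (at t)"
    proof -
      have e: "((\<lambda>t. exp (- 1 / t)) has_real_derivative exp (- 1 / t) * (1 / t\<^sup>2)) (at t)"
        using 3 by (auto intro!: derivative_eq_intros simp: power2_eq_square)
      have p: "((\<lambda>t. t ^ k) has_real_derivative real k * t ^ k / t) (at t)"
        using DERIV_pow[of k t] 3 by (cases k) simp_all
      have "(exp (- 1 / t) * (1 / t\<^sup>2) * t ^ k - exp (- 1 / t) * (real k * t ^ k / t)) / (t ^ k * t ^ k) =
          flat (k + 2) t - real k * flat (k + 1) t"
        using 3 by (simp add: flat_def power_add power2_eq_square divide_simps) (simp add: algebra_simps)
      with DERIV_divide[OF e p] show ?thesis using 3 by simp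
    qed
    then show ?thesis
      by (rule has_field_derivative_transform_within_open[where S="{0<..}"])
         (use 3 in \<open>auto simp: flat_def\<close>)
  qed
qed

section \<open>Products, powers and compositions of smooth functions; cutoff functions\<close>

inductive smooth_closure :: "'e::euclidean_space set \<Rightarrow> ('e \<Rightarrow> real) \<Rightarrow> bool" for S where
  base: "smooth_on S f \<Longrightarrow> smooth_closure S f"
| add: "smooth_closure S f \<Longrightarrow> smooth_closure S h \<Longrightarrow> smooth_closure S (\<lambda>x. f x + h x)"
| mult: "smooth_closure S f \<Longrightarrow> smooth_closure S h \<Longrightarrow> smooth_closure S (\<lambda>x. f x * h x)"
| powr: "smooth_closure S f \<Longrightarrow> (\<And>x. x \<in> S \<Longrightarrow> f x > 0) \<Longrightarrow> smooth_closure S (\<lambda>x. f x powr a)"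
| flat: "smooth_closure S f \<Longrightarrow> smooth_closure S (\<lambda>x. flat k (f x))"
| comp: "smooth_on T f \<Longrightarrow> (\<And>b. b \<in> Basis \<Longrightarrow> smooth_closure S (\<lambda>x. h x \<bullet> b)) \<Longrightarrow>
    (\<And>x. x \<in> S \<Longrightarrow> h x \<in> T) \<Longrightarrow> smooth_closure S (\<lambda>x. f ((h x) :: 'e))"

lemma smooth_closure_sum:
  assumes "finite I" "\<And>i. i \<in> I \<Longrightarrow> smooth_closure S (f i)"
  shows "smooth_closure S (\<lambda>x. \<Sum>i\<in>I. f i x)"
  using assms by (induction I) (auto intro: smooth_closure.intros smooth_on_const)

text \<open>The derivative of each generator is built from the generators again, so one induction
  yields product rule, chain rule and smoothness of powers together. Composition is phrased by
  components because the class contains only real-valued functions.\<close>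

lemma smooth_closure_derivative:
  fixes f :: "'e::euclidean_space \<Rightarrow> real"
  assumes "smooth_closure S f"
  shows "\<exists>f'. (\<forall>x\<in>S. (f has_derivative f' x) (at x)) \<and> (\<forall>v. smooth_closure S (\<lambda>x. f' x v))"
  using assms
proof induction
  case (base f)
  then show ?case
    by (intro exI[of _ "\<lambda>x. frechet_derivative f (at x)"])
       (auto intro: smooth_on_has_derivative smooth_on_frechet_derivative smooth_closure.base)
next
  case (add f h)
  then obtain f' h' where
    "\<forall>x\<in>S. (f has_derivative f' x) (at x)" "\<And>v. smooth_closure S (\<lambda>x. f' x v)"
    "\<forall>x\<in>S. (h has_derivative h' x) (at x)" "\<And>v. smooth_closure S (\<lambda>x. h' x v)" by metis
  then show ?case
    by (intro exI[of _ "\<lambda>x v. f' x v + h' x v"]) (auto intro: has_derivative_add smooth_closure.add)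
next
  case (mult f h)
  then obtain f' h' where
    "\<forall>x\<in>S. (f has_derivative f' x) (at x)" "\<And>v. smooth_closure S (\<lambda>x. f' x v)"
    "\<forall>x\<in>S. (h has_derivative h' x) (at x)" "\<And>v. smooth_closure S (\<lambda>x. h' x v)" by metis
  note d = this
  have "smooth_closure S (\<lambda>x. f x * h' x v + f' x v * h x)" for v
    by (intro smooth_closure.add smooth_closure.mult d mult.hyps)
  with d(1,3) show ?case
    by (intro exI[of _ "\<lambda>x v. f x * h' x v + f' x v * h x"]) (blast intro: has_derivative_mult)
next
  case (powr f a)
  then obtain f' where f':
    "\<forall>x\<in>S. (f has_derivative f' x) (at x)" "\<And>v. smooth_closure S (\<lambda>x. f' x v)" by metis
  have "((\<lambda>x. f x powr a) has_derivative (\<lambda>v. a * (f x powr (a - 1)) * f' x v)) (at x)" if "x \<in> S" for x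
  proof -
    have "((\<lambda>t. t powr a) has_real_derivative a * (f x powr (a - 1))) (at (f x))"
      using powr.hyps that by (auto intro!: has_real_derivative_powr)
    then show ?thesis
      using f'(1) that has_derivative_compose[of f "f' x" x UNIV "\<lambda>t. t powr a"]
      by (simp add: has_field_derivative_def)
  qed
  moreover have "smooth_closure S (\<lambda>x. a * (f x powr (a - 1)) * f' x v)" for v
    by (intro smooth_closure.mult smooth_closure.powr f' smooth_closure.base[OF smooth_on_const])
       (use powr.hyps in auto)
  ultimately show ?case by (intro exI[of _ "\<lambda>x v. a * (f x powr (a - 1)) * f' x v"]) blast
next
  case (flat f k)
  then obtain f' where f':
    "\<forall>x\<in>S. (f has_derivative f' x) (at x)" "\<And>v. smooth_closure S (\<lambda>x. f' x v)" by metis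
  have "((\<lambda>x. flat k (f x)) has_derivative
      (\<lambda>v. (flat (k + 2) (f x) + (- real k) * flat (k + 1) (f x)) * f' x v)) (at x)" if "x \<in> S" for x
    using f'(1) that has_derivative_compose[of f "f' x" x UNIV "flat k"] DERIV_flat[of k "f x"]
    by (simp add: has_field_derivative_def)
  moreover have "smooth_closure S (\<lambda>x. (flat (k + 2) (f x) + (- real k) * flat (k + 1) (f x)) * f' x v)" for v
    by (intro smooth_closure.mult smooth_closure.add smooth_closure.flat f'
          smooth_closure.base[OF smooth_on_const] flat.hyps)
  ultimately show ?case
    by (intro exI[of _ "\<lambda>x v. (flat (k + 2) (f x) + (- real k) * flat (k + 1) (f x)) * f' x v"]) blast
next
  case (comp T f h)
  obtain h' where h': "\<And>b x. b \<in> Basis \<Longrightarrow> x \<in> S \<Longrightarrow> ((\<lambda>x. h x \<bullet> b) has_derivative h' b x) (at x)"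
      "\<And>b v. b \<in> Basis \<Longrightarrow> smooth_closure S (\<lambda>x. h' b x v)"
    using comp.IH by metis
  let ?h = "\<lambda>x v. \<Sum>b\<in>Basis. h' b x v *\<^sub>R b"
  let ?f = "\<lambda>x. frechet_derivative f (at x)"
  have hd: "(h has_derivative ?h x) (at x)" if "x \<in> S" for x
  proof -
    have "(\<lambda>v. ?h x v \<bullet> b) = h' b x" if "b \<in> Basis" for b
      using that by (simp add: inner_sum_left inner_Basis if_distrib cong: if_cong)
    then show ?thesis
      using h'(1) that by (subst has_derivative_componentwise_within) (auto)
  qed
  have "((\<lambda>x. f (h x)) has_derivative (\<lambda>v. \<Sum>b\<in>Basis. h' b x v * ?f (h x) b)) (at x)" if "x \<in> S" for x
  proof -
    have f1: "(f has_derivative ?f (h x)) (at (h x))"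
      using smooth_on_has_derivative comp.hyps that by blast
    then have "linear (?f (h x))" using has_derivative_linear by blast
    then have "?f (h x) (?h x v) = (\<Sum>b\<in>Basis. h' b x v * ?f (h x) b)" for v
      by (simp add: linear_sum linear_scale)
    then show ?thesis
      using has_derivative_compose[OF hd[OF that] f1] by simp
  qed
  moreover have "smooth_closure S (\<lambda>x. \<Sum>b\<in>Basis. h' b x v * ?f (h x) b)" for v
  proof (rule smooth_closure_sum[OF finite_Basis])
    fix b :: 'e assume b: "b \<in> Basis"
    have "smooth_closure S (\<lambda>x. ?f (h x) b)"
    proof (rule smooth_closure.comp[where f="\<lambda>x. ?f x b" and h=h and T=T])
      show "smooth_on T (\<lambda>x. ?f x b)" by (rule smooth_on_frechet_derivative[OF comp.hyps(1)])
    qed (fact comp.hyps)+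
    then show "smooth_closure S (\<lambda>x. h' b x v * ?f (h x) b)"
      by (rule smooth_closure.mult[OF h'(2)[OF b]])
  qed
  ultimately show ?case
    by (intro exI[of _ "\<lambda>x v. \<Sum>b\<in>Basis. h' b x v * ?f (h x) b"]) blast
qed

lemma smooth_closure_imp_smooth:
  assumes "open S" "smooth_closure S f"
  shows "smooth_on S f"
proof (rule smooth_on_coinduct[where P="smooth_closure S"])
  show "\<exists>f'. (\<forall>x\<in>S. (f has_derivative f' x) (at x)) \<and> (\<forall>v. smooth_closure S (\<lambda>x. f' x v))"
    if "smooth_closure S f" for f
    using that by (rule smooth_closure_derivative)
qed (fact assms)+

lemma smooth_on_add: "open S \<Longrightarrow> smooth_on S f \<Longrightarrow> smooth_on S h \<Longrightarrow> smooth_on S (\<lambda>x. f x + h x :: real)"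
  by (rule smooth_closure_imp_smooth) (auto intro!: smooth_closure.add intro: smooth_closure.base)

lemma smooth_on_mult: "open S \<Longrightarrow> smooth_on S f \<Longrightarrow> smooth_on S h \<Longrightarrow> smooth_on S (\<lambda>x. f x * h x :: real)"
  by (rule smooth_closure_imp_smooth) (auto intro!: smooth_closure.mult intro: smooth_closure.base)

lemma smooth_on_powr:
  "open S \<Longrightarrow> smooth_on S f \<Longrightarrow> (\<And>x. x \<in> S \<Longrightarrow> f x > 0) \<Longrightarrow> smooth_on S (\<lambda>x. f x powr a :: real)"
  by (rule smooth_closure_imp_smooth) (auto intro!: smooth_closure.powr intro: smooth_closure.base)

lemma smooth_on_compose:
  fixes h :: "'e::euclidean_space \<Rightarrow> 'e" and f :: "'e \<Rightarrow> real"
  assumes "open S" "smooth_on T f" "smooth_on S h" "h ` S \<subseteq> T"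
  shows "smooth_on S (\<lambda>x. f (h x))"
proof (rule smooth_closure_imp_smooth[OF assms(1)], rule smooth_closure.comp[where f=f and h=h and T=T])
  show "smooth_closure S (\<lambda>x. h x \<bullet> b)" for b
    by (rule smooth_closure.base[OF smooth_on_inner_const[OF assms(1,3)]])
qed (use assms in auto)

text \<open>The quotient u / (u + w) works, with u positive exactly inside the ball of radius r and
  w positive exactly outside the closed ball of radius r / 2. These regions cover the space, so the
  denominator never vanishes.\<close>

lemma smooth_cutoff:
  fixes a :: "'e::euclidean_space"
  assumes "r > 0"
  obtains \<beta> :: "'e \<Rightarrow> real" where "smooth_on UNIV \<beta>" "\<And>x. 0 \<le> \<beta> x" "\<And>x. \<beta> x \<le> 1"
    "\<And>x. x \<in> ball a (r / 2) \<Longrightarrow> \<beta> x = 1" "\<And>x. x \<notin> ball a r \<Longrightarrow> \<beta> x = 0"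
proof -
  let ?n = "\<lambda>x::'e. (\<Sum>b\<in>Basis. (x \<bullet> b + - (a \<bullet> b)) * (x \<bullet> b + - (a \<bullet> b)))"
  have n: "?n x = (norm (x - a))\<^sup>2" for x
    unfolding power2_norm_eq_inner euclidean_inner[of "x - a" "x - a"] by (simp add: inner_diff_left)
  let ?u = "\<lambda>x. flat 0 (r\<^sup>2 + (- 1) * ?n x)" and ?w = "\<lambda>x. flat 0 (?n x + - ((r / 2)\<^sup>2))"
  have pos: "?u x + ?w x > 0" for x
  proof (cases "?n x < r\<^sup>2")
    case True
    then show ?thesis using flat_pos[of "r\<^sup>2 + (- 1) * ?n x" 0] flat_nonneg[of 0] by (smt (verit))
  next
    case False
    have "(r / 2)\<^sup>2 < r\<^sup>2" using assms by (simp add: power2_eq_square)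
    with False have "?n x + - ((r / 2)\<^sup>2) > 0" by linarith
    then show ?thesis using flat_pos[of "?n x + - ((r / 2)\<^sup>2)" 0] flat_nonneg[of 0] by (smt (verit))
  qed
  have sn: "smooth_closure UNIV ?n"
    by (intro smooth_closure_sum smooth_closure.mult smooth_closure.add smooth_closure.base
        smooth_on_const smooth_on_linear bounded_linear_inner_left) simp
  \<comment> \<open>Division is written as the power -1, since \<open>smooth_closure\<close> has
    positive powers of its members with any real exponent as generators.\<close>
  let ?b = "\<lambda>x. ?u x * (?u x + ?w x) powr (- 1)"
  have b: "?b x = ?u x / (?u x + ?w x)" for x
    using pos[of x] by (simp add: powr_minus_divide)
  show thesis
  proof
    show "smooth_on UNIV ?b"
      by (rule smooth_closure_imp_smooth, simp,
          intro smooth_closure.mult smooth_closure.powr smooth_closure.add smooth_closure.flat sn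
            smooth_closure.base[OF smooth_on_const] pos)
    show "0 \<le> ?b x" for x using flat_nonneg by simp
    show "?b x \<le> 1" for x
      unfolding b using pos[of x] flat_nonneg[of 0 "?n x + - ((r / 2)\<^sup>2)"] by (simp add: divide_le_eq)
    show "?b x = 1" if "x \<in> ball a (r / 2)" for x
    proof -
      have "norm (x - a) < r / 2" using that by (simp add: dist_norm norm_minus_commute)
      then have "(norm (x - a))\<^sup>2 \<le> (r / 2)\<^sup>2" by (intro power_mono) auto
      then have "?w x = 0" unfolding n by (intro flat_zero) simp
      then show ?thesis unfolding b using pos[of x] by simp
    qed
    show "?b x = 0" if "x \<notin> ball a r" for x
    proof -
      have "r \<le> norm (x - a)" using that by (simp add: dist_norm norm_minus_commute)
      then have "r\<^sup>2 \<le> (norm (x - a))\<^sup>2" using assms by (intro power_mono) auto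
      then have "?u x = 0" unfolding n by (intro flat_zero) simp
      then show ?thesis by simp
    qed
  qed
qed

lemma smooth_on_ray_integral:
  fixes f :: "'e::euclidean_space \<Rightarrow> real"
  assumes C: "open C" "convex C" "a \<in> C" and f: "smooth_on C f"
  shows "smooth_on C (\<lambda>x. integral (cbox 0 1) (\<lambda>t::real. t ^ m * f (a + t *\<^sub>R (x - a))))"
proof (rule smooth_on_coinduct[where P="\<lambda>k. \<exists>m f. smooth_on C f \<and>
    k = (\<lambda>x. integral (cbox 0 1) (\<lambda>t::real. t ^ m * f (a + t *\<^sub>R (x - a))))"])
  have seg: "a + t *\<^sub>R (x - a) \<in> C" if "x \<in> C" "t \<in> cbox 0 1" for x t
    using convexD_alt[OF C(2,3), of x t] that by (auto simp: algebra_simps)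
  fix k assume "\<exists>m f. smooth_on C f \<and> k = (\<lambda>x. integral (cbox 0 1) (\<lambda>t::real. t ^ m * f (a + t *\<^sub>R (x - a))))"
  then obtain m f where f: "smooth_on C f"
    and k: "k = (\<lambda>x. integral (cbox 0 1) (\<lambda>t::real. t ^ m * f (a + t *\<^sub>R (x - a))))" by blast
  let ?f = "\<lambda>x. frechet_derivative f (at x)"
  \<comment> \<open>The derivative in x of the integrand, assembled as a bounded linear function
    because \<open>leibniz_rule\<close> expects one.\<close>
  let ?D = "\<lambda>x t. \<Sum>b\<in>Basis. (t ^ Suc m * ?f (a + t *\<^sub>R (x - a)) b) *\<^sub>R blinfun_inner_right b"
  have cont: "continuous_on (C \<times> cbox 0 1) (\<lambda>(x, t). h (a + t *\<^sub>R (x - a)))"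
    if "smooth_on C h" for h :: "'e \<Rightarrow> real"
    unfolding case_prod_unfold
    by (rule continuous_on_compose2[OF smooth_on_continuous[OF that]])
       (use seg in \<open>auto intro!: continuous_intros\<close>)
  have cont_t: "continuous_on (cbox 0 1) (\<lambda>t. h (a + t *\<^sub>R (x - a)))"
    if "smooth_on C h" "x \<in> C" for h :: "'e \<Rightarrow> real" and x
    by (rule continuous_on_compose2[OF smooth_on_continuous[OF that(1)]])
       (use seg that in \<open>auto intro!: continuous_intros\<close>)
  have D: "?D x t v = t ^ Suc m * ?f (a + t *\<^sub>R (x - a)) v" if "x \<in> C" "t \<in> cbox 0 1" for x t v
  proof -
    have "linear (?f (a + t *\<^sub>R (x - a)))"
      using smooth_on_has_derivative[OF f seg[OF that]] has_derivative_linear by blast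
    then have "?f (a + t *\<^sub>R (x - a)) v = (\<Sum>b\<in>Basis. (v \<bullet> b) * ?f (a + t *\<^sub>R (x - a)) b)"
      by (subst euclidean_representation[of v, symmetric]) (simp add: linear_sum linear_scale del: euclidean_representation)
    then show ?thesis
      by (simp add: blinfun.sum_left blinfun.scaleR_left sum_distrib_left inner_commute mult_ac)
  qed
  have "(k has_derivative integral (cbox 0 1) (?D x)) (at x)" if x: "x \<in> C" for x
  proof -
    have "(k has_derivative integral (cbox 0 1) (?D x)) (at x within C)"
      unfolding k
    proof (rule leibniz_rule[OF _ _ _ x C(2)])
      fix y and t :: real assume y: "y \<in> C" "t \<in> cbox 0 1"
      have "((\<lambda>y. a + t *\<^sub>R (y - a)) has_derivative (\<lambda>v. t *\<^sub>R v)) (at y within C)"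
        by (auto intro!: derivative_eq_intros)
      then have "((\<lambda>y. f (a + t *\<^sub>R (y - a))) has_derivative (\<lambda>v. ?f (a + t *\<^sub>R (y - a)) (t *\<^sub>R v)))
          (at y within C)"
        using has_derivative_compose smooth_on_has_derivative[OF f seg[OF y]] by blast
      moreover have "linear (?f (a + t *\<^sub>R (y - a)))"
        using smooth_on_has_derivative[OF f seg[OF y]] has_derivative_linear by blast
      ultimately have "((\<lambda>y. t ^ m * f (a + t *\<^sub>R (y - a))) has_derivative
          (\<lambda>v. t ^ m * (t * ?f (a + t *\<^sub>R (y - a)) v))) (at y within C)"
        by (intro has_derivative_mult_right) (simp add: linear_scale)
      moreover have "(\<lambda>v. t ^ m * (t * ?f (a + t *\<^sub>R (y - a)) v)) = blinfun_apply (?D y t)"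
        using D[OF y] by auto
      ultimately show "((\<lambda>y. t ^ m * f (a + t *\<^sub>R (y - a))) has_derivative blinfun_apply (?D y t))
          (at y within C)"
        by simp
    next
      fix y assume "y \<in> C"
      then show "(\<lambda>t. t ^ m * f (a + t *\<^sub>R (y - a))) integrable_on cbox 0 1"
        by (intro integrable_continuous continuous_on_mult cont_t f continuous_intros)
    next
      show "continuous_on (C \<times> cbox 0 1) (\<lambda>(x, t). ?D x t)"
        using cont[OF smooth_on_frechet_derivative[OF f]]
        unfolding case_prod_unfold by (intro continuous_intros) auto
    qed
    then show ?thesis using at_within_open[OF x C(1)] by simp
  qed
  moreover have "integral (cbox 0 1) (?D x) v =
      integral (cbox 0 1) (\<lambda>t. t ^ Suc m * ?f (a + t *\<^sub>R (x - a)) v)" if x: "x \<in> C" for x v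
  proof -
    have "?D x integrable_on cbox 0 1"
      by (intro integrable_continuous continuous_intros cont_t[OF smooth_on_frechet_derivative[OF f] x])
    then have "integral (cbox 0 1) (?D x) v = integral (cbox 0 1) (\<lambda>t. ?D x t v)"
      using integral_linear[of "?D x" "cbox 0 1" "\<lambda>h. blinfun_apply h v"]
      by (simp add: o_def blinfun.bounded_linear_left)
    also have "\<dots> = integral (cbox 0 1) (\<lambda>t. t ^ Suc m * ?f (a + t *\<^sub>R (x - a)) v)"
      by (rule integral_cong) (use D[OF x] in auto)
    finally show ?thesis .
  qed
  ultimately have "\<forall>x\<in>C. (k has_derivative
      (\<lambda>v. integral (cbox 0 1) (\<lambda>t. t ^ Suc m * ?f (a + t *\<^sub>R (x - a)) v))) (at x)"
    by (metis (no_types, lifting) ext)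
  then show "\<exists>k'. (\<forall>x\<in>C. (k has_derivative k' x) (at x)) \<and>
      (\<forall>v. \<exists>m f. smooth_on C f \<and>
        (\<lambda>x. k' x v) = (\<lambda>x. integral (cbox 0 1) (\<lambda>t::real. t ^ m * f (a + t *\<^sub>R (x - a)))))"
    using smooth_on_frechet_derivative[OF f]
    by (intro exI[of _ "\<lambda>x v. integral (cbox 0 1) (\<lambda>t. t ^ Suc m * ?f (a + t *\<^sub>R (x - a)) v)"]) blast
qed (use assms in blast)+

text \<open>Integrate the derivative of f along the segment from a to x and split the direction x -
  a into basis vectors; each coefficient is a ray integral, hence smooth up to and including
  a.\<close>

lemma hadamard_expansion:
  fixes f :: "'e::euclidean_space \<Rightarrow> real"
  assumes C: "open C" "convex C" "a \<in> C" and f: "smooth_on C f"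
  obtains h where "\<And>b. smooth_on C (h b)" "\<And>b. h b a = frechet_derivative f (at a) b"
    "\<And>x. x \<in> C \<Longrightarrow> f x = f a + (\<Sum>b\<in>Basis. ((x - a) \<bullet> b) * h b x)"
proof -
  let ?f = "\<lambda>x. frechet_derivative f (at x)"
  define h where "h b x = integral (cbox 0 1) (\<lambda>t::real. t ^ 0 * ?f (a + t *\<^sub>R (x - a)) b)" for b x
  show thesis
  proof
    show "smooth_on C (h b)" for b
      unfolding h_def by (rule smooth_on_ray_integral[OF C smooth_on_frechet_derivative[OF f]])
    show "h b a = ?f a b" for b by (simp add: h_def)
    fix x assume x: "x \<in> C"
    have seg: "a + t *\<^sub>R (x - a) \<in> C" if "t \<in> {0..1}" for t
      using convexD_alt[OF C(2,3), of x t] x that by (auto simp: algebra_simps)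
    have "((\<lambda>t. f (a + t *\<^sub>R (x - a))) has_vector_derivative ?f (a + t *\<^sub>R (x - a)) (x - a))
        (at t within {0..1})" if t: "t \<in> {0..1}" for t
    proof -
      have "((\<lambda>t. a + t *\<^sub>R (x - a)) has_derivative (\<lambda>s. s *\<^sub>R (x - a))) (at t within {0..1})"
        by (auto intro!: derivative_eq_intros)
      then have "((\<lambda>t. f (a + t *\<^sub>R (x - a))) has_derivative
          (\<lambda>s. ?f (a + t *\<^sub>R (x - a)) (s *\<^sub>R (x - a)))) (at t within {0..1})"
        using has_derivative_compose smooth_on_has_derivative[OF f seg[OF t]] by blast
      moreover have "linear (?f (a + t *\<^sub>R (x - a)))"
        using smooth_on_has_derivative[OF f seg[OF t]] has_derivative_linear by blast
      ultimately show ?thesis by (simp add: has_vector_derivative_def linear_scale)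
    qed
    from fundamental_theorem_of_calculus[OF _ this]
    have "((\<lambda>t. ?f (a + t *\<^sub>R (x - a)) (x - a)) has_integral f x - f a) {0..1}"
      by simp
    then have fx: "f x - f a = integral {0..1} (\<lambda>t. ?f (a + t *\<^sub>R (x - a)) (x - a))"
      by (simp add: integral_unique)
    also have "\<dots> = integral {0..1} (\<lambda>t. \<Sum>b\<in>Basis. ((x - a) \<bullet> b) * ?f (a + t *\<^sub>R (x - a)) b)"
    proof (rule integral_cong)
      fix t :: real assume t: "t \<in> {0..1}"
      have "linear (?f (a + t *\<^sub>R (x - a)))"
        using smooth_on_has_derivative[OF f seg[OF t]] has_derivative_linear by blast
      then show "?f (a + t *\<^sub>R (x - a)) (x - a) = (\<Sum>b\<in>Basis. ((x - a) \<bullet> b) * ?f (a + t *\<^sub>R (x - a)) b)"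
        by (subst (2) euclidean_representation[of "x - a", symmetric])
           (simp add: linear_sum linear_scale del: euclidean_representation)
    qed
    also have "\<dots> = (\<Sum>b\<in>Basis. ((x - a) \<bullet> b) * h b x)"
    proof -
      have "(\<lambda>t. ?f (a + t *\<^sub>R (x - a)) b) integrable_on {0..1}" for b
        by (rule integrable_continuous_real,
            rule continuous_on_compose2[OF smooth_on_continuous[OF smooth_on_frechet_derivative[OF f]]])
           (use seg in \<open>auto intro!: continuous_intros\<close>)
      then show ?thesis
        by (subst integral_sum) (auto simp: h_def intro: integrable_on_mult_right)
    qed
    finally show "f x = f a + (\<Sum>b\<in>Basis. ((x - a) \<bullet> b) * h b x)" by simp
  qed
qed

section \<open>Smooth functions and vector fields on a manifold\<close>

lemma sum_fun_apply: "(\<Sum>i\<in>I. F i) x = (\<Sum>i\<in>I. F i x)"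
  for F :: "'i \<Rightarrow> 'b \<Rightarrow> 'c::comm_monoid_add"
  by (induction I rule: infinite_finite_induct) auto

lemma tscale_apply: "(c *\<^sub>T v) f = c * v f"
  by (simp add: tscale_def)

lemma fscale_apply: "(f *\<^sub>F X) p = f p *\<^sub>T X p"
  by (simp add: fscale_def)

interpretation tvec: vector_space "tscale :: real \<Rightarrow> 'a tvec \<Rightarrow> 'a tvec"
  by unfold_locales (auto simp: tscale_def fun_eq_iff algebra_simps)

locale smooth_manifold =
  fixes \<A> :: "('a::t2_space, 'e::euclidean_space) chart set"
  assumes atlas: "smooth_atlas \<A>"
begin

abbreviation "TS \<equiv> tangent_space \<A>"

lemma chart:
  assumes "(U, \<kappa>) \<in> \<A>"
  shows chart_open: "open U" and chart_image: "open (\<kappa> ` U)"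
    and chart_cont: "continuous_on U \<kappa>" and chart_inv_cont: "continuous_on (\<kappa> ` U) (inv_into U \<kappa>)"
    and chart_inv: "\<And>q. q \<in> U \<Longrightarrow> inv_into U \<kappa> (\<kappa> q) = q"
    and chart_inv_in: "\<And>y. y \<in> \<kappa> ` U \<Longrightarrow> inv_into U \<kappa> y \<in> U"
    and chart_of_inv: "\<And>y. y \<in> \<kappa> ` U \<Longrightarrow> \<kappa> (inv_into U \<kappa> y) = y"
proof -
  from atlas assms have *: "open U \<and> open (\<kappa> ` U) \<and> homeomorphism U (\<kappa> ` U) \<kappa> (inv_into U \<kappa>)"
    unfolding smooth_atlas_def by fast
  then show "open U" "open (\<kappa> ` U)" "continuous_on U \<kappa>" "continuous_on (\<kappa> ` U) (inv_into U \<kappa>)"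
    "\<And>q. q \<in> U \<Longrightarrow> inv_into U \<kappa> (\<kappa> q) = q"
    by (auto simp: homeomorphism_def)
  show "\<And>y. y \<in> \<kappa> ` U \<Longrightarrow> inv_into U \<kappa> y \<in> U" by (rule inv_into_into)
  show "\<And>y. y \<in> \<kappa> ` U \<Longrightarrow> \<kappa> (inv_into U \<kappa> y) = y" by (rule f_inv_into_f)
qed

lemma chart_at: obtains U \<kappa> where "(U, \<kappa>) \<in> \<A>" "p \<in> U"
proof -
  from atlas have "(\<Union>(U, \<kappa>)\<in>\<A>. U) = UNIV" unfolding smooth_atlas_def by fast
  then show thesis using that by fast
qed

lemma transition:
  assumes "(U, \<kappa>) \<in> \<A>" "(V, \<mu>) \<in> \<A>"
  shows "smooth_on (\<kappa> ` (U \<inter> V)) (\<mu> \<circ> inv_into U \<kappa>)"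
  using atlas assms unfolding smooth_atlas_def by fast

lemma chart_preimage_open: "(U, \<kappa>) \<in> \<A> \<Longrightarrow> open C \<Longrightarrow> open (U \<inter> \<kappa> -` C)"
  by (rule continuous_open_preimage) (auto intro: chart_cont chart_open)

lemma chart_image_open:
  assumes "(U, \<kappa>) \<in> \<A>" "open W"
  shows "open (\<kappa> ` (U \<inter> W))"
proof -
  have "\<kappa> ` (U \<inter> W) = \<kappa> ` U \<inter> inv_into U \<kappa> -` W"
    using chart_inv[OF assms(1)] by (auto 4 3)
  then show ?thesis
    using continuous_open_preimage[OF chart_inv_cont[OF assms(1)] chart_image[OF assms(1)] assms(2)]
    by simp
qed

lemma smooth_funD: "smooth_fun \<A> f \<Longrightarrow> (U, \<kappa>) \<in> \<A> \<Longrightarrow> smooth_on (\<kappa> ` U) (\<lambda>y. f (inv_into U \<kappa> y))"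
  unfolding smooth_fun_def by (auto simp: o_def)

lemma smooth_funI:
  "(\<And>U \<kappa>. (U, \<kappa>) \<in> \<A> \<Longrightarrow> smooth_on (\<kappa> ` U) (\<lambda>y. f (inv_into U \<kappa> y))) \<Longrightarrow> smooth_fun \<A> f"
  unfolding smooth_fun_def by (auto simp: o_def)

lemma smooth_fun_const: "smooth_fun \<A> (\<lambda>x. c)"
  by (rule smooth_funI) (rule smooth_on_const)

lemma smooth_fun_add: "smooth_fun \<A> f \<Longrightarrow> smooth_fun \<A> h \<Longrightarrow> smooth_fun \<A> (\<lambda>x. f x + h x)"
  by (rule smooth_funI) (rule smooth_on_add[OF chart_image smooth_funD smooth_funD])

lemma smooth_fun_mult: "smooth_fun \<A> f \<Longrightarrow> smooth_fun \<A> h \<Longrightarrow> smooth_fun \<A> (\<lambda>x. f x * h x)"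
  by (rule smooth_funI) (rule smooth_on_mult[OF chart_image smooth_funD smooth_funD])

lemma smooth_fun_powr: "smooth_fun \<A> f \<Longrightarrow> (\<And>x. f x > 0) \<Longrightarrow> smooth_fun \<A> (\<lambda>x. f x powr a)"
  by (rule smooth_funI) (rule smooth_on_powr[OF chart_image smooth_funD])

lemma smooth_fun_minus: "smooth_fun \<A> f \<Longrightarrow> smooth_fun \<A> (\<lambda>x. - f x)"
  using smooth_fun_mult[OF smooth_fun_const[of "-1"]] by simp

lemma smooth_fun_diff: "smooth_fun \<A> f \<Longrightarrow> smooth_fun \<A> h \<Longrightarrow> smooth_fun \<A> (\<lambda>x. f x - h x)"
  using smooth_fun_add[OF _ smooth_fun_minus] by simp

lemma smooth_fun_sum:
  "(\<And>i. i \<in> I \<Longrightarrow> smooth_fun \<A> (f i)) \<Longrightarrow> smooth_fun \<A> (\<lambda>x. \<Sum>i\<in>I. f i x)"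
  by (induction I rule: infinite_finite_induct) (auto intro: smooth_fun_add smooth_fun_const)

lemmas smooth_intros = smooth_fun_const smooth_fun_add smooth_fun_mult smooth_fun_minus
  smooth_fun_diff smooth_fun_sum

lemma smooth_fun_continuous:
  assumes "smooth_fun \<A> f" shows "continuous_on UNIV f"
proof (rule continuous_at_imp_continuous_on, rule ballI)
  fix p
  obtain U \<kappa> where c: "(U, \<kappa>) \<in> \<A>" "p \<in> U" by (rule chart_at)
  have "continuous_on U (\<lambda>q. f (inv_into U \<kappa> (\<kappa> q)))"
    by (rule continuous_on_compose2[OF smooth_on_continuous[OF smooth_funD[OF assms c(1)]]
          chart_cont[OF c(1)]]) auto
  then have "continuous_on U f"
    by (rule continuous_on_cong[THEN iffD1, rotated -1]) (auto simp: chart_inv[OF c(1)])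
  then show "isCont f p" using c chart_open by (simp add: continuous_on_eq_continuous_at)
qed

text \<open>Smoothness is local: on the open set where the chart formula holds f is h in
  coordinates, on the complement of K it is 0, and these two open sets cover since K lies in the
  first.\<close>

lemma smooth_fun_extend:
  assumes c: "(U, \<kappa>) \<in> \<A>" and C: "open C" "C \<subseteq> \<kappa> ` U" and h: "smooth_on C h"
    and K: "closed K" "K \<subseteq> U \<inter> \<kappa> -` C"
    and f: "\<And>q. q \<in> U \<Longrightarrow> \<kappa> q \<in> C \<Longrightarrow> f q = h (\<kappa> q)" "\<And>q. q \<notin> K \<Longrightarrow> f q = 0"
  shows "smooth_fun \<A> f"
proof (rule smooth_funI)
  fix V \<mu> assume c': "(V, \<mu>) \<in> \<A>"
  let ?W = "U \<inter> \<kappa> -` C" and ?f = "\<lambda>y. f (inv_into V \<mu> y)"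
  have oW: "open (\<mu> ` (V \<inter> ?W))" by (rule chart_image_open[OF c' chart_preimage_open[OF c C(1)]])
  have oK: "open (\<mu> ` (V \<inter> - K))" by (rule chart_image_open[OF c']) (use K in auto)
  have "smooth_on (\<mu> ` (V \<inter> ?W)) (\<lambda>y. h ((\<kappa> \<circ> inv_into V \<mu>) y))"
    by (rule smooth_on_compose[OF oW h smooth_on_subset[OF transition[OF c' c]]])
       (auto simp: chart_inv[OF c'])
  then have 1: "smooth_on (\<mu> ` (V \<inter> ?W)) ?f"
    by (rule smooth_on_cong[OF oW, rotated]) (auto simp: chart_inv[OF c'] f(1))
  have 2: "smooth_on (\<mu> ` (V \<inter> - K)) ?f"
    by (rule smooth_on_cong[OF oK _ smooth_on_const[of _ 0]]) (auto simp: chart_inv[OF c'] f(2))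
  have "\<mu> ` (V \<inter> ?W) \<union> \<mu> ` (V \<inter> - K) = \<mu> ` V" using K(2) by blast
  then show "smooth_on (\<mu> ` V) ?f" using smooth_on_Un[OF oW oK 1 2] by simp
qed

lemma bump:
  assumes c: "(U, \<kappa>) \<in> \<A>" and p: "p \<in> U" "\<kappa> p \<in> C" and C: "open C"
  obtains \<psi> K V where "smooth_fun \<A> \<psi>" "closed K" "K \<subseteq> U \<inter> \<kappa> -` C" "open V" "p \<in> V" "V \<subseteq> K"
    "\<And>q. 0 \<le> \<psi> q" "\<And>q. \<psi> q \<le> 1" "\<And>q. q \<in> V \<Longrightarrow> \<psi> q = 1" "\<And>q. q \<notin> K \<Longrightarrow> \<psi> q = 0"
proof -
  have "open (\<kappa> ` U \<inter> C)" "\<kappa> p \<in> \<kappa> ` U \<inter> C" using chart_image[OF c] C p by auto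
  then obtain r where r: "r > 0" "cball (\<kappa> p) r \<subseteq> \<kappa> ` U \<inter> C" using open_contains_cball by metis
  obtain \<beta> :: "'e \<Rightarrow> real" where \<beta>: "smooth_on UNIV \<beta>" "\<And>x. 0 \<le> \<beta> x" "\<And>x. \<beta> x \<le> 1"
    "\<And>x. x \<in> ball (\<kappa> p) (r / 2) \<Longrightarrow> \<beta> x = 1" "\<And>x. x \<notin> ball (\<kappa> p) r \<Longrightarrow> \<beta> x = 0"
    using smooth_cutoff[OF r(1)] by metis
  define K where "K = inv_into U \<kappa> ` cball (\<kappa> p) r"
  define V where "V = U \<inter> \<kappa> -` ball (\<kappa> p) (r / 2)"
  define \<psi> where "\<psi> q = (if q \<in> U then \<beta> (\<kappa> q) else 0)" for q
  have K_iff: "q \<in> K \<longleftrightarrow> q \<in> U \<and> \<kappa> q \<in> cball (\<kappa> p) r" for q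
  proof
    assume "q \<in> K"
    then obtain y where "y \<in> cball (\<kappa> p) r" "q = inv_into U \<kappa> y" "y \<in> \<kappa> ` U" using r(2) K_def by blast
    then show "q \<in> U \<and> \<kappa> q \<in> cball (\<kappa> p) r" using chart_inv_in[OF c] chart_of_inv[OF c] by metis
  next
    assume "q \<in> U \<and> \<kappa> q \<in> cball (\<kappa> p) r"
    then show "q \<in> K" unfolding K_def using chart_inv[OF c, of q] by (metis image_eqI)
  qed
  \<comment> \<open>The image of a compact ball is compact; the Hausdorff axiom then makes it closed
    in the whole manifold, as extension by zero requires.\<close>
  have "compact K"
    unfolding K_def by (rule compact_continuous_image[OF continuous_on_subset[OF chart_inv_cont[OF c]]])
      (use r in auto)
  then have closed: "closed K" by (rule compact_imp_closed)
  have KU: "K \<subseteq> U \<inter> \<kappa> -` (\<kappa> ` U \<inter> C)" 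
  proof
    fix q assume "q \<in> K"
    then have "q \<in> U" "\<kappa> q \<in> cball (\<kappa> p) r" by (simp_all only: K_iff)
    with r(2) show "q \<in> U \<inter> \<kappa> -` (\<kappa> ` U \<inter> C)" by blast
  qed
  have zero: "\<psi> q = 0" if "q \<notin> K" for q
  proof (cases "q \<in> U")
    case True
    then have "\<kappa> q \<notin> ball (\<kappa> p) r" using that K_iff[of q] by auto
    then show ?thesis using \<beta>(5) by (simp add: \<psi>_def)
  qed (simp add: \<psi>_def)
  show thesis
  proof
    show "smooth_fun \<A> \<psi>"
      by (rule smooth_fun_extend[OF c _ _ smooth_on_subset[OF \<beta>(1)] closed KU])
         (use zero chart_image[OF c] C in \<open>auto simp: \<psi>_def\<close>)
    show "open V" unfolding V_def by (rule chart_preimage_open[OF c]) simp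
    show "p \<in> V" using p r by (simp add: V_def)
    show "V \<subseteq> K" 
    proof
      fix q assume "q \<in> V"
      then have "q \<in> U" "\<kappa> q \<in> ball (\<kappa> p) (r / 2)" by (auto simp: V_def)
      then show "q \<in> K" using r(1) by (auto simp only: K_iff mem_ball mem_cball)
    qed
    show "closed K" by (rule closed)
    show "K \<subseteq> U \<inter> \<kappa> -` C" using KU by blast
    show "0 \<le> \<psi> q" "\<psi> q \<le> 1" for q using \<beta>(2,3) by (auto simp: \<psi>_def)
    show "\<psi> q = 1" if "q \<in> V" for q using that \<beta>(4) by (auto simp: \<psi>_def V_def)
  qed (rule zero)
qed

lemma bump_open:
  assumes "open W" "p \<in> W"
  obtains \<psi> V where "smooth_fun \<A> \<psi>" "open V" "p \<in> V" "V \<subseteq> W"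
    "\<And>q. 0 \<le> \<psi> q" "\<And>q. \<psi> q \<le> 1" "\<And>q. q \<in> V \<Longrightarrow> \<psi> q = 1" "\<And>q. q \<notin> W \<Longrightarrow> \<psi> q = 0"
proof -
  obtain U \<kappa> where c: "(U, \<kappa>) \<in> \<A>" "p \<in> U" by (rule chart_at)
  have o: "open (\<kappa> ` (U \<inter> W))" by (rule chart_image_open[OF c(1) assms(1)])
  have "U \<inter> \<kappa> -` (\<kappa> ` (U \<inter> W)) \<subseteq> W"
  proof
    fix q assume q: "q \<in> U \<inter> \<kappa> -` (\<kappa> ` (U \<inter> W))"
    then obtain q' where "q' \<in> U \<inter> W" "\<kappa> q = \<kappa> q'" by blast
    then show "q \<in> W" using chart_inv[OF c(1), of q] chart_inv[OF c(1), of q'] q by auto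
  qed
  note sub = this
  have "\<kappa> p \<in> \<kappa> ` (U \<inter> W)" using assms(2) c(2) by blast
  then obtain \<psi> K V where "smooth_fun \<A> \<psi>" "closed K" "K \<subseteq> U \<inter> \<kappa> -` (\<kappa> ` (U \<inter> W))"
    "open V" "p \<in> V" "V \<subseteq> K" "\<And>q. 0 \<le> \<psi> q" "\<And>q. \<psi> q \<le> 1" "\<And>q. q \<in> V \<Longrightarrow> \<psi> q = 1"
    "\<And>q. q \<notin> K \<Longrightarrow> \<psi> q = 0"
    by (rule bump[OF c _ o]) (rule that)
  then show thesis using sub by (intro that[of \<psi> V]) blast+
qed

subsection \<open>Tangent vectors\<close>

lemma tangent_nonsmooth: "v \<in> TS p \<Longrightarrow> \<not> smooth_fun \<A> f \<Longrightarrow> v f = 0"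
  by (simp add: tangent_space_def)

lemma tangent_add: "v \<in> TS p \<Longrightarrow> smooth_fun \<A> f \<Longrightarrow> smooth_fun \<A> h \<Longrightarrow> v (\<lambda>x. f x + h x) = v f + v h"
  by (simp add: tangent_space_def)

lemma tangent_cmult: "v \<in> TS p \<Longrightarrow> smooth_fun \<A> f \<Longrightarrow> v (\<lambda>x. c * f x) = c * v f"
  by (simp add: tangent_space_def)

lemma tangent_mult:
  "v \<in> TS p \<Longrightarrow> smooth_fun \<A> f \<Longrightarrow> smooth_fun \<A> h \<Longrightarrow> v (\<lambda>x. f x * h x) = f p * v h + h p * v f"
  by (simp add: tangent_space_def)

text \<open>The Leibniz rule for 1 * 1 = 1 gives v 1 = 2 * v 1.\<close>

lemma tangent_const:
  assumes "v \<in> TS p" shows "v (\<lambda>x. c) = 0"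
  using tangent_mult[OF assms smooth_fun_const[of 1] smooth_fun_const[of 1]]
    tangent_cmult[OF assms smooth_fun_const[of 1], of c]
  by simp

lemma tangent_minus: "v \<in> TS p \<Longrightarrow> smooth_fun \<A> f \<Longrightarrow> v (\<lambda>x. - f x) = - v f"
  using tangent_cmult[of v p f "-1"] by simp

lemma tangent_diff: "v \<in> TS p \<Longrightarrow> smooth_fun \<A> f \<Longrightarrow> smooth_fun \<A> h \<Longrightarrow> v (\<lambda>x. f x - h x) = v f - v h"
  using tangent_add[of v p f "\<lambda>x. - h x"] by (simp add: tangent_minus smooth_fun_minus)

lemma tangent_sum:
  assumes "v \<in> TS p" "\<And>i. i \<in> I \<Longrightarrow> smooth_fun \<A> (f i)"
  shows "v (\<lambda>x. \<Sum>i\<in>I. f i x) = (\<Sum>i\<in>I. v (f i))"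
  using assms(2)
  by (induction I rule: infinite_finite_induct)
     (auto simp: tangent_const[OF assms(1)] tangent_add[OF assms(1)] smooth_fun_sum)

text \<open>With a bump function \<psi> supported in W, the product \<psi> * (f - h) is identically
  0, while the Leibniz rule evaluates v on it as v f - v h.\<close>

lemma tangent_local:
  assumes v: "v \<in> TS p" and sm: "smooth_fun \<A> f" "smooth_fun \<A> h"
    and W: "open W" "p \<in> W" "\<And>q. q \<in> W \<Longrightarrow> f q = h q"
  shows "v f = v h"
proof -
  obtain \<psi> where \<psi>: "smooth_fun \<A> \<psi>" "\<psi> p = 1" "\<And>q. q \<notin> W \<Longrightarrow> \<psi> q = 0"
    using bump_open[OF W(1,2)] by metis
  have "(\<lambda>q. \<psi> q * (f q - h q)) = (\<lambda>q. 0)" using \<psi>(3) W(3) by fastforce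
  then have "v (\<lambda>q. \<psi> q * (f q - h q)) = 0" using tangent_const[OF v] by simp
  then show ?thesis
    using tangent_mult[OF v \<psi>(1) smooth_fun_diff[OF sm]] tangent_diff[OF v sm] \<psi>(2) W(2,3) by simp
qed

lemma tangent_space_add: "u \<in> TS p \<Longrightarrow> v \<in> TS p \<Longrightarrow> u + v \<in> TS p"
  by (auto simp: tangent_space_def algebra_simps)

lemma tangent_space_scale: "v \<in> TS p \<Longrightarrow> c *\<^sub>T v \<in> TS p"
  by (auto simp: tangent_space_def tscale_def algebra_simps)

lemma tangent_space_zero: "0 \<in> TS p"
  by (auto simp: tangent_space_def)

lemma tangent_subspace: "tvec.subspace (TS p)"
  by (simp add: tvec.subspace_def tangent_space_add tangent_space_scale tangent_space_zero)

lemma tangent_space_minus: "v \<in> TS p \<Longrightarrow> - v \<in> TS p"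
  using tvec.subspace_neg[OF tangent_subspace] .

lemma tangent_space_diff: "u \<in> TS p \<Longrightarrow> v \<in> TS p \<Longrightarrow> u - v \<in> TS p"
  using tvec.subspace_diff[OF tangent_subspace] .

text \<open>Coordinate derivations and coordinate functions of a chart are cut off by a bump
  function to become global. That they span is Hadamard's lemma: a derivation at q is determined by
  its values on the coordinates.\<close>

lemma coordinate_fields:
  obtains E :: "'e \<Rightarrow> 'a vfield" and x :: "'e \<Rightarrow> 'a \<Rightarrow> real" and V where
    "open V" "p \<in> V" "\<And>b. vector_field \<A> (E b)"
    "\<And>b b' q. b \<in> Basis \<Longrightarrow> b' \<in> Basis \<Longrightarrow> q \<in> V \<Longrightarrow> E b q (x b') = (if b = b' then 1 else 0)"
    "\<And>q v. q \<in> V \<Longrightarrow> v \<in> TS q \<Longrightarrow> v = (\<Sum>b\<in>Basis. v (x b) *\<^sub>T E b q)"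
proof -
  obtain U \<kappa> where c: "(U, \<kappa>) \<in> \<A>" "p \<in> U" by (rule chart_at)
  obtain r where r: "r > 0" "ball (\<kappa> p) r \<subseteq> \<kappa> ` U"
    using chart_image[OF c(1)] c(2) open_contains_ball by (metis image_eqI)
  let ?C = "ball (\<kappa> p) r"
  have "\<kappa> p \<in> ?C" using r by simp
  then obtain \<psi> K V where \<psi>: "smooth_fun \<A> \<psi>" and K: "closed K" "K \<subseteq> U \<inter> \<kappa> -` ?C"
    and V: "open V" "p \<in> V" "V \<subseteq> K"
    and "\<And>q. 0 \<le> \<psi> q" "\<And>q. \<psi> q \<le> 1"
    and \<psi>1: "\<And>q. q \<in> V \<Longrightarrow> \<psi> q = 1" and \<psi>0: "\<And>q. q \<notin> K \<Longrightarrow> \<psi> q = 0"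
    by (rule bump[OF c _ open_ball[of "\<kappa> p" r]]) (rule that)
  have VU: "q \<in> U" "\<kappa> q \<in> ?C" if "q \<in> V" for q using that K V(3) by auto
  have ext: "smooth_fun \<A> (\<lambda>q. if q \<in> U then \<psi> q * h (\<kappa> q) else 0)" if h: "smooth_on ?C h" for h
  proof (rule smooth_fun_extend[OF c(1) open_ball r(2) _ K])
    show "smooth_on ?C (\<lambda>y. \<psi> (inv_into U \<kappa> y) * h y)"
      by (rule smooth_on_mult[OF open_ball smooth_on_subset[OF smooth_funD[OF \<psi> c(1)] r(2)] h])
  qed (auto simp: \<psi>0 chart_inv[OF c(1)])
  let ?f = "\<lambda>f y. f (inv_into U \<kappa> y) :: real"
  \<comment> \<open>The value 0 on non-smooth f follows the convention in
    \<open>tangent_space\<close>.\<close>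
  define E where "E b q f = (if q \<in> U \<and> smooth_fun \<A> f
      then \<psi> q * frechet_derivative (?f f) (at (\<kappa> q)) b else 0)" for b q f
  define x where "x b q = (if q \<in> U then \<psi> q * (\<kappa> q \<bullet> b) else 0)" for b q
  have x: "smooth_fun \<A> (x b)" for b
    
    unfolding x_def
    by (rule ext[OF smooth_on_subset[OF smooth_on_linear[OF bounded_linear_inner_left]]]) simp
  have fd: "(?f f has_derivative frechet_derivative (?f f) (at (\<kappa> q))) (at (\<kappa> q))"
    if "smooth_fun \<A> f" "q \<in> U" for f q
    by (rule smooth_on_has_derivative[OF smooth_funD[OF that(1) c(1)]]) (use that(2) in simp)
  have "E b q \<in> TS q" for b q
  proof (cases "q \<in> U")
    case True
    note d = fd[OF _ True] and [simp] = chart_inv[OF c(1) True]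
    have "frechet_derivative (?f (\<lambda>x. f x + h x)) (at (\<kappa> q)) =
        (\<lambda>b. frechet_derivative (?f f) (at (\<kappa> q)) b + frechet_derivative (?f h) (at (\<kappa> q)) b)"
      if "smooth_fun \<A> f" "smooth_fun \<A> h" for f h
      by (rule frechet_derivative_at[OF has_derivative_add[OF d[OF that(1)] d[OF that(2)]], symmetric])
    moreover have "frechet_derivative (?f (\<lambda>x. c * f x)) (at (\<kappa> q)) =
        (\<lambda>b. c * frechet_derivative (?f f) (at (\<kappa> q)) b)"
      if "smooth_fun \<A> f" for f c
      by (rule frechet_derivative_at[OF has_derivative_mult_right[OF d[OF that]], symmetric])
    moreover have "frechet_derivative (?f (\<lambda>x. f x * h x)) (at (\<kappa> q)) =
        (\<lambda>b. ?f f (\<kappa> q) * frechet_derivative (?f h) (at (\<kappa> q)) b +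
          frechet_derivative (?f f) (at (\<kappa> q)) b * ?f h (\<kappa> q))"
      if "smooth_fun \<A> f" "smooth_fun \<A> h" for f h
      by (rule frechet_derivative_at[OF has_derivative_mult[OF d[OF that(1)] d[OF that(2)]], symmetric])
    ultimately show ?thesis
      using True by (auto simp: tangent_space_def E_def smooth_intros algebra_simps)
  next
    case False
    then show ?thesis by (auto simp: tangent_space_def E_def)
  qed
  moreover have "smooth_fun \<A> (\<lambda>q. E b q f)" if "smooth_fun \<A> f" for b f
    using ext[OF smooth_on_subset[OF smooth_on_frechet_derivative[OF smooth_funD[OF that c(1)]] r(2)], of b] that
    by (simp add: E_def)
  ultimately have vf: "vector_field \<A> (E b)" for b
    by (simp add: vector_field_def)
  have Ex: "E b q (x b') = (if b = b' then 1 else 0)" if b: "b \<in> Basis" "b' \<in> Basis" and q: "q \<in> V" for b b' q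
  proof -
    have "((\<lambda>y. y \<bullet> b') has_derivative (\<lambda>v. v \<bullet> b')) (at (\<kappa> q))"
      by (intro bounded_linear_imp_has_derivative bounded_linear_inner_left)
    then have "(?f (x b') has_derivative (\<lambda>v. v \<bullet> b')) (at (\<kappa> q))"
      by (rule has_derivative_transform_within_open[OF _ chart_image_open[OF c(1) V(1)]])
         (use q VU in \<open>auto simp: x_def chart_inv[OF c(1)] \<psi>1\<close>)
    then have "frechet_derivative (?f (x b')) (at (\<kappa> q)) = (\<lambda>v. v \<bullet> b')"
      using frechet_derivative_at by metis
    then show ?thesis using q b VU x by (simp add: E_def \<psi>1 inner_Basis)
  qed
  have span: "v = (\<Sum>b\<in>Basis. v (x b) *\<^sub>T E b q)" if q: "q \<in> V" and v: "v \<in> TS q" for q v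
  proof
    fix f
    show "v f = (\<Sum>b\<in>Basis. v (x b) *\<^sub>T E b q) f"
    proof (cases "smooth_fun \<A> f")
      case False
      then show ?thesis
        using tangent_nonsmooth[OF v] by (simp add: sum_fun_apply tscale_apply E_def)
    next
      case f: True
      let ?a = "\<kappa> q"
      obtain h where h: "\<And>b. smooth_on ?C (h b)" "\<And>b. h b ?a = frechet_derivative (?f f) (at ?a) b"
        "\<And>y. y \<in> ?C \<Longrightarrow> ?f f y = ?f f ?a + (\<Sum>b\<in>Basis. ((y - ?a) \<bullet> b) * h b y)"
        by (rule hadamard_expansion[OF open_ball convex_ball VU(2)[OF q]
              smooth_on_subset[OF smooth_funD[OF f c(1)] r(2)]]) (rule that)
      define H where "H b q = (if q \<in> U then \<psi> q * h b (\<kappa> q) else 0)" for b q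
      have H: "smooth_fun \<A> (H b)" for b unfolding H_def by (rule ext[OF h(1)])
      \<comment> \<open>Hadamard's expansion made global: one factor \<psi> is absorbed by the
        coordinate difference, the other by the coefficient \<open>H b\<close>.\<close>
      have id: "\<psi> q' * \<psi> q' * (f q' - f q) = (\<Sum>b\<in>Basis. (x b q' - (?a \<bullet> b) * \<psi> q') * H b q')" for q'
      proof (cases "q' \<in> K")
        case True
        then have "q' \<in> U" "\<kappa> q' \<in> ?C" using K by auto
        then show ?thesis
          using h(3)[of "\<kappa> q'"] VU(1)[OF q]
          by (simp add: chart_inv[OF c(1)] H_def x_def sum_distrib_left inner_diff_left algebra_simps)
      next
        case False
        then have "H b q' = 0" for b by (simp add: \<psi>0 H_def)
        then show ?thesis using False by (simp add: \<psi>0)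
      qed
      have "v f = v (\<lambda>q'. f q' - f q)" using tangent_diff[OF v f smooth_fun_const] tangent_const[OF v] by simp
      also have "\<dots> = v (\<lambda>q'. \<psi> q' * \<psi> q' * (f q' - f q))"
        by (rule tangent_local[OF v _ _ V(1) q]) (auto simp: \<psi>1 intro!: smooth_intros f \<psi>)
      also have "\<dots> = (\<Sum>b\<in>Basis. v (\<lambda>q'. (x b q' - (?a \<bullet> b) * \<psi> q') * H b q'))"
        unfolding id by (rule tangent_sum[OF v]) (intro smooth_intros x H \<psi>)
      also have "\<dots> = (\<Sum>b\<in>Basis. v (x b) * E b q f)"
      proof (rule sum.cong[OF refl])
        fix b :: 'e
        \<comment> \<open>Near q the function \<psi> is constantly 1, so the cutoff does not affect
          v.\<close>
        have v0: "v \<psi> = 0"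
          using tangent_local[OF v \<psi> smooth_fun_const[of 1] V(1) q] \<psi>1 tangent_const[OF v] by simp
        have "x b q = ?a \<bullet> b" "\<psi> q = 1" "H b q = E b q f"
          using VU[OF q] \<psi>1[OF q] f by (auto simp: x_def H_def E_def h(2))
        moreover have "v (\<lambda>q'. x b q' - (?a \<bullet> b) * \<psi> q') = v (x b)"
          using tangent_diff[OF v x smooth_fun_mult[OF smooth_fun_const \<psi>], of b "?a \<bullet> b"]
            tangent_cmult[OF v \<psi>, of "?a \<bullet> b"] v0 by simp
        ultimately show "v (\<lambda>q'. (x b q' - (?a \<bullet> b) * \<psi> q') * H b q') = v (x b) * E b q f"
          by (subst tangent_mult[OF v _ H]) (auto intro!: smooth_intros x \<psi>)
      qed
      finally show ?thesis by (simp add: sum_fun_apply tscale_apply)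
    qed
  qed
  show thesis by (rule that[OF V(1,2) vf Ex span])
qed

abbreviation "VF \<equiv> vector_field \<A>"

lemma VF_tangent: "VF X \<Longrightarrow> X p \<in> TS p"
  by (simp add: vector_field_def)

lemma VF_smooth: "VF X \<Longrightarrow> smooth_fun \<A> f \<Longrightarrow> smooth_fun \<A> (\<lambda>p. X p f)"
  by (simp add: vector_field_def)

lemma VF_add: "VF X \<Longrightarrow> VF Y \<Longrightarrow> VF (X + Y)"
  by (simp add: vector_field_def tangent_space_add smooth_fun_add)

lemma VF_scale: "smooth_fun \<A> f \<Longrightarrow> VF X \<Longrightarrow> VF (f *\<^sub>F X)"
  by (simp add: vector_field_def fscale_apply tscale_apply tangent_space_scale smooth_fun_mult)

lemma VF_minus: "VF X \<Longrightarrow> VF (- X)"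
  by (simp add: vector_field_def tangent_space_minus smooth_fun_minus)

lemma VF_diff: "VF X \<Longrightarrow> VF Y \<Longrightarrow> VF (X - Y)"
  by (simp add: vector_field_def tangent_space_diff smooth_fun_diff)

lemma VF_zero: "VF 0"
  by (simp add: vector_field_def tangent_space_zero smooth_fun_const)

lemma VF_sum: "(\<And>i. i \<in> I \<Longrightarrow> VF (F i)) \<Longrightarrow> VF (\<Sum>i\<in>I. F i)"
  by (induction I rule: infinite_finite_induct) (auto simp: VF_zero VF_add)

lemma sections_tangent: "sections \<A> TS = Collect VF"
  by (auto simp: sections_def vector_field_def)

end

section \<open>Local orthonormal fields of a Riemannian metric\<close>

locale riemannian_manifold = smooth_manifold \<A>
  for \<A> :: "('a::t2_space, 'e::euclidean_space) chart set" +
  fixes g :: "'a metric"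
  assumes metric: "riemannian_metric \<A> g"
begin

lemma g_sym: "u \<in> TS p \<Longrightarrow> v \<in> TS p \<Longrightarrow> g p u v = g p v u"
  using metric unfolding riemannian_metric_def by blast

lemma g_add_left: "u \<in> TS p \<Longrightarrow> v \<in> TS p \<Longrightarrow> w \<in> TS p \<Longrightarrow> g p (u + v) w = g p u w + g p v w"
  using metric unfolding riemannian_metric_def by blast

lemma g_scale_left: "u \<in> TS p \<Longrightarrow> v \<in> TS p \<Longrightarrow> g p (c *\<^sub>T u) v = c * g p u v"
  using metric unfolding riemannian_metric_def by blast

lemma g_pos: "v \<in> TS p \<Longrightarrow> v \<noteq> 0 \<Longrightarrow> g p v v > 0"
  using metric unfolding riemannian_metric_def by blast

lemma g_smooth: "VF X \<Longrightarrow> VF Y \<Longrightarrow> smooth_fun \<A> (\<lambda>p. g p (X p) (Y p))"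
  using metric unfolding riemannian_metric_def by blast

lemma g_add_right: "u \<in> TS p \<Longrightarrow> v \<in> TS p \<Longrightarrow> w \<in> TS p \<Longrightarrow> g p w (u + v) = g p w u + g p w v"
  using g_add_left[of u p v w] g_sym by (simp add: tangent_space_add)

lemma g_scale_right: "u \<in> TS p \<Longrightarrow> v \<in> TS p \<Longrightarrow> g p v (c *\<^sub>T u) = c * g p v u"
  using g_scale_left[of u p v] g_sym by (simp add: tangent_space_scale)

lemma g_zero_left: "v \<in> TS p \<Longrightarrow> g p 0 v = 0"
  using g_scale_left[of v p v 0] by simp

lemma g_zero_right: "v \<in> TS p \<Longrightarrow> g p v 0 = 0"
  using g_scale_right[of v p v 0] by simp

lemma g_minus_left: "u \<in> TS p \<Longrightarrow> v \<in> TS p \<Longrightarrow> g p (- u) v = - g p u v"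
  using g_scale_left[of u p v "-1"] by simp

lemma g_minus_right: "u \<in> TS p \<Longrightarrow> v \<in> TS p \<Longrightarrow> g p v (- u) = - g p v u"
  using g_scale_right[of u p v "-1"] by simp

lemma g_diff_left: "u \<in> TS p \<Longrightarrow> v \<in> TS p \<Longrightarrow> w \<in> TS p \<Longrightarrow> g p (u - v) w = g p u w - g p v w"
  using g_add_left[of u p "- v" w] by (simp add: g_minus_left tangent_space_minus)

lemma g_diff_right: "u \<in> TS p \<Longrightarrow> v \<in> TS p \<Longrightarrow> w \<in> TS p \<Longrightarrow> g p w (u - v) = g p w u - g p w v"
  using g_add_right[of u p "- v" w] by (simp add: g_minus_right tangent_space_minus)

lemma tangent_space_sum: "(\<And>i. i \<in> I \<Longrightarrow> u i \<in> TS p) \<Longrightarrow> (\<Sum>i\<in>I. u i) \<in> TS p"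
  using tvec.subspace_sum[OF tangent_subspace] by blast

lemma g_sum_left: "w \<in> TS p \<Longrightarrow> (\<And>i. i \<in> I \<Longrightarrow> u i \<in> TS p) \<Longrightarrow> g p (\<Sum>i\<in>I. u i) w = (\<Sum>i\<in>I. g p (u i) w)"
  by (induction I rule: infinite_finite_induct)
     (auto simp: g_zero_left g_add_left tangent_space_sum)

lemma g_nondegenerate: "v \<in> TS p \<Longrightarrow> g p v v = 0 \<Longrightarrow> v = 0"
  using g_pos by force

definition orthonormal_at :: "'a \<Rightarrow> 'a vfield set \<Rightarrow> bool" where
  "orthonormal_at q S \<longleftrightarrow> finite S \<and> (\<forall>E\<in>S. E q \<in> TS q) \<and>
     (\<forall>E\<in>S. \<forall>F\<in>S. g q (E q) (F q) = (if E = F then 1 else 0))"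

lemma orthonormal_atD:
  assumes "orthonormal_at q S"
  shows "finite S" "E \<in> S \<Longrightarrow> E q \<in> TS q" "E \<in> S \<Longrightarrow> F \<in> S \<Longrightarrow> g q (E q) (F q) = (if E = F then 1 else 0)"
  using assms by (auto simp: orthonormal_at_def)

lemma orthonormal_coeff:
  assumes S: "orthonormal_at q S" and F: "F \<in> S"
  shows "g q (\<Sum>E\<in>S. c E *\<^sub>T E q) (F q) = c F"
proof -
  have "g q (\<Sum>E\<in>S. c E *\<^sub>T E q) (F q) = (\<Sum>E\<in>S. c E * (if E = F then 1 else 0))"
    using F orthonormal_atD[OF S] by (simp add: g_sum_left tangent_space_scale g_scale_left)
  also have "\<dots> = c F"
    using F orthonormal_atD(1)[OF S] by (simp add: mult_delta_right)
  finally show ?thesis .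
qed

lemma orthonormal_expand:
  assumes S: "orthonormal_at q S" and v: "v = (\<Sum>E\<in>S. c E *\<^sub>T E q)"
  shows "v = (\<Sum>E\<in>S. g q v (E q) *\<^sub>T E q)"
  using orthonormal_coeff[OF S, of _ c] v by (metis (no_types, lifting) sum.cong)

lemma orthonormal_inj: "orthonormal_at q S \<Longrightarrow> inj_on (\<lambda>E. E q) S"
  unfolding inj_on_def orthonormal_at_def by (metis zero_neq_one)

lemma orthonormal_span:
  assumes S: "orthonormal_at q S" and v: "v \<in> tvec.span ((\<lambda>E. E q) ` S)"
  shows "v = (\<Sum>E\<in>S. g q v (E q) *\<^sub>T E q)"
proof -
  obtain c where "v = (\<Sum>w\<in>(\<lambda>E. E q) ` S. c w *\<^sub>T w)"
    using v orthonormal_atD(1)[OF S] by (auto simp: tvec.span_finite)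
  then have "v = (\<Sum>E\<in>S. c (E q) *\<^sub>T E q)"
    by (simp add: sum.reindex[OF orthonormal_inj[OF S]])
  then show ?thesis by (rule orthonormal_expand[OF S])
qed

lemma orthonormal_independent:
  assumes S: "orthonormal_at q S"
  shows "tvec.independent ((\<lambda>E. E q) ` S)"
proof -
  have "u (F q) = 0" if "(\<Sum>w\<in>(\<lambda>E. E q) ` S. u w *\<^sub>T w) = 0" "F \<in> S" for u F
  proof -
    have "(\<Sum>E\<in>S. u (E q) *\<^sub>T E q) = 0"
      using that(1) by (simp add: sum.reindex[OF orthonormal_inj[OF S]])
    then show ?thesis
      using orthonormal_coeff[OF S that(2), of "\<lambda>E. u (E q)"] orthonormal_atD(2)[OF S that(2)]
      by (simp add: g_zero_left)
  qed
  then show ?thesis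
    using orthonormal_atD(1)[OF S] by (auto simp: tvec.dependent_finite)
qed

lemma tangent_dim_le:
  obtains B where "finite B" "card B \<le> DIM('e)" "TS q \<subseteq> tvec.span B"
proof -
  obtain E :: "'e \<Rightarrow> 'a vfield" and x :: "'e \<Rightarrow> 'a \<Rightarrow> real" and V where
    "open V" and q: "q \<in> V" and "\<And>b. VF (E b)"
    "\<And>b b' q. b \<in> Basis \<Longrightarrow> b' \<in> Basis \<Longrightarrow> q \<in> V \<Longrightarrow> E b q (x b') = (if b = b' then 1 else 0)"
    and sp: "\<And>q v. q \<in> V \<Longrightarrow> v \<in> TS q \<Longrightarrow> v = (\<Sum>b\<in>Basis. v (x b) *\<^sub>T E b q)"
    by (rule coordinate_fields[of q]) (rule that)
  show thesis
  proof
    show "finite ((\<lambda>b. E b q) ` Basis)" by simp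
    show "card ((\<lambda>b. E b q) ` Basis) \<le> DIM('e)" by (rule card_image_le) simp
    show "TS q \<subseteq> tvec.span ((\<lambda>b. E b q) ` Basis)"
    proof
      fix v assume "v \<in> TS q"
      then have "v = (\<Sum>b\<in>Basis. v (x b) *\<^sub>T E b q)" by (rule sp[OF q])
      also have "\<dots> \<in> tvec.span ((\<lambda>b. E b q) ` Basis)"
        by (intro tvec.span_sum tvec.span_scale tvec.span_base) auto
      finally show "v \<in> tvec.span ((\<lambda>b. E b q) ` Basis)" .
    qed
  qed
qed

lemma orthonormal_card_le:
  assumes S: "orthonormal_at q S" shows "card S \<le> DIM('e)"
proof -
  obtain B where B: "finite B" "card B \<le> DIM('e)" "TS q \<subseteq> tvec.span B" by (rule tangent_dim_le)
  have "(\<lambda>E. E q) ` S \<subseteq> tvec.span B" using B(3) orthonormal_atD(2)[OF S] by blast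
  then have "card ((\<lambda>E. E q) ` S) \<le> card B"
    by (rule tvec.independent_span_bound[OF B(1) orthonormal_independent[OF S], THEN conjunct2])
  then show ?thesis using B(2) card_image[OF orthonormal_inj[OF S]] by simp
qed

text \<open>A vector outside the span would give \<open>DIM('e) + 1\<close> independent vectors in a
  space spanned by \<open>DIM('e)\<close> of them.\<close>

lemma orthonormal_full_expand:
  assumes S: "orthonormal_at q S" and card: "card S = DIM('e)" and v: "v \<in> TS q"
  shows "v = (\<Sum>E\<in>S. g q v (E q) *\<^sub>T E q)"
proof (rule orthonormal_span[OF S], rule ccontr)
  let ?V = "(\<lambda>E. E q) ` S"
  assume n: "v \<notin> tvec.span ?V"
  obtain B where B: "finite B" "card B \<le> DIM('e)" "TS q \<subseteq> tvec.span B" by (rule tangent_dim_le)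
  have "tvec.independent (insert v ?V)"
    by (rule tvec.independent_insertI[OF n orthonormal_independent[OF S]])
  moreover have "insert v ?V \<subseteq> tvec.span B" using B(3) v orthonormal_atD(2)[OF S] by blast
  ultimately have "card (insert v ?V) \<le> card B"
    by (rule tvec.independent_span_bound[OF B(1), THEN conjunct2])
  moreover have "v \<notin> ?V" using n tvec.span_base[of v ?V] by metis
  ultimately show False
    using B(2) card card_image[OF orthonormal_inj[OF S]] finite_imageI[OF orthonormal_atD(1)[OF S]]
    by (metis card_insert_disjoint leD lessI order.trans)
qed

definition orthonormal_near :: "'a \<Rightarrow> 'a vfield set \<Rightarrow> bool" where
  "orthonormal_near p S \<longleftrightarrow> (\<forall>E\<in>S. VF E) \<and> (\<exists>U. open U \<and> p \<in> U \<and> (\<forall>q\<in>U. orthonormal_at q S))"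

text \<open>One Gram-Schmidt step with parameters: the independent coordinate vectors at p are too
  many to lie in the span of S, and orthogonalising an outlying one stays possible near p.\<close>

lemma orthonormal_near_extend:
  assumes S: "orthonormal_near p S" and card: "card S < DIM('e)"
  obtains E where "E \<notin> S" "orthonormal_near p (insert E S)"
proof -
  obtain U where U: "open U" "p \<in> U" "\<And>q. q \<in> U \<Longrightarrow> orthonormal_at q S"
    and SV: "\<And>E. E \<in> S \<Longrightarrow> VF E" using S by (auto simp: orthonormal_near_def)
  note fin = orthonormal_atD(1)[OF U(3)[OF U(2)]]
  obtain B :: "'e \<Rightarrow> 'a vfield" and x :: "'e \<Rightarrow> 'a \<Rightarrow> real" and V where
    V: "open V" "p \<in> V" and B: "\<And>b. VF (B b)"
    "\<And>b b' q. b \<in> Basis \<Longrightarrow> b' \<in> Basis \<Longrightarrow> q \<in> V \<Longrightarrow> B b q (x b') = (if b = b' then 1 else 0)"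
    and "\<And>q v. q \<in> V \<Longrightarrow> v \<in> TS q \<Longrightarrow> v = (\<Sum>b\<in>Basis. v (x b) *\<^sub>T B b q)"
    by (rule coordinate_fields[of p]) (rule that)
  let ?B = "(\<lambda>b. B b p) ` Basis"
  have inj: "inj_on (\<lambda>b. B b p) Basis"
  proof (rule inj_onI)
    fix b b' :: 'e assume b: "b \<in> Basis" "b' \<in> Basis" "B b p = B b' p"
    then have "B b' p (x b) = 1" using B(2)[OF b(1) b(1) V(2)] by simp
    then show "b = b'" using B(2)[OF b(2,1) V(2)] by (auto split: if_splits)
  qed
  have "tvec.independent ?B"
  proof -
    have "u (B b p) = 0" if z: "(\<Sum>w\<in>?B. u w *\<^sub>T w) = 0" and b: "b \<in> Basis" for u b
    proof -
      have "(\<Sum>b\<in>Basis. u (B b p) *\<^sub>T B b p) (x b) = 0"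
        using z by (simp add: sum.reindex[OF inj])
      then have "(\<Sum>b'\<in>Basis. u (B b' p) * (if b' = b then 1 else 0)) = 0"
        using B(2)[OF _ b V(2)] by (simp add: sum_fun_apply tscale_apply)
      then show ?thesis using b by (simp add: mult_delta_right)
    qed
    then show ?thesis by (auto simp: tvec.dependent_finite)
  qed
  moreover have "card ?B = DIM('e)" by (rule card_image[OF inj])
  moreover have "card ((\<lambda>E. E p) ` S) = card S" by (rule card_image[OF orthonormal_inj[OF U(3)[OF U(2)]]])
  ultimately have "\<not> ?B \<subseteq> tvec.span ((\<lambda>E. E p) ` S)"
    using tvec.independent_span_bound[of "(\<lambda>E. E p) ` S" ?B] card fin by auto
  then obtain b where b: "B b p \<notin> tvec.span ((\<lambda>E. E p) ` S)" by blast
  define W where "W = B b - (\<Sum>E\<in>S. (\<lambda>q. g q (B b q) (E q)) *\<^sub>F E)"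
  have W: "VF W" unfolding W_def by (intro VF_diff VF_sum VF_scale g_smooth B SV)
  have Wq: "W q = B b q - (\<Sum>E\<in>S. g q (B b q) (E q) *\<^sub>T E q)" for q
    by (simp add: W_def sum_fun_apply fscale_apply)
  have W0: "W p \<noteq> 0"
  proof
    assume "W p = 0"
    then have "B b p = (\<Sum>E\<in>S. g p (B b p) (E p) *\<^sub>T E p)" by (simp add: Wq)
    also have "\<dots> \<in> tvec.span ((\<lambda>E. E p) ` S)"
      by (intro tvec.span_sum tvec.span_scale tvec.span_base) auto
    finally show False using b by simp
  qed
  define u where "u q = g q (W q) (W q)" for q
  have u: "smooth_fun \<A> u" unfolding u_def by (rule g_smooth[OF W W])
  have "u p > 0" unfolding u_def by (rule g_pos[OF VF_tangent[OF W] W0])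
  then have pu: "p \<in> u -` {0<..}" by simp
  have ou: "open (u -` {0<..})"
    by (rule open_vimage[OF _ smooth_fun_continuous[OF u]]) simp
  obtain \<psi> V' where \<psi>: "smooth_fun \<A> \<psi>" and V': "open V'" "p \<in> V'" "V' \<subseteq> u -` {0<..}"
    and \<psi>01: "\<And>q. 0 \<le> \<psi> q" "\<And>q. \<psi> q \<le> 1"
    and \<psi>1: "\<And>q. q \<in> V' \<Longrightarrow> \<psi> q = 1" and \<psi>0: "\<And>q. q \<notin> u -` {0<..} \<Longrightarrow> \<psi> q = 0"
    by (rule bump_open[OF ou pu]) (rule that)
  \<comment> \<open>Interpolating with the constant 1 keeps \<open>u'\<close> positive everywhere,
    so its power -1/2 is globally smooth, while \<open>u' = u\<close> near p.\<close>
  define u' where "u' q = \<psi> q * u q + (1 - \<psi> q)" for q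
  have u': "smooth_fun \<A> u'" unfolding u'_def by (intro smooth_intros \<psi> u)
  have u'_pos: "u' q > 0" for q
  proof (cases "u q > 0")
    case True
    then have "\<psi> q * u q > 0 \<or> \<psi> q = 0" using \<psi>01(1)[of q] by (simp add: zero_less_mult_iff less_le)
    moreover have "\<psi> q * u q \<ge> 0" using True \<psi>01(1)[of q] by simp
    ultimately show ?thesis using \<psi>01(2)[of q] by (auto simp: u'_def)
  qed (use \<psi>0 in \<open>simp add: u'_def\<close>)
  define E where "E = (\<lambda>q. u' q powr (- 1 / 2)) *\<^sub>F W"
  have E: "VF E" unfolding E_def by (intro VF_scale smooth_fun_powr u' u'_pos W)
  have ort: "orthonormal_at q (insert E S) \<and> E \<notin> S" if q: "q \<in> U \<inter> V'" for q
  proof -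
    note Sq = U(3)[of q] and t = VF_tangent[OF W, of q] VF_tangent[OF E, of q]
    have Eq: "E q = (u q powr (- 1 / 2)) *\<^sub>T W q"
      using q \<psi>1 by (simp add: E_def fscale_apply u'_def)
    have "u q > 0" using q V' by auto
    then have "u q powr (- 1 / 2) * (u q powr (- 1 / 2) * u q) = 1"
      by (simp add: powr_add[symmetric] powr_minus_divide flip: powr_mult_base mult.assoc)
    then have 1: "g q (E q) (E q) = 1"
      using t by (simp add: Eq g_scale_left g_scale_right tangent_space_scale u_def)
    have 2: "g q (E q) (F q) = 0" if F: "F \<in> S" for F
    proof -
      have "g q (W q) (F q) = 0"
      proof -
        have "(\<Sum>E\<in>S. g q (B b q) (E q) *\<^sub>T E q) \<in> TS q"
          by (rule tangent_space_sum, rule tangent_space_scale, rule VF_tangent, erule SV)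
        then show ?thesis
          unfolding Wq using q
          by (simp add: g_diff_left VF_tangent B(1) SV F orthonormal_coeff[OF Sq F])
      qed
      then show ?thesis using t VF_tangent[OF SV[OF F]] by (simp add: Eq g_scale_left)
    qed
    then have "E \<notin> S" using 1 by fastforce
    moreover have "g q (F q) (E q) = 0" if "F \<in> S" for F
      using 2[OF that] g_sym[of "F q" q "E q"] t VF_tangent[OF SV[OF that]] by simp
    moreover have "orthonormal_at q S" using Sq q by simp
    ultimately show ?thesis using 1 2 t fin by (auto simp: orthonormal_at_def)
  qed
  show thesis
  proof
    show "E \<notin> S" using ort U(2) V'(2) by blast
    show "orthonormal_near p (insert E S)"
      unfolding orthonormal_near_def
      using E SV ort U V' by (auto intro!: exI[of _ "U \<inter> V'"])
  qed
qed

lemma orthonormal_near_extend_full: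
  assumes "orthonormal_near p S"
  obtains S' where "S \<subseteq> S'" "orthonormal_near p S'" "card S' = DIM('e)"
proof -
  have "\<exists>S'. S \<subseteq> S' \<and> orthonormal_near p S' \<and> card S' = DIM('e)" if "orthonormal_near p S" for S
    using that
  proof (induction "DIM('e) - card S" arbitrary: S)
    case 0
    then obtain U where "p \<in> U" "\<forall>q\<in>U. orthonormal_at q S" unfolding orthonormal_near_def by blast
    then have "card S \<le> DIM('e)" using orthonormal_card_le by blast
    with 0 show ?case by auto
  next
    case (Suc n)
    then have "card S < DIM('e)" by simp
    then obtain E where E: "E \<notin> S" "orthonormal_near p (insert E S)"
      using orthonormal_near_extend[OF Suc.prems] by metis
    moreover have "finite S" using Suc.prems by (auto simp: orthonormal_near_def orthonormal_at_def)
    ultimately have "n = DIM('e) - card (insert E S)" using Suc.hyps(2) by simp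
    from Suc.hyps(1)[OF this E(2)] show ?case by auto
  qed
  then show thesis using assms that by blast
qed

lemma frame_coeff:
  assumes S: "local_orthonormal_frame \<A> g B p S" and B: "\<And>q. B q \<subseteq> TS q"
  obtains U where "open U" "p \<in> U" "\<And>q. q \<in> U \<Longrightarrow> orthonormal_at q S"
    "\<And>q v. q \<in> U \<Longrightarrow> v \<in> B q \<Longrightarrow> v = (\<Sum>E\<in>S. g q v (E q) *\<^sub>T E q)"
proof -
  obtain U where U: "open U" "p \<in> U"
    "\<forall>q\<in>U. (\<forall>E\<in>S. \<forall>F\<in>S. g q (E q) (F q) = (if E = F then 1 else 0)) \<and>
        (\<forall>v\<in>B q. \<exists>c. v = (\<Sum>E\<in>S. c E *\<^sub>T E q))"
    and fin: "finite S" and SB: "S \<subseteq> sections \<A> B"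
    using S unfolding local_orthonormal_frame_def by blast
  have o: "orthonormal_at q S" if "q \<in> U" for q
    using U(3) that fin SB unfolding orthonormal_at_def sections_def vector_field_def by blast
  show thesis
    by (rule that[OF U(1,2) o]) (use U(3) orthonormal_expand[OF o] in blast)+
qed

section \<open>Function-linear functionals and their traces\<close>

definition tensorial :: "('a \<Rightarrow> 'a tvec set) \<Rightarrow> 'a \<Rightarrow> ('a vfield \<Rightarrow> real) \<Rightarrow> bool" where
  "tensorial B p T \<longleftrightarrow>
     (\<forall>X\<in>sections \<A> B. \<forall>Y\<in>sections \<A> B. T (X + Y) = T X + T Y) \<and>
     (\<forall>f. \<forall>X\<in>sections \<A> B. smooth_fun \<A> f \<longrightarrow> T (f *\<^sub>F X) = f p * T X)"

lemma tensorialI: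
  "(\<And>X Y. X \<in> sections \<A> B \<Longrightarrow> Y \<in> sections \<A> B \<Longrightarrow> T (X + Y) = T X + T Y) \<Longrightarrow>
   (\<And>f X. smooth_fun \<A> f \<Longrightarrow> X \<in> sections \<A> B \<Longrightarrow> T (f *\<^sub>F X) = f p * T X) \<Longrightarrow> tensorial B p T"
  by (simp add: tensorial_def)

text \<open>The frame expansion of X holds only on U, but after multiplication by a bump function it
  is an identity of global sections. Since the bump function is 1 at p, \<open>T\<close> does not
  notice it.\<close>

lemma tensorial_expand:
  assumes S: "local_orthonormal_frame \<A> g B p S" and sub: "\<And>q. tvec.subspace (B q)" "\<And>q. B q \<subseteq> TS q"
    and T: "tensorial B p T" and X: "X \<in> sections \<A> B"
  shows "T X = (\<Sum>E\<in>S. g p (X p) (E p) * T E)"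
proof -
  obtain U where U: "open U" "p \<in> U" "\<And>q. q \<in> U \<Longrightarrow> orthonormal_at q S"
    "\<And>q v. q \<in> U \<Longrightarrow> v \<in> B q \<Longrightarrow> v = (\<Sum>E\<in>S. g q v (E q) *\<^sub>T E q)"
    by (rule frame_coeff[OF S sub(2)]) (rule that)
  have SB: "\<And>E. E \<in> S \<Longrightarrow> E \<in> sections \<A> B" using S by (auto simp: local_orthonormal_frame_def)
  obtain \<psi> where \<psi>: "smooth_fun \<A> \<psi>" "\<psi> p = 1" "\<And>q. q \<notin> U \<Longrightarrow> \<psi> q = 0"
    using bump_open[OF U(1,2)] by metis
  have add: "\<And>X Y. X \<in> sections \<A> B \<Longrightarrow> Y \<in> sections \<A> B \<Longrightarrow> X + Y \<in> sections \<A> B"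
    and sc: "\<And>f X. smooth_fun \<A> f \<Longrightarrow> X \<in> sections \<A> B \<Longrightarrow> f *\<^sub>F X \<in> sections \<A> B"
    and z: "0 \<in> sections \<A> B"
    using sub(1) by (auto simp: sections_def VF_add VF_scale VF_zero fscale_apply
        tvec.subspace_add tvec.subspace_scale tvec.subspace_0)
  have T_add: "\<And>X Y. X \<in> sections \<A> B \<Longrightarrow> Y \<in> sections \<A> B \<Longrightarrow> T (X + Y) = T X + T Y"
    and T_scale: "\<And>f X. smooth_fun \<A> f \<Longrightarrow> X \<in> sections \<A> B \<Longrightarrow> T (f *\<^sub>F X) = f p * T X"
    using T by (auto simp: tensorial_def)
  have T_sum: "(\<Sum>i\<in>I. F i) \<in> sections \<A> B \<and> T (\<Sum>i\<in>I. F i) = (\<Sum>i\<in>I. T (F i))"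
    if "\<And>i. i \<in> I \<Longrightarrow> F i \<in> sections \<A> B" for I :: "'a vfield set" and F
    using that
    by (induction I rule: infinite_finite_induct)
       \<comment> \<open>Additivity at 0 + 0 gives T 0 = 0, the value for empty and infinite index
         sets.\<close>
       (use T_add[OF z z] in \<open>auto simp: z add T_add\<close>)
  have VX: "VF X" and VE: "\<And>E. E \<in> S \<Longrightarrow> VF E" using X SB by (auto simp: sections_def)
  have sm: "smooth_fun \<A> (\<lambda>q. \<psi> q * g q (X q) (E q))" if "E \<in> S" for E
    using that by (intro smooth_intros \<psi> g_smooth VX VE)
  have "\<psi> *\<^sub>F X = (\<Sum>E\<in>S. (\<lambda>q. \<psi> q * g q (X q) (E q)) *\<^sub>F E)"
  proof
    fix q
    have "\<psi> q *\<^sub>T X q = (\<Sum>E\<in>S. (\<psi> q * g q (X q) (E q)) *\<^sub>T E q)"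
    proof (cases "q \<in> U")
      case True
      have "X q \<in> B q" using X by (simp add: sections_def)
      from U(4)[OF True this] show ?thesis
        by (metis (no_types, lifting) sum.cong tvec.scale_scale tvec.scale_sum_right)
    qed (simp add: \<psi>(3))
    then show "(\<psi> *\<^sub>F X) q = (\<Sum>E\<in>S. (\<lambda>q. \<psi> q * g q (X q) (E q)) *\<^sub>F E) q"
      by (simp add: fscale_apply sum_fun_apply)
  qed
  moreover have "T (\<psi> *\<^sub>F X) = T X" using T_scale[OF \<psi>(1) X] \<psi>(2) by simp
  moreover have "T (\<Sum>E\<in>S. (\<lambda>q. \<psi> q * g q (X q) (E q)) *\<^sub>F E) = (\<Sum>E\<in>S. g p (X p) (E p) * T E)"
    using T_sum[of S "\<lambda>E. (\<lambda>q. \<psi> q * g q (X q) (E q)) *\<^sub>F E"] sm SB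
    by (simp add: sc T_scale \<psi>(2))
  ultimately show ?thesis by simp
qed

text \<open>Frames come from \<open>SOME\<close>, so this is the only access to them: it allows
  passing to a frame containing \<xi>, or to the image of a frame under J.\<close>

lemma trace_frame_independent:
  assumes S: "local_orthonormal_frame \<A> g B p S" "local_orthonormal_frame \<A> g B p S'"
    and sub: "\<And>q. tvec.subspace (B q)" "\<And>q. B q \<subseteq> TS q"
    and T: "\<And>X. X \<in> sections \<A> B \<Longrightarrow> tensorial B p (T X)"
      "\<And>X. X \<in> sections \<A> B \<Longrightarrow> tensorial B p (\<lambda>Y. T Y X)"
  shows "(\<Sum>E\<in>S. T E E) = (\<Sum>F\<in>S'. T F F)"
proof -
  have SB: "\<And>E. E \<in> S \<Longrightarrow> E \<in> sections \<A> B" "\<And>E. E \<in> S' \<Longrightarrow> E \<in> sections \<A> B"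
    using S by (auto simp: local_orthonormal_frame_def)
  then have tg: "\<And>E. E \<in> S \<Longrightarrow> E p \<in> TS p" "\<And>E. E \<in> S' \<Longrightarrow> E p \<in> TS p"
    by (auto simp: sections_def VF_tangent)
  obtain U where U: "open U" "p \<in> U" "\<And>q. q \<in> U \<Longrightarrow> orthonormal_at q S'"
    "\<And>q v. q \<in> U \<Longrightarrow> v \<in> B q \<Longrightarrow> v = (\<Sum>E\<in>S'. g q v (E q) *\<^sub>T E q)"
    by (rule frame_coeff[OF S(2) sub(2)]) (rule that)
  \<comment> \<open>Parseval's identity: the matrix between the two frames is orthogonal.\<close>
  have par: "(\<Sum>F\<in>S'. g p (E p) (F p) * g p (F p) (E' p)) = g p (E p) (E' p)" if "E \<in> S" "E' \<in> S" for E E'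
  proof -
    have "E p \<in> B p" using SB(1)[OF that(1)] by (simp add: sections_def)
    from arg_cong[OF U(4)[OF U(2) this], of "\<lambda>v. g p v (E' p)"]
    have "g p (E p) (E' p) = g p (\<Sum>F\<in>S'. g p (E p) (F p) *\<^sub>T F p) (E' p)" .
    also have "\<dots> = (\<Sum>F\<in>S'. g p (E p) (F p) * g p (F p) (E' p))"
      using that by (simp add: g_sum_left g_scale_left tangent_space_scale tg)
    finally show ?thesis by simp
  qed
  have on: "g p (E p) (E' p) = (if E = E' then 1 else 0)" if "E \<in> S" "E' \<in> S" for E E'
    using S(1) that unfolding local_orthonormal_frame_def by blast
  have fin: "finite S" using S(1) by (simp add: local_orthonormal_frame_def)
  have "(\<Sum>F\<in>S'. T F F) = (\<Sum>F\<in>S'. \<Sum>E\<in>S. \<Sum>E'\<in>S. g p (E p) (F p) * g p (F p) (E' p) * T E E')"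
  proof (rule sum.cong[OF refl])
    fix F assume F: "F \<in> S'"
    have "T F F = (\<Sum>E\<in>S. g p (F p) (E p) * T E F)"
      by (rule tensorial_expand[OF S(1) sub T(2)[OF SB(2)[OF F]] SB(2)[OF F]])
    also have "\<dots> = (\<Sum>E\<in>S. g p (F p) (E p) * (\<Sum>E'\<in>S. g p (F p) (E' p) * T E E'))"
      using tensorial_expand[OF S(1) sub T(1) SB(2)[OF F]] SB(1) by simp
    finally show "T F F = (\<Sum>E\<in>S. \<Sum>E'\<in>S. g p (E p) (F p) * g p (F p) (E' p) * T E E')"
      using F g_sym[OF tg(2)[OF F] tg(1)] by (simp add: sum_distrib_left mult.assoc)
  qed
  also have "\<dots> = (\<Sum>E\<in>S. \<Sum>E'\<in>S. (\<Sum>F\<in>S'. g p (E p) (F p) * g p (F p) (E' p)) * T E E')"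
    by (subst sum.swap, rule sum.cong[OF refl], subst sum.swap) (simp add: sum_distrib_right)
  also have "\<dots> = (\<Sum>E\<in>S. \<Sum>E'\<in>S. if E = E' then T E E' else 0)"
    by (intro sum.cong refl) (simp add: par on)
  also have "\<dots> = (\<Sum>E\<in>S. T E E)" using fin by (simp add: sum.delta')
  finally show ?thesis by simp
qed

end

section \<open>Contact metric manifolds\<close>

locale contact_metric_manifold = riemannian_manifold \<A> g
  for \<A> :: "('a::t2_space, 'e::euclidean_space) chart set" and g :: "'a metric" +
  fixes \<phi> :: "'a endo" and \<xi> :: "'a vfield" and \<eta> :: "'a \<Rightarrow> 'a tvec \<Rightarrow> real" and D :: "'a conn"
  assumes contact: "contact_metric \<A> g \<phi> \<xi> \<eta>"
    and lc: "levi_civita \<A> g D"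
begin

declare VF_add [simp] VF_minus [simp] VF_diff [simp] VF_zero [simp] VF_scale [simp] VF_tangent [simp]

abbreviation "CB \<equiv> contact_bundle \<A> \<phi>"
abbreviation "J \<equiv> J_op \<phi>"
abbreviation "nb \<equiv> bar_conn \<A> g \<phi> D"

text \<open>The result is a function on the manifold, ready to be differentiated by a tangent
  vector.\<close>

definition ip :: "'a vfield \<Rightarrow> 'a vfield \<Rightarrow> 'a \<Rightarrow> real" where
  "ip X Y = (\<lambda>p. g p (X p) (Y p))"

lemma acm: "almost_contact_metric \<A> g \<phi> \<xi> \<eta>"
  using contact by (simp add: contact_metric_def)

lemma xi_VF [simp]: "VF \<xi>"
  using acm by (simp add: almost_contact_metric_def)

lemma eta_eq: "\<eta> = dual_form g \<xi>"
  using acm by (simp add: almost_contact_metric_def)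

lemma xi_unit: "g p (\<xi> p) (\<xi> p) = 1"
  using acm by (simp add: almost_contact_metric_def)

lemma phi_tensor: "tensor11 \<A> \<phi>"
  using acm by (simp add: almost_contact_metric_def)

lemma phi_tangent: "u \<in> TS p \<Longrightarrow> \<phi> p u \<in> TS p"
  using phi_tensor unfolding tensor11_def by blast

lemma phi_add: "u \<in> TS p \<Longrightarrow> v \<in> TS p \<Longrightarrow> \<phi> p (u + v) = \<phi> p u + \<phi> p v"
  using phi_tensor unfolding tensor11_def by blast

lemma phi_scale: "u \<in> TS p \<Longrightarrow> \<phi> p (c *\<^sub>T u) = c *\<^sub>T \<phi> p u"
  using phi_tensor unfolding tensor11_def by blast

lemma phi_minus: "u \<in> TS p \<Longrightarrow> \<phi> p (- u) = - \<phi> p u"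
  using phi_scale[of u p "-1"] by simp

lemma phi_phi: "u \<in> TS p \<Longrightarrow> \<phi> p (\<phi> p u) = - u + g p (\<xi> p) u *\<^sub>T \<xi> p"
  using acm unfolding almost_contact_metric_def eta_eq dual_form_def by blast

lemma phi_g: "u \<in> TS p \<Longrightarrow> v \<in> TS p \<Longrightarrow> g p (\<phi> p u) (\<phi> p v) = g p u v - g p (\<xi> p) u * g p (\<xi> p) v"
  using acm unfolding almost_contact_metric_def eta_eq dual_form_def by blast

lemma phi_xi: "\<phi> p (\<xi> p) = 0"
  using g_nondegenerate[OF phi_tangent[of "\<xi> p" p]] phi_g[of "\<xi> p" p "\<xi> p"] by (simp add: xi_unit)

text \<open>Compute the third power of \<phi> in two ways: applying \<phi> to the formula for its
  square gives -\<phi> u, while the formula at \<phi> u has the extra term \<eta>(\<phi> u)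
  \<xi>.\<close>

lemma eta_phi: assumes u: "u \<in> TS p" shows "g p (\<xi> p) (\<phi> p u) = 0"
proof -
  have "\<phi> p (\<phi> p (\<phi> p u)) = \<phi> p (- u + g p (\<xi> p) u *\<^sub>T \<xi> p)"
    using u by (simp only: phi_phi)
  also have "\<dots> = \<phi> p (- u) + \<phi> p (g p (\<xi> p) u *\<^sub>T \<xi> p)"
    by (rule phi_add) (simp_all add: u tangent_space_minus tangent_space_scale)
  finally have "\<phi> p (\<phi> p (\<phi> p u)) = - \<phi> p u"
    using u by (simp add: phi_minus phi_scale phi_xi)
  then have "g p (\<xi> p) (\<phi> p u) *\<^sub>T \<xi> p = 0"
    using phi_phi[OF phi_tangent[OF u]] by simp
  then show ?thesis using xi_unit[of p] g_zero_left[of "\<xi> p" p] by auto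
qed

lemma contact_bundle_eq: "CB p = {v \<in> TS p. g p (\<xi> p) v = 0}"
proof (intro equalityI subsetI)
  fix v assume "v \<in> {v \<in> TS p. g p (\<xi> p) v = 0}"
  then have v: "v \<in> TS p" "\<phi> p (\<phi> p v) = - v" by (auto simp: phi_phi)
  then have "v = \<phi> p (- \<phi> p v)" by (simp add: phi_minus phi_tangent)
  then show "v \<in> CB p"
    unfolding contact_bundle_def using v(1) by (metis image_eqI phi_tangent tangent_space_minus)
qed (auto simp: contact_bundle_def eta_phi phi_tangent)

lemma contact_bundle_subspace: "tvec.subspace (CB p)"
  by (auto simp: contact_bundle_eq tvec.subspace_def tangent_space_add tangent_space_scale
      tangent_space_zero g_add_right g_scale_right g_zero_right)

lemma contact_bundle_tangent: "CB p \<subseteq> TS p"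
  by (auto simp: contact_bundle_eq)

lemma orth_proj_eq:
  assumes v: "v \<in> TS p" shows "orth_proj g CB p v = v - g p (\<xi> p) v *\<^sub>T \<xi> p"
  unfolding orth_proj_def
proof (rule the_equality)
  let ?w = "v - g p (\<xi> p) v *\<^sub>T \<xi> p"
  have w: "?w \<in> CB p"
    using v by (simp add: contact_bundle_eq tangent_space_diff tangent_space_scale g_diff_right g_scale_right xi_unit)
  then show "?w \<in> CB p \<and> (\<forall>u\<in>CB p. g p (v - ?w) u = 0)"
    by (auto simp: contact_bundle_eq g_scale_left)
  fix w assume w': "w \<in> CB p \<and> (\<forall>u\<in>CB p. g p (v - w) u = 0)"
  then have d: "?w - w \<in> CB p" using w tvec.subspace_diff[OF contact_bundle_subspace] by blast
  have "g p (?w - w) (?w - w) = g p (v - w) (?w - w) - g p (g p (\<xi> p) v *\<^sub>T \<xi> p) (?w - w)"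
    using v w' d contact_bundle_tangent
    by (subst g_diff_left[symmetric]) (auto simp: tangent_space_diff tangent_space_scale contact_bundle_eq algebra_simps)
  also have "\<dots> = 0" using w' d by (simp add: contact_bundle_eq g_scale_left)
  finally show "w = ?w" using g_nondegenerate d contact_bundle_tangent by fastforce
qed

subsection \<open>Algebra of vector fields\<close>

lemma ip_sym: "VF X \<Longrightarrow> VF Y \<Longrightarrow> ip X Y p = ip Y X p"
  by (simp add: ip_def g_sym)

lemma ip_smooth [simp]: "VF X \<Longrightarrow> VF Y \<Longrightarrow> smooth_fun \<A> (ip X Y)"
  unfolding ip_def by (rule g_smooth)

lemma ip_add_left: "VF X \<Longrightarrow> VF Y \<Longrightarrow> VF Z \<Longrightarrow> ip (X + Y) Z p = ip X Z p + ip Y Z p"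
  by (simp add: ip_def g_add_left)

lemma ip_add_right: "VF X \<Longrightarrow> VF Y \<Longrightarrow> VF Z \<Longrightarrow> ip Z (X + Y) p = ip Z X p + ip Z Y p"
  by (simp add: ip_def g_add_right)

lemma ip_diff_left: "VF X \<Longrightarrow> VF Y \<Longrightarrow> VF Z \<Longrightarrow> ip (X - Y) Z p = ip X Z p - ip Y Z p"
  by (simp add: ip_def g_diff_left)

lemma ip_diff_right: "VF X \<Longrightarrow> VF Y \<Longrightarrow> VF Z \<Longrightarrow> ip Z (X - Y) p = ip Z X p - ip Z Y p"
  by (simp add: ip_def g_diff_right)

lemma ip_minus_left: "VF X \<Longrightarrow> VF Y \<Longrightarrow> ip (- X) Y p = - ip X Y p"
  by (simp add: ip_def g_minus_left)

lemma ip_minus_right: "VF X \<Longrightarrow> VF Y \<Longrightarrow> ip Y (- X) p = - ip Y X p"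
  by (simp add: ip_def g_minus_right)

lemma ip_scale_left: "VF X \<Longrightarrow> VF Y \<Longrightarrow> ip (f *\<^sub>F X) Y p = f p * ip X Y p"
  by (simp add: ip_def g_scale_left fscale_apply)

lemma ip_scale_right: "VF X \<Longrightarrow> VF Y \<Longrightarrow> ip Y (f *\<^sub>F X) p = f p * ip Y X p"
  by (simp add: ip_def g_scale_right fscale_apply)

lemma ip_zero_left: "VF X \<Longrightarrow> ip 0 X p = 0"
  by (simp add: ip_def g_zero_left)

lemma ip_zero_right: "VF X \<Longrightarrow> ip X 0 p = 0"
  by (simp add: ip_def g_zero_right)

lemmas ip_simps = ip_add_left ip_add_right ip_diff_left ip_diff_right ip_minus_left ip_minus_right
  ip_scale_left ip_scale_right ip_zero_left ip_zero_right

lemma ip_nondegenerate: "VF X \<Longrightarrow> ip X X p = 0 \<Longrightarrow> X p = 0"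
  using g_nondegenerate[of "X p" p] by (simp add: ip_def)

lemma fscale_const: "(\<lambda>p. -1) *\<^sub>F X = - X"
  by (simp add: fun_eq_iff fscale_apply tscale_apply)

lemma J_VF [simp]: "VF X \<Longrightarrow> VF (J X)"
  using phi_tensor unfolding tensor11_def J_op_def by blast

lemma J_apply: "J X p = \<phi> p (X p)"
  by (simp add: J_op_def)

lemma J_add: "VF X \<Longrightarrow> VF Y \<Longrightarrow> J (X + Y) = J X + J Y"
  by (rule ext) (simp add: J_apply phi_add)

lemma J_scale: "VF X \<Longrightarrow> J (f *\<^sub>F X) = f *\<^sub>F J X"
  by (rule ext) (simp add: J_apply phi_scale fscale_apply)

lemma J_minus: "VF X \<Longrightarrow> J (- X) = - J X"
  using J_scale[of X "\<lambda>p. -1"] by (simp add: fscale_const)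

lemma J_diff: "VF X \<Longrightarrow> VF Y \<Longrightarrow> J (X - Y) = J X - J Y"
  using J_add[of X "- Y"] by (simp add: J_minus)

lemma J_xi: "J \<xi> = 0"
  by (rule ext) (simp add: J_apply phi_xi)

lemma ip_xi_xi: "ip \<xi> \<xi> p = 1"
  by (simp add: ip_def xi_unit)

lemma ip_xi_J: "VF X \<Longrightarrow> ip \<xi> (J X) p = 0"
  by (simp add: ip_def J_op_def eta_phi)

lemma J_J: "VF X \<Longrightarrow> J (J X) = - X + ip \<xi> X *\<^sub>F \<xi>"
  by (rule ext) (simp add: J_apply phi_phi fscale_apply ip_def)

lemma ip_J_J: "VF X \<Longrightarrow> VF Y \<Longrightarrow> ip (J X) (J Y) p = ip X Y p - ip \<xi> X p * ip \<xi> Y p"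
  by (simp add: ip_def J_op_def phi_g)

lemma ip_J_left: assumes "VF X" "VF Y" shows "ip (J X) Y p = - ip X (J Y) p"
proof -
  \<comment> \<open>The same quantity is given by compatibility of the metric with J, applied to X
    and \<open>J Y\<close>.\<close>
  have "ip (J X) (J (J Y)) p = - ip (J X) Y p"
    unfolding J_J[OF assms(2)] using assms ip_xi_J[OF assms(1)] ip_sym[of \<xi> "J X" p]
    by (simp add: ip_simps)
  then show ?thesis using ip_J_J[of X "J Y" p] assms by (simp add: ip_xi_J)
qed

text \<open>Sections of the contact subbundle as the kernel of \<eta>, a form that the simplifier
  can check.\<close>

definition SD :: "'a vfield \<Rightarrow> bool" where
  "SD X \<longleftrightarrow> VF X \<and> (\<forall>p. ip \<xi> X p = 0)"

lemma sections_SD: "sections \<A> CB = Collect SD"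
  by (auto simp: sections_def SD_def contact_bundle_eq ip_def)

lemma SD_VF [simp]: "SD X \<Longrightarrow> VF X"
  by (simp add: SD_def)

lemma ip_xi_SD: "SD X \<Longrightarrow> ip \<xi> X p = 0" "SD X \<Longrightarrow> ip X \<xi> p = 0"
  using ip_sym[of X \<xi>] by (simp_all add: SD_def)

lemma SD_J [simp]: "VF X \<Longrightarrow> SD (J X)"
  by (simp add: SD_def ip_xi_J)

lemma SD_closed [simp]: "SD X \<Longrightarrow> SD Y \<Longrightarrow> SD (X + Y)" "SD X \<Longrightarrow> SD Y \<Longrightarrow> SD (X - Y)"
  "SD X \<Longrightarrow> SD (- X)" "smooth_fun \<A> f \<Longrightarrow> SD X \<Longrightarrow> SD (f *\<^sub>F X)" "SD 0"
  by (simp_all add: SD_def ip_simps)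

lemma J_J_SD: "SD X \<Longrightarrow> J (J X) = - X"
  by (rule ext) (simp add: J_J fscale_apply ip_xi_SD)

lemma ip_J_J_SD: "SD X \<Longrightarrow> SD Y \<Longrightarrow> ip (J X) (J Y) p = ip X Y p"
  by (simp add: ip_J_J ip_xi_SD)

subsection \<open>The Levi-Civita connection and its curvature\<close>

lemma D_affine: "affine_connection \<A> D"
  using lc by (simp add: levi_civita_def)

lemma D_VF [simp]: "VF X \<Longrightarrow> VF Y \<Longrightarrow> VF (D X Y)"
  using D_affine unfolding affine_connection_def by blast

lemma D_add_left: "VF X \<Longrightarrow> VF Y \<Longrightarrow> VF Z \<Longrightarrow> D (X + Y) Z = D X Z + D Y Z"
  using D_affine unfolding affine_connection_def by blast

lemma D_add_right: "VF X \<Longrightarrow> VF Y \<Longrightarrow> VF Z \<Longrightarrow> D X (Y + Z) = D X Y + D X Z"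
  using D_affine unfolding affine_connection_def by blast

lemma D_scale_left: "smooth_fun \<A> f \<Longrightarrow> VF X \<Longrightarrow> VF Y \<Longrightarrow> D (f *\<^sub>F X) Y = f *\<^sub>F D X Y"
  using D_affine unfolding affine_connection_def by blast

lemma D_leibniz:
  "smooth_fun \<A> f \<Longrightarrow> VF X \<Longrightarrow> VF Y \<Longrightarrow> D X (f *\<^sub>F Y) = (\<lambda>p. X p f) *\<^sub>F Y + f *\<^sub>F D X Y"
  using D_affine unfolding affine_connection_def by blast

lemma D_minus_left: "VF X \<Longrightarrow> VF Y \<Longrightarrow> D (- X) Y = - D X Y"
  using D_scale_left[OF smooth_fun_const[of "-1"], of X Y] by (simp add: fscale_const)

lemma D_zero_right: "VF X \<Longrightarrow> D X 0 = 0"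
  using D_add_right[of X 0 0] by simp

lemma D_minus_right: "VF X \<Longrightarrow> VF Y \<Longrightarrow> D X (- Y) = - D X Y"
  using D_add_right[of X Y "- Y"] by (simp add: D_zero_right eq_neg_iff_add_eq_0 add.commute)

lemma D_diff_left: "VF X \<Longrightarrow> VF Y \<Longrightarrow> VF Z \<Longrightarrow> D (X - Y) Z = D X Z - D Y Z"
  using D_add_left[of X "- Y" Z] by (simp add: D_minus_left)

lemma D_diff_right: "VF X \<Longrightarrow> VF Y \<Longrightarrow> VF Z \<Longrightarrow> D X (Y - Z) = D X Y - D X Z"
  using D_add_right[of X Y "- Z"] by (simp add: D_minus_right)

lemma D_torsion: "VF X \<Longrightarrow> VF Y \<Longrightarrow> lie_bracket X Y = D X Y - D Y X"
  using lc unfolding levi_civita_def by metis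

lemma D_metric: "VF X \<Longrightarrow> VF Y \<Longrightarrow> VF Z \<Longrightarrow> X p (ip Y Z) = ip (D X Y) Z p + ip Y (D X Z) p"
  using lc unfolding levi_civita_def ip_def by blast

section \<open>Symmetries of the Riemann tensor\<close>

lemma lie_bracket_jacobi:
  assumes X: "VF X" and Y: "VF Y" and Z: "VF Z"
  shows "lie_bracket X (lie_bracket Y Z) + lie_bracket Y (lie_bracket Z X) + lie_bracket Z (lie_bracket X Y) = 0"
proof (intro ext)
  fix p f
  show "(lie_bracket X (lie_bracket Y Z) + lie_bracket Y (lie_bracket Z X) + lie_bracket Z (lie_bracket X Y)) p f
      = (0 :: 'a vfield) p f"
  \<comment> \<open>The identity is equality in HOL, so it is also needed on non-smooth f, where
    every derivative is 0 by convention.\<close>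
  proof (cases "smooth_fun \<A> f")
    case True
    then show ?thesis
      using X Y Z
      by (simp add: lie_bracket_def VF_smooth tangent_diff[OF VF_tangent[OF X]]
          tangent_diff[OF VF_tangent[OF Y]] tangent_diff[OF VF_tangent[OF Z]])
  next
    case False
    show ?thesis
      by (simp add: lie_bracket_def X Y Z tangent_nonsmooth[OF VF_tangent[OF X] False]
          tangent_nonsmooth[OF VF_tangent[OF Y] False] tangent_nonsmooth[OF VF_tangent[OF Z] False]
          tangent_const[OF VF_tangent[OF X]] tangent_const[OF VF_tangent[OF Y]]
          tangent_const[OF VF_tangent[OF Z]])
  qed
qed

text \<open>With \<open>D\<close> itself in the bundle slot, \<open>bar_curv\<close> is the Riemann
  curvature, since torsion-freeness turns the two first-order terms into the bracket term.\<close>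

definition Rm :: "'a vfield \<Rightarrow> 'a vfield \<Rightarrow> 'a vfield \<Rightarrow> 'a vfield \<Rightarrow> 'a \<Rightarrow> real" where
  "Rm X Y Z W = ip (bar_curv D D X Y Z) W"

lemma bar_curv_D: "bar_curv D D X Y Z = D X (D Y Z) - D (D X Y) Z - (D Y (D X Z) - D (D Y X) Z)"
  by (simp add: bar_curv_def second_cov_def)

lemma Rm_skew12: "VF X \<Longrightarrow> VF Y \<Longrightarrow> VF Z \<Longrightarrow> VF W \<Longrightarrow> Rm Y X Z W p = - Rm X Y Z W p"
  by (simp add: Rm_def bar_curv_D ip_simps)

text \<open>Second derivatives of the function \<open>ip Z W\<close>: by metricity, its commutator
  of derivatives minus the bracket derivative, which is 0, expands to the sum of the two curvature
  terms.\<close>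

lemma Rm_skew34:
  assumes V: "VF X" "VF Y" "VF Z" "VF W"
  shows "Rm X Y W Z p = - Rm X Y Z W p"
proof -
  have d: "A p (\<lambda>q. B q (ip Z W)) = ip (D A (D B Z)) W p + ip (D B Z) (D A W) p
      + (ip (D A Z) (D B W) p + ip Z (D A (D B W)) p)" if "VF A" "VF B" for A B
  proof -
    have "(\<lambda>q. B q (ip Z W)) = (\<lambda>q. ip (D B Z) W q + ip Z (D B W) q)"
      using that V by (simp add: D_metric)
    then show ?thesis using that V by (simp add: tangent_add[OF VF_tangent[OF that(1)]] D_metric)
  qed
  have "lie_bracket X Y p (ip Z W) = X p (\<lambda>q. Y q (ip Z W)) - Y p (\<lambda>q. X q (ip Z W))"
    by (simp add: lie_bracket_def)
  moreover have "lie_bracket X Y p (ip Z W) = ip (D (D X Y) Z) W p + ip Z (D (D X Y) W) p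
      - (ip (D (D Y X) Z) W p + ip Z (D (D Y X) W) p)"
    using V by (simp add: D_torsion D_metric)
  moreover have "ip Z (bar_curv D D X Y W) p = ip (bar_curv D D X Y W) Z p"
    using V by (intro ip_sym) (simp_all add: bar_curv_D)
  ultimately show ?thesis
    using V by (simp add: Rm_def d bar_curv_D ip_simps)
qed

text \<open>Torsion-freeness rewrites the cyclic sum of curvatures as the Jacobi expression.\<close>

lemma Rm_bianchi:
  assumes V: "VF X" "VF Y" "VF Z" "VF W"
  shows "Rm X Y Z W p + Rm Y Z X W p + Rm Z X Y W p = 0"
proof -
  have "bar_curv D D X Y Z + bar_curv D D Y Z X + bar_curv D D Z X Y =
      lie_bracket X (lie_bracket Y Z) + lie_bracket Y (lie_bracket Z X) + lie_bracket Z (lie_bracket X Y)"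
    using V by (simp add: bar_curv_D D_torsion D_diff_left D_diff_right)
  then have "bar_curv D D X Y Z + bar_curv D D Y Z X + bar_curv D D Z X Y = 0"
    using V by (simp add: lie_bracket_jacobi)
  then have "ip (bar_curv D D X Y Z + bar_curv D D Y Z X + bar_curv D D Z X Y) W p = 0"
    using V by (simp add: ip_zero_left)
  then show ?thesis using V by (simp add: Rm_def bar_curv_D ip_simps)
qed

text \<open>The octahedron argument: four cyclic sums, one for each choice of last argument,
  combined through the two skew symmetries.\<close>

lemma Rm_pair:
  assumes V: "VF X" "VF Y" "VF Z" "VF W"
  shows "Rm X Y Z W p = Rm Z W X Y p"
  using Rm_bianchi[OF V(1) V(2) V(3) V(4), of p]
    Rm_bianchi[OF V(2) V(3) V(4) V(1), of p]
    Rm_bianchi[OF V(3) V(4) V(1) V(2), of p]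
    Rm_bianchi[OF V(4) V(1) V(2) V(3), of p]
    Rm_skew34[OF V(1) V(2) V(3) V(4), of p]
    Rm_skew34[OF V(3) V(4) V(1) V(2), of p]
    Rm_skew34[OF V(2) V(3) V(1) V(4), of p]
    Rm_skew34[OF V(4) V(1) V(2) V(3), of p]
    Rm_skew12[OF V(3) V(1) V(4) V(2), of p]
    Rm_skew34[OF V(3) V(1) V(2) V(4), of p]
    Rm_skew12[OF V(4) V(2) V(1) V(3), of p]
    Rm_skew34[OF V(4) V(2) V(3) V(1), of p]
  by linarith

text \<open>The two terms with a derivative of f cancel. The first slot suffices, as the symmetries
  carry any other slot there.\<close>

lemma tensorial_Rm:
  assumes V: "VF Y" "VF Z" "VF W"
  shows "tensorial CB p (\<lambda>X. Rm X Y Z W p)"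
proof (rule tensorialI)
  fix X X' assume "X \<in> sections \<A> CB" "X' \<in> sections \<A> CB"
  then have "VF X" "VF X'" by (auto simp: sections_SD)
  then show "Rm (X + X') Y Z W p = Rm X Y Z W p + Rm X' Y Z W p"
    using V by (simp add: Rm_def bar_curv_D D_add_left D_add_right ip_simps)
next
  fix f X assume "smooth_fun \<A> f" "X \<in> sections \<A> CB"
  then have "smooth_fun \<A> f" "VF X" by (auto simp: sections_SD)
  then show "Rm (f *\<^sub>F X) Y Z W p = f p * Rm X Y Z W p"
    using V by (simp add: Rm_def bar_curv_D D_scale_left D_leibniz D_add_left ip_simps VF_smooth algebra_simps)
qed

section \<open>The covariant derivatives of the Reeb field and of the fundamental form\<close>

lemma D_xi_SD [simp]: assumes "VF X" shows "SD (D X \<xi>)"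
proof -
  have "X p (ip \<xi> \<xi>) = 0" for p
    using tangent_const[OF VF_tangent[OF assms, of p], of 1] ip_xi_xi by (simp add: ext[of "ip \<xi> \<xi>" "\<lambda>p. 1"])
  then have "ip \<xi> (D X \<xi>) p = 0" for p
    using D_metric[OF assms xi_VF xi_VF, of p] ip_sym[OF D_VF[OF assms xi_VF] xi_VF, of p]
    by (metis add_eq_0_iff neg_equal_zero)
  then show ?thesis using assms by (simp add: SD_def)
qed

text \<open>Differentiate \<open>ip \<xi> Z = 0\<close>. This is the normal component of
  \<open>D X Z\<close>, the source of the correction terms in the Gauss equation.\<close>

lemma ip_xi_D: assumes "VF X" "SD Z" shows "ip \<xi> (D X Z) p = - ip (D X \<xi>) Z p"
proof -
  have "ip \<xi> Z = (\<lambda>p. 0)" using assms by (auto simp: ip_xi_SD)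
  then have "X p (ip \<xi> Z) = 0" using tangent_const[OF VF_tangent[OF assms(1)]] by simp
  then show ?thesis using assms by (simp add: D_metric)
qed

text \<open>The contact condition in terms of the connection: terms with
  \<open>ip \<xi> (D X Y)\<close> cancel against the bracket. The 2 undoes the 1/2 in
  \<open>ext_deriv\<close>.\<close>

lemma D_xi_skew: assumes V: "VF X" "VF Y" shows "ip (D X \<xi>) Y p - ip (D Y \<xi>) X p = 2 * ip X (J Y) p"
proof -
  have "ext_deriv \<eta> X Y p = ip X (J Y) p"
    using contact V by (simp add: contact_metric_def ip_def J_op_def)
  moreover have "ext_deriv \<eta> X Y p = (X p (ip \<xi> Y) - Y p (ip \<xi> X) - ip \<xi> (lie_bracket X Y) p) / 2"
    by (simp add: ext_deriv_def eta_eq dual_form_def ip_def)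
  ultimately show ?thesis using V by (simp add: D_metric D_torsion ip_simps)
qed

text \<open>Take Y = \<open>D \<xi> \<xi>\<close> in \<open>D_xi_skew\<close>: all other terms
  vanish, leaving its squared norm.\<close>

lemma D_xi_xi: "D \<xi> \<xi> = 0"
proof
  fix p
  have "ip (D \<xi> \<xi>) (D \<xi> \<xi>) p = 0"
    using D_xi_skew[of \<xi> "D \<xi> \<xi>" p] by (simp add: ip_xi_J ip_xi_SD)
  then show "D \<xi> \<xi> p = 0 p" using ip_nondegenerate[of "D \<xi> \<xi>" p] by simp
qed

text \<open>\<open>dphi X Y Z\<close> is \<open>(\<nabla>\<^sub>X \<Phi>)(Y, Z)\<close>.\<close>

definition dphi :: "'a vfield \<Rightarrow> 'a vfield \<Rightarrow> 'a vfield \<Rightarrow> 'a \<Rightarrow> real" where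
  "dphi X Y Z p = ip Y (D X (J Z)) p + ip (J Y) (D X Z) p"

lemma dphi_deriv:
  assumes V: "VF X" "VF Y" "VF Z"
  shows "dphi X Y Z p = X p (ip Y (J Z)) - ip (D X Y) (J Z) p + ip (J Y) (D X Z) p"
  using V by (simp add: dphi_def D_metric)

lemma dphi_skew:
  assumes V: "VF X" "VF Y" "VF Z"
  shows "dphi X Z Y p = - dphi X Y Z p"
proof -
  have "ip Z (J Y) = (\<lambda>q. - ip Y (J Z) q)"
    using V ip_J_left[of Y Z] ip_sym[of Z "J Y"] by auto
  then have "X p (ip Z (J Y)) = - X p (ip Y (J Z))"
    using V tangent_minus[OF VF_tangent[OF V(1), of p], of "ip Y (J Z)"] by simp
  then show ?thesis
    using V ip_sym[of "D X Z" "J Y" p] ip_sym[of "J Z" "D X Y" p] by (simp add: dphi_deriv)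
qed

text \<open>\<open>\<Phi>\<close> is closed, being \<open>d\<eta>\<close>: by \<open>D_xi_skew\<close> its cyclic derivative is a cyclic sum of
  curvature terms \<open>R(X, Y, \<xi>, Z)\<close>, which vanishes by the first Bianchi identity.\<close>

lemma dphi_cyclic:
  assumes V: "VF X" "VF Y" "VF Z"
  shows "dphi X Y Z p + dphi Y Z X p + dphi Z X Y p = 0"
proof -
  \<comment> \<open>The identity \<open>D_xi_skew\<close> differentiated along A: the right side
    consists of second covariant derivatives of \<xi>, whose skew part in the directions is
    curvature.\<close>
  have H: "2 * dphi A B C p = ip (D A (D B \<xi>) - D (D A B) \<xi>) C p - ip (D A (D C \<xi>) - D (D A C) \<xi>) B p"
    if v: "VF A" "VF B" "VF C" for A B C
  proof -
    have "ip (D B \<xi>) C = (\<lambda>q. ip (D C \<xi>) B q + 2 * ip B (J C) q)"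
      using D_xi_skew[OF v(2,3)] by (simp add: fun_eq_iff algebra_simps)
    then have "A p (ip (D B \<xi>) C) = A p (ip (D C \<xi>) B) + 2 * A p (ip B (J C))"
      using v by (simp add: tangent_add[OF VF_tangent[OF v(1)]] tangent_cmult[OF VF_tangent[OF v(1)]] smooth_intros)
    then have 1: "2 * A p (ip B (J C)) = ip (D A (D B \<xi>)) C p + ip (D B \<xi>) (D A C) p
        - ip (D A (D C \<xi>)) B p - ip (D C \<xi>) (D A B) p"
      using v by (simp add: D_metric)
    have 2: "ip (D (D A B) \<xi>) C p - ip (D C \<xi>) (D A B) p = 2 * ip (D A B) (J C) p"
      using v by (simp add: D_xi_skew)
    have 3: "ip (D B \<xi>) (D A C) p - ip (D (D A C) \<xi>) B p = 2 * ip B (J (D A C)) p"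
      using v by (simp add: D_xi_skew)
    have 4: "ip (J B) (D A C) p = - ip B (J (D A C)) p"
      using v by (simp add: ip_J_left)
    show ?thesis
      unfolding dphi_deriv[OF v] using 1 2 3 4 v by (simp add: ip_simps)
  qed
  have R: "ip (D A (D B \<xi>) - D (D A B) \<xi>) C p - ip (D B (D A \<xi>) - D (D B A) \<xi>) C p = - Rm A B C \<xi> p"
    if v: "VF A" "VF B" "VF C" for A B C
    using v Rm_skew34[of A B C \<xi> p] by (simp add: Rm_def bar_curv_D ip_simps)
  show ?thesis
    using H[OF V] H[OF V(2,3,1)] H[OF V(3,1,2)] R[OF V] R[OF V(2,3,1)] R[OF V(3,1,2)]
      Rm_bianchi[OF V xi_VF, of p] by linarith
qed

text \<open>On the contact subbundle J squares to -1, so its covariant derivative anticommutes with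
  J.\<close>

lemma dphi_J_J:
  assumes "VF X" "SD Y" "SD Z"
  shows "dphi X (J Y) (J Z) p = - dphi X Y Z p"
  using assms by (simp add: dphi_def J_J_SD D_minus_right ip_simps)

text \<open>In the cyclic identity with \<xi> in one slot, the other two terms reduce to derivatives
  of \<xi> because \<open>J \<xi> = 0\<close>.\<close>

lemma dphi_xi_aux:
  assumes "SD Y" "SD Z"
  shows "dphi \<xi> Y Z p = ip (J Y) (D Z \<xi>) p - ip (J Z) (D Y \<xi>) p"
proof -
  have "dphi Y Z \<xi> p = ip (J Z) (D Y \<xi>) p" "dphi Z Y \<xi> p = ip (J Y) (D Z \<xi>) p"
    using assms by (simp_all add: dphi_def J_xi D_zero_right ip_simps)
  then show ?thesis
    using dphi_cyclic[of \<xi> Y Z p] dphi_skew[of Z Y \<xi> p] assms by simp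
qed

text \<open>The endomorphism \<open>\<nabla>\<^sub>\<xi> J\<close> anticommutes with \<open>J\<close>, whereas the formula of \<open>dphi_xi_aux\<close>
  commutes with \<open>J\<close>.\<close>

lemma dphi_xi:
  assumes V: "SD Y" "SD Z"
  shows "dphi \<xi> Y Z p = 0"
proof -
  have "dphi \<xi> (J Y) (J Z) p = ip (D Z \<xi>) (J Y) p - ip (D Y \<xi>) (J Z) p"
  proof -
    have "dphi \<xi> (J Y) (J Z) p = ip Z (D (J Y) \<xi>) p - ip Y (D (J Z) \<xi>) p"
      using V by (simp add: dphi_xi_aux J_J_SD ip_simps)
    then show ?thesis
      using D_xi_skew[of "J Y" Z p] D_xi_skew[of "J Z" Y p] V ip_sym[of Z "D (J Y) \<xi>" p]
        ip_sym[of Y "D (J Z) \<xi>" p] ip_sym[of "J Z" "J Y" p] by simp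
  qed
  then show ?thesis
    using dphi_J_J[of \<xi> Y Z p] dphi_xi_aux[OF V] V ip_sym[of "D Y \<xi>" "J Z" p]
      ip_sym[of "D Z \<xi>" "J Y" p] by simp
qed

text \<open>Equivalent to the symmetric part of \<open>D _ \<xi>\<close> anticommuting with J; the
  skew part -J satisfies the identity by itself.\<close>

lemma D_xi_J:
  assumes "SD Y" "SD Z"
  shows "ip (D Z \<xi>) (J Y) p = ip (D Y \<xi>) (J Z) p"
  using dphi_xi[OF assms] dphi_xi_aux[OF assms] assms ip_sym[of "J Y" "D Z \<xi>" p]
    ip_sym[of "J Z" "D Y \<xi>" p] by simp

lemma dphi_add_left: "VF X \<Longrightarrow> VF X' \<Longrightarrow> VF Y \<Longrightarrow> VF Z \<Longrightarrow> dphi (X + X') Y Z p = dphi X Y Z p + dphi X' Y Z p"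
  by (simp add: dphi_def D_add_left ip_simps)

lemma dphi_scale_left: "smooth_fun \<A> f \<Longrightarrow> VF X \<Longrightarrow> VF Y \<Longrightarrow> VF Z \<Longrightarrow> dphi (f *\<^sub>F X) Y Z p = f p * dphi X Y Z p"
  by (simp add: dphi_def D_scale_left ip_simps algebra_simps)

lemma dphi_add_mid: "VF X \<Longrightarrow> VF Y \<Longrightarrow> VF Y' \<Longrightarrow> VF Z \<Longrightarrow> dphi X (Y + Y') Z p = dphi X Y Z p + dphi X Y' Z p"
  by (simp add: dphi_def J_add ip_simps)

lemma dphi_scale_mid: "smooth_fun \<A> f \<Longrightarrow> VF X \<Longrightarrow> VF Y \<Longrightarrow> VF Z \<Longrightarrow> dphi X (f *\<^sub>F Y) Z p = f p * dphi X Y Z p"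
  by (simp add: dphi_def J_scale ip_simps algebra_simps)

subsection \<open>The induced connection in the contact subbundle\<close>

lemma nb_eq: "VF X \<Longrightarrow> VF Y \<Longrightarrow> nb X Y = D X Y - ip \<xi> (D X Y) *\<^sub>F \<xi>"
  by (rule ext) (simp add: bar_conn_def orth_proj_eq fscale_apply ip_def)

lemma nb_SD [simp]: "VF X \<Longrightarrow> VF Y \<Longrightarrow> SD (nb X Y)"
  by (simp add: nb_eq SD_def ip_simps ip_xi_xi)

lemma ip_nb: "VF X \<Longrightarrow> VF Y \<Longrightarrow> SD W \<Longrightarrow> ip (nb X Y) W p = ip (D X Y) W p"
  by (simp add: nb_eq ip_simps ip_xi_SD)

lemma ip_nb_right: "VF X \<Longrightarrow> VF Y \<Longrightarrow> SD W \<Longrightarrow> ip W (nb X Y) p = ip W (D X Y) p"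
  by (simp add: nb_eq ip_simps ip_xi_SD)

lemma nb_metric:
  "VF X \<Longrightarrow> SD Y \<Longrightarrow> SD Z \<Longrightarrow> X p (ip Y Z) = ip (nb X Y) Z p + ip Y (nb X Z) p"
  by (simp add: D_metric ip_nb ip_nb_right)

lemma nb_diff_right: "VF X \<Longrightarrow> VF Y \<Longrightarrow> VF Z \<Longrightarrow> nb X (Y - Z) = nb X Y - nb X Z"
  by (rule ext) (simp add: nb_eq D_diff_right ip_simps fscale_apply tvec.scale_left_diff_distrib)

abbreviation "dJ X \<equiv> end_conn nb X J"

lemma dJ_eq: "dJ X Z = nb X (J Z) - J (nb X Z)"
  by (simp add: end_conn_def)

lemma dJ_SD [simp]: "VF X \<Longrightarrow> VF Z \<Longrightarrow> SD (dJ X Z)"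
  by (simp add: dJ_eq)

text \<open>Projection to the contact subbundle does not change products with its sections, so the
  induced derivative of J is measured by \<open>dphi\<close>.\<close>

lemma ip_dJ: "VF X \<Longrightarrow> SD Y \<Longrightarrow> SD Z \<Longrightarrow> ip Y (dJ X Z) p = dphi X Y Z p"
  using ip_J_left[of Y "nb X Z" p] by (simp add: dJ_eq dphi_def ip_simps ip_nb_right)

lemma dphi_smooth [simp]: "VF X \<Longrightarrow> SD Y \<Longrightarrow> SD Z \<Longrightarrow> smooth_fun \<A> (dphi X Y Z)"
  using ip_smooth[of Y "dJ X Z"] ip_dJ[of X Y Z] by (simp add: ext[of "ip Y (dJ X Z)" "dphi X Y Z"])

text \<open>The \<xi>-component of the direction is lost because J is parallel along \<xi>. This
  gives all slots of the cyclic identity the same derivative \<open>nb V X\<close>.\<close>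

lemma dphi_D:
  assumes "VF V" "SD X" "SD Y" "SD Z"
  shows "dphi (D V X) Y Z p = dphi (nb V X) Y Z p"
proof -
  have "D V X = nb V X + ip \<xi> (D V X) *\<^sub>F \<xi>" using assms by (simp add: nb_eq)
  then have "dphi (D V X) Y Z p = dphi (nb V X + ip \<xi> (D V X) *\<^sub>F \<xi>) Y Z p" by simp
  also have "\<dots> = dphi (nb V X) Y Z p"
    using assms by (simp add: dphi_add_left dphi_scale_left dphi_xi)
  finally show ?thesis .
qed

lemma bar_curv_nb: "bar_curv D nb X Y Z = nb X (nb Y Z) - nb (D X Y) Z - (nb Y (nb X Z) - nb (D Y X) Z)"
  by (simp add: bar_curv_def second_cov_def)

text \<open>\<open>d2phi V X Y Z\<close> is \<open>g(Y, (\<nabla>\<^sup>2\<^sub>V\<^sub>,\<^sub>X J) Z)\<close> for the induced connection.\<close>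

definition d2phi :: "'a vfield \<Rightarrow> 'a vfield \<Rightarrow> 'a vfield \<Rightarrow> 'a vfield \<Rightarrow> 'a \<Rightarrow> real" where
  "d2phi V X Y Z p = ip Y (second_cov D (end_conn nb) V X J Z) p"

lemma second_cov_J: "second_cov D (end_conn nb) V X J Z = nb V (dJ X Z) - dJ X (nb V Z) - dJ (D V X) Z"
  by (simp add: second_cov_def end_conn_def)

lemma second_cov_J_SD [simp]: "VF V \<Longrightarrow> VF X \<Longrightarrow> VF Z \<Longrightarrow> SD (second_cov D (end_conn nb) V X J Z)"
  by (simp add: second_cov_J)

lemma d2phi_eq:
  assumes V: "VF V" "VF X" "SD Y" "SD Z"
  shows "d2phi V X Y Z p = V p (dphi X Y Z) - dphi X (nb V Y) Z p - dphi X Y (nb V Z) p - dphi (D V X) Y Z p"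
proof -
  have "dphi X Y Z = ip Y (dJ X Z)" using V by (auto simp: ip_dJ)
  then show ?thesis
    using V by (simp add: d2phi_def second_cov_J ip_simps ip_dJ nb_metric)
qed

lemma d2phi_skew:
  assumes V: "VF V" "VF X" "SD Y" "SD Z"
  shows "d2phi V X Z Y p = - d2phi V X Y Z p"
proof -
  have "dphi X Z Y = (\<lambda>q. - dphi X Y Z q)" using V dphi_skew[of X Y Z] by auto
  then have "V p (dphi X Z Y) = - V p (dphi X Y Z)"
    using V tangent_minus[OF VF_tangent[OF V(1), of p], of "dphi X Y Z"] by simp
  then show ?thesis
    using V dphi_skew[of X "nb V Y" Z p] dphi_skew[of X Y "nb V Z" p] dphi_skew[of "D V X" Y Z p]
    by (simp add: d2phi_eq)
qed

text \<open>Differentiate \<open>dphi_cyclic\<close> along V; the correction terms group into three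
  further cyclic sums, one for each differentiated argument.\<close>

lemma d2phi_cyclic:
  assumes V: "VF V" "SD X" "SD Y" "SD Z"
  shows "d2phi V X Y Z p + d2phi V Y Z X p + d2phi V Z X Y p = 0"
proof -
  have "dphi X Y Z = (\<lambda>q. - (dphi Y Z X q + dphi Z X Y q))"
  proof
    fix q show "dphi X Y Z q = - (dphi Y Z X q + dphi Z X Y q)"
      using V dphi_cyclic[of X Y Z q] by simp
  qed
  then have "V p (dphi X Y Z) = - (V p (dphi Y Z X) + V p (dphi Z X Y))"
    using V by (simp only: tangent_minus[OF VF_tangent[OF V(1)]] tangent_add[OF VF_tangent[OF V(1)]]
        smooth_intros dphi_smooth SD_VF)
  then show ?thesis
    using V dphi_cyclic[of "nb V X" Y Z p] dphi_cyclic[of X "nb V Y" Z p] dphi_cyclic[of X Y "nb V Z" p]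
    by (simp add: d2phi_eq dphi_D)
qed

text \<open>The Ricci identity: exchanging derivatives of an endomorphism field costs its commutator
  with the curvature.\<close>

lemma d2phi_commute:
  assumes V: "VF V" "VF X" "SD Y" "SD Z"
  shows "d2phi V X Y Z p - d2phi X V Y Z p =
    ip Y (bar_curv D nb V X (J Z)) p + ip (J Y) (bar_curv D nb V X Z) p"
proof -
  have "second_cov D (end_conn nb) V X J Z - second_cov D (end_conn nb) X V J Z =
      bar_curv D nb V X (J Z) - J (bar_curv D nb V X Z)"
    using V by (simp add: second_cov_J dJ_eq bar_curv_nb nb_diff_right J_diff)
  then have "ip Y (second_cov D (end_conn nb) V X J Z - second_cov D (end_conn nb) X V J Z) p =
      ip Y (bar_curv D nb V X (J Z) - J (bar_curv D nb V X Z)) p" by simp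
  then show ?thesis
    using V ip_J_left[of Y "bar_curv D nb V X Z" p]
    by (simp add: d2phi_def ip_simps bar_curv_nb)
qed

text \<open>The derivative of f from differentiating \<open>dphi\<close> cancels against the one
  from \<open>D V (f *\<^sub>F X)\<close>. With the companion for the first slot, the Laplacian may
  be computed in any frame.\<close>

lemma tensorial_d2phi_right:
  assumes V: "VF V" "SD Y" "SD Z"
  shows "tensorial TS p (\<lambda>X. d2phi V X Y Z p)"
proof (rule tensorialI)
  fix X X' assume "X \<in> sections \<A> TS" "X' \<in> sections \<A> TS"
  then have X: "VF X" "VF X'" by (auto simp: sections_tangent)
  have "dphi (X + X') Y Z = (\<lambda>q. dphi X Y Z q + dphi X' Y Z q)"
    using V X by (auto simp: dphi_add_left)
  then show "d2phi V (X + X') Y Z p = d2phi V X Y Z p + d2phi V X' Y Z p"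
    using V X by (simp add: d2phi_eq dphi_add_left D_add_right tangent_add[OF VF_tangent[OF V(1)]])
next
  fix f X assume "smooth_fun \<A> f" "X \<in> sections \<A> TS"
  then have X: "smooth_fun \<A> f" "VF X" by (auto simp: sections_tangent)
  have "dphi (f *\<^sub>F X) Y Z = (\<lambda>q. f q * dphi X Y Z q)"
    using V X by (auto simp: dphi_scale_left)
  then show "d2phi V (f *\<^sub>F X) Y Z p = f p * d2phi V X Y Z p"
    using V X by (simp add: d2phi_eq dphi_add_left dphi_scale_left D_leibniz VF_smooth
        tangent_mult[OF VF_tangent[OF V(1)]] algebra_simps)
qed

lemma tensorial_d2phi_left:
  assumes V: "VF X" "SD Y" "SD Z"
  shows "tensorial TS p (\<lambda>V. d2phi V X Y Z p)"
proof -
  have add: "nb (V + V') W = nb V W + nb V' W" if "VF V" "VF V'" "VF W" for V V' W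
    using that by (intro ext) (simp add: nb_eq D_add_left ip_simps fscale_apply tvec.scale_left_distrib)
  have sc: "nb (f *\<^sub>F V) W = f *\<^sub>F nb V W" if "smooth_fun \<A> f" "VF V" "VF W" for f V W
    using that by (intro ext)
      (simp add: nb_eq D_scale_left ip_simps fscale_apply tvec.scale_right_diff_distrib)
  have sk: "dphi X Y W p = - dphi X W Y p" if "VF W" for W
    using dphi_skew[of X W Y p] V that by simp
  show ?thesis
  proof (rule tensorialI)
    fix W W' assume "W \<in> sections \<A> TS" "W' \<in> sections \<A> TS"
    then have W: "VF W" "VF W'" by (auto simp: sections_tangent)
    then show "d2phi (W + W') X Y Z p = d2phi W X Y Z p + d2phi W' X Y Z p"
      using V by (simp add: d2phi_eq dphi_add_left dphi_add_mid D_add_left add sk)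
  next
    fix f W assume "smooth_fun \<A> f" "W \<in> sections \<A> TS"
    then have W: "smooth_fun \<A> f" "VF W" by (auto simp: sections_tangent)
    then show "d2phi (f *\<^sub>F W) X Y Z p = f p * d2phi W X Y Z p"
      using V by (simp add: d2phi_eq dphi_scale_left dphi_scale_mid D_scale_left sc sk
          fscale_apply tscale_apply algebra_simps)
  qed
qed

text \<open>Only the normal component of the inner derivative matters: by \<open>ip_xi_D\<close> it
  is a multiple of \<xi>, and differentiating it again leaves, inside the subbundle, that multiple
  times the derivative of \<xi>.\<close>

lemma gauss_equation:
  assumes V: "VF X" "VF Y" "SD Z" "SD W"
  shows "ip (bar_curv D nb X Y Z) W p = Rm X Y Z W p
    + ip Z (D Y \<xi>) p * ip (D X \<xi>) W p - ip Z (D X \<xi>) p * ip (D Y \<xi>) W p"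
proof -
  have 1: "ip (nb A (nb B Z)) W p = ip (D A (D B Z)) W p + ip Z (D B \<xi>) p * ip (D A \<xi>) W p"
    if "VF A" "VF B" for A B
  proof -
    have "ip (nb A (nb B Z)) W p = ip (D A (nb B Z)) W p" using that V by (simp add: ip_nb)
    also have "\<dots> = ip (D A (D B Z)) W p - ip \<xi> (D B Z) p * ip (D A \<xi>) W p"
      using that V by (simp add: nb_eq D_diff_right D_leibniz ip_simps ip_xi_SD VF_smooth)
    finally show ?thesis using that V ip_sym[of Z "D B \<xi>" p] by (simp add: ip_xi_D)
  qed
  show ?thesis
    using V by (simp add: bar_curv_nb Rm_def bar_curv_D ip_simps 1 ip_nb[of "D X Y"] ip_nb[of "D Y X"])
qed

lemma bar_curv_VF [simp]: "VF X \<Longrightarrow> VF Y \<Longrightarrow> VF Z \<Longrightarrow> VF (bar_curv D nb X Y Z)"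
  by (simp add: bar_curv_def second_cov_def)

lemma bar_curv_skew34:
  assumes "VF X" "VF Y" "SD Z" "SD W"
  shows "ip (bar_curv D nb X Y W) Z p = - ip (bar_curv D nb X Y Z) W p"
  using assms ip_sym[of Z "D Y \<xi>" p] ip_sym[of Z "D X \<xi>" p] ip_sym[of W "D Y \<xi>" p] ip_sym[of W "D X \<xi>" p]
    Rm_skew34[of X Y Z W p]
  by (simp add: gauss_equation)

lemma bar_curv_skew12: "bar_curv D nb Y X Z = - bar_curv D nb X Y Z"
  by (simp add: bar_curv_def)

abbreviation "is_frame p S \<equiv> local_orthonormal_frame \<A> g CB p S"

subsection \<open>Adapted frames\<close>

lemma is_frameI:
  assumes "finite S" "S \<subseteq> sections \<A> B" "open U" "p \<in> U"
    and "\<And>q E F. q \<in> U \<Longrightarrow> E \<in> S \<Longrightarrow> F \<in> S \<Longrightarrow> g q (E q) (F q) = (if E = F then 1 else 0)"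
    and "\<And>q v. q \<in> U \<Longrightarrow> v \<in> B q \<Longrightarrow> \<exists>c. v = (\<Sum>E\<in>S. c E *\<^sub>T E q)"
  shows "local_orthonormal_frame \<A> g B p S"
  unfolding local_orthonormal_frame_def
  by (intro conjI exI[of _ U] ballI assms)

text \<open>Complete \<xi> to a full orthonormal frame and discard \<xi>.\<close>

lemma is_frame_ex:
  obtains S where "is_frame p S"
proof -
  have "orthonormal_near p {\<xi>}"
    by (auto simp: orthonormal_near_def orthonormal_at_def xi_unit intro: exI[of _ UNIV])
  then obtain S' where S': "{\<xi>} \<subseteq> S'" "orthonormal_near p S'" "card S' = DIM('e)"
    by (rule orthonormal_near_extend_full) (rule that)
  obtain U where U: "open U" "p \<in> U" "\<And>q. q \<in> U \<Longrightarrow> orthonormal_at q S'"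
    and VS: "\<And>E. E \<in> S' \<Longrightarrow> VF E" using S'(2) by (auto simp: orthonormal_near_def)
  note fin = orthonormal_atD(1)[OF U(3)[OF U(2)]]
  \<comment> \<open>The other fields are orthogonal to \<xi> only on U; \<open>?P\<close> makes them
    sections of the subbundle everywhere and leaves them unchanged on U.\<close>
  let ?P = "\<lambda>E. E - ip \<xi> E *\<^sub>F \<xi>"
  let ?S = "?P ` (S' - {\<xi>})"
  have Pq: "?P E q = E q" if "q \<in> U" "E \<in> S' - {\<xi>}" for E q
    using orthonormal_atD(3)[OF U(3)[OF that(1)], of \<xi> E] that(2) S'(1) by (auto simp: fscale_apply ip_def)
  have inj: "inj_on ?P (S' - {\<xi>})"
  proof (rule inj_onI)
    fix E F assume E: "E \<in> S' - {\<xi>}" "F \<in> S' - {\<xi>}" "?P E = ?P F"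
    then have "E p = F p" using Pq[OF U(2) E(1)] Pq[OF U(2) E(2)] by simp
    then show "E = F" using inj_onD[OF orthonormal_inj[OF U(3)[OF U(2)]], of E F] E(1,2) by simp
  qed
  have span: "\<exists>c. v = (\<Sum>E\<in>?S. c E *\<^sub>T E q)" if q: "q \<in> U" and v: "v \<in> CB q" for q v
  proof -
    have "v = (\<Sum>E\<in>S'. g q v (E q) *\<^sub>T E q)"
      using v by (intro orthonormal_full_expand[OF U(3)[OF q] S'(3)]) (simp add: contact_bundle_eq)
    also have "\<dots> = (\<Sum>E\<in>S' - {\<xi>}. g q v (E q) *\<^sub>T E q)"
      using fin S'(1) v g_sym[of v q "\<xi> q"] by (simp add: sum.remove[of S' \<xi>] contact_bundle_eq)
    also have "\<dots> = (\<Sum>E\<in>S' - {\<xi>}. g q v (?P E q) *\<^sub>T ?P E q)"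
      by (rule sum.cong[OF refl]) (simp only: Pq[OF q])
    also have "\<dots> = (\<Sum>E\<in>?S. g q v (E q) *\<^sub>T E q)"
      by (simp only: sum.reindex[OF inj] o_def)
    finally show ?thesis by (intro exI[of _ "\<lambda>E. g q v (E q)"])
  qed
  have on: "g q (E q) (F q) = (if E = F then 1 else 0)" if q: "q \<in> U" and "E \<in> ?S" "F \<in> ?S" for q E F
  proof -
    obtain E' F' where E': "E = ?P E'" "E' \<in> S' - {\<xi>}" "F = ?P F'" "F' \<in> S' - {\<xi>}" using \<open>E \<in> ?S\<close> \<open>F \<in> ?S\<close> by blast
    have "(E = F) = (E' = F')" unfolding E'(1,3) by (rule inj_on_eq_iff[OF inj E'(2,4)])
    moreover have "g q (E q) (F q) = g q (E' q) (F' q)"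
      unfolding E'(1,3) by (simp only: Pq[OF q E'(2)] Pq[OF q E'(4)])
    ultimately show ?thesis using orthonormal_atD(3)[OF U(3)[OF q], of E' F'] E'(2,4) by simp
  qed
  have "?S \<subseteq> sections \<A> CB"
    using VS by (auto simp: sections_SD SD_def ip_simps ip_xi_xi)
  then have "is_frame p ?S"
    using fin by (intro is_frameI[OF _ _ U(1,2) on span]) auto
  then show thesis by (rule that)
qed

lemma is_frame_SD: "is_frame p S \<Longrightarrow> F \<in> S \<Longrightarrow> SD F"
  unfolding local_orthonormal_frame_def sections_SD by blast

text \<open>One set of fields serves all points near p, so identities between traces can be
  differentiated at p.\<close>

lemma is_frame_nearby:
  assumes "is_frame p S"
  obtains U where "open U" "p \<in> U" "\<And>q. q \<in> U \<Longrightarrow> is_frame q S"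
  using assms unfolding local_orthonormal_frame_def by blast

lemma is_frame_orthonormal: "is_frame p S \<Longrightarrow> E \<in> S \<Longrightarrow> F \<in> S \<Longrightarrow> ip E F p = (if E = F then 1 else 0)"
  unfolding local_orthonormal_frame_def ip_def by blast

lemma is_frame_adjoin_xi:
  assumes S: "is_frame p S"
  shows "local_orthonormal_frame \<A> g TS p (insert \<xi> S)" "\<xi> \<notin> S" "card S + 1 \<le> DIM('e)"
proof -
  obtain U where U: "open U" "p \<in> U" "\<And>q. q \<in> U \<Longrightarrow> orthonormal_at q S"
    "\<And>q v. q \<in> U \<Longrightarrow> v \<in> CB q \<Longrightarrow> v = (\<Sum>E\<in>S. g q v (E q) *\<^sub>T E q)"
    by (rule frame_coeff[OF S contact_bundle_tangent]) (rule that)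
  have fin: "finite S" using S by (simp add: local_orthonormal_frame_def)
  have xiF: "g q (\<xi> q) (F q) = 0" "g q (F q) (\<xi> q) = 0" if "F \<in> S" for q F
    using ip_xi_SD[OF is_frame_SD[OF S that], of q] by (auto simp: ip_def)
  show xi: "\<xi> \<notin> S" using xiF xi_unit by fastforce
  have SV: "\<And>E. E \<in> insert \<xi> S \<Longrightarrow> VF E" using is_frame_SD[OF S] by auto
  have on: "orthonormal_at q (insert \<xi> S)" if "q \<in> U" for q
    using U(3)[OF that] xi xiF xi_unit by (auto simp: orthonormal_at_def)
  have span: "\<exists>c. v = (\<Sum>E\<in>insert \<xi> S. c E *\<^sub>T E q)" if q: "q \<in> U" and v: "v \<in> TS q" for q v
  proof -
    let ?w = "v - g q (\<xi> q) v *\<^sub>T \<xi> q"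
    have "?w \<in> CB q" using v
      by (simp add: contact_bundle_eq tangent_space_diff tangent_space_scale g_diff_right g_scale_right xi_unit)
    from U(4)[OF q this]
    have "v = g q (\<xi> q) v *\<^sub>T \<xi> q + (\<Sum>E\<in>S. g q ?w (E q) *\<^sub>T E q)" by (simp add: algebra_simps)
    also have "\<dots> = (\<Sum>E\<in>insert \<xi> S. (if E = \<xi> then g q (\<xi> q) v else g q ?w (E q)) *\<^sub>T E q)"
      using fin xi by (simp add: sum.insert) (intro sum.cong refl, auto)
    finally show ?thesis by (intro exI[of _ "\<lambda>E. if E = \<xi> then g q (\<xi> q) v else g q ?w (E q)"])
  qed
  show "local_orthonormal_frame \<A> g TS p (insert \<xi> S)"
    by (rule is_frameI[OF _ _ U(1,2) orthonormal_atD(3)[OF on] span])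
       (use fin SV in \<open>auto simp: sections_tangent\<close>)
  show "card S + 1 \<le> DIM('e)"
    using orthonormal_card_le[OF on[OF U(2)]] xi fin by simp
qed

lemma is_frame_J:
  assumes S: "is_frame p S"
  shows "is_frame p (J ` S)" "inj_on J S"
proof -
  have SS: "\<And>F. F \<in> S \<Longrightarrow> SD F" by (rule is_frame_SD[OF S])
  show inj: "inj_on J S"
  proof (rule inj_onI)
    fix E F assume EF: "E \<in> S" "F \<in> S" and eq: "J E = J F"
    have "- E = - F"
      using J_J_SD[OF SS[OF EF(1)]] J_J_SD[OF SS[OF EF(2)]] unfolding eq by (rule trans[OF sym])
    then show "E = F" by (simp only: neg_equal_iff_equal)
  qed
  obtain U where U: "open U" "p \<in> U" "\<And>q. q \<in> U \<Longrightarrow> orthonormal_at q S"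
    "\<And>q v. q \<in> U \<Longrightarrow> v \<in> CB q \<Longrightarrow> v = (\<Sum>E\<in>S. g q v (E q) *\<^sub>T E q)"
    by (rule frame_coeff[OF S contact_bundle_tangent]) (rule that)
  have fin: "finite S" using S by (simp add: local_orthonormal_frame_def)
  have on: "g q (E q) (F q) = (if E = F then 1 else 0)" if q: "q \<in> U" and EF: "E \<in> J ` S" "F \<in> J ` S" for q E F
  proof -
    obtain E' F' where E': "E = J E'" "E' \<in> S" "F = J F'" "F' \<in> S" using EF by blast
    then have "(E = F) = (E' = F')" by (simp add: inj_on_eq_iff[OF inj])
    moreover have "g q (E q) (F q) = g q (E' q) (F' q)"
      using ip_J_J_SD[of E' F' q] SS E' by (simp add: ip_def)
    ultimately show ?thesis using orthonormal_atD(3)[OF U(3)[OF q]] E' by simp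
  qed
  have span: "\<exists>c. v = (\<Sum>E\<in>J ` S. c E *\<^sub>T E q)" if q: "q \<in> U" and v: "v \<in> CB q" for q v
  proof -
    have vT: "v \<in> TS q" using v by (simp add: contact_bundle_eq)
    \<comment> \<open>Since v = J (-J v) on the subbundle, expand -J v in S and apply J to the
      expansion.\<close>
    let ?w = "- \<phi> q v"
    have w: "?w \<in> CB q"
      using vT by (simp add: contact_bundle_eq tangent_space_minus phi_tangent g_minus_right eta_phi)
    have lin: "\<phi> q (\<Sum>E\<in>I. c E *\<^sub>T E q) = (\<Sum>E\<in>I. c E *\<^sub>T \<phi> q (E q))" if "I \<subseteq> S" for I c
      using finite_subset[OF that fin] that
    proof (induction I rule: finite_induct)
      case empty
      have "\<phi> q 0 = 0"
        using phi_scale[OF tangent_space_zero, of q 0] by (simp only: tvec.scale_zero_left)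
      then show ?case by (simp only: sum.empty)
    next
      case (insert E I)
      have "(\<Sum>E\<in>I. c E *\<^sub>T E q) \<in> TS q"
        using insert.prems SS by (intro tangent_space_sum tangent_space_scale VF_tangent SD_VF) auto
      then show ?case
        using insert SS[of E] phi_add[of "c E *\<^sub>T E q" q "\<Sum>E\<in>I. c E *\<^sub>T E q"]
        by (simp only: sum.insert insert_subset phi_scale tangent_space_scale VF_tangent SD_VF simp_thms)
    qed
    have "v = \<phi> q ?w" using vT v by (simp add: phi_minus phi_phi phi_tangent contact_bundle_eq)
    also have "\<dots> = \<phi> q (\<Sum>E\<in>S. g q ?w (E q) *\<^sub>T E q)"
      by (rule arg_cong[OF U(4)[OF q w]])
    also have "\<dots> = (\<Sum>E\<in>S. g q ?w (E q) *\<^sub>T J E q)"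
      by (simp only: lin[OF subset_refl] J_apply)
    also have "\<dots> = (\<Sum>E\<in>J ` S. g q ?w (inv_into S J E q) *\<^sub>T E q)"
      using inj by (simp add: sum.reindex)
    finally show ?thesis by (intro exI[of _ "\<lambda>E. g q ?w (inv_into S J E q)"])
  qed
  have "J ` S \<subseteq> sections \<A> CB" using SS by (auto simp: sections_SD)
  then show "is_frame p (J ` S)"
    using fin by (intro is_frameI[OF _ _ U(1,2) on span]) auto
qed

lemma expand_SD:
  assumes "is_frame p S" "tensorial CB p T" "SD X"
  shows "T X = (\<Sum>E\<in>S. ip X E p * T E)"
  using tensorial_expand[OF assms(1) contact_bundle_subspace contact_bundle_tangent assms(2)] assms(3)
  by (simp add: sections_SD ip_def)

lemma trace_J:
  assumes S: "is_frame p S"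
    and T: "\<And>X. SD X \<Longrightarrow> tensorial CB p (T X)" "\<And>X. SD X \<Longrightarrow> tensorial CB p (\<lambda>Y. T Y X)"
  shows "(\<Sum>F\<in>S. T (J F) (J F)) = (\<Sum>F\<in>S. T F F)"
  using trace_frame_independent[OF is_frame_J(1)[OF S] S contact_bundle_subspace contact_bundle_tangent, of T] T
  by (simp add: sections_SD sum.reindex[OF is_frame_J(2)[OF S]])

subsection \<open>Traces of the covariant derivatives of \<open>J\<close>\<close>

lemma tensorial_dphi_left: "SD Y \<Longrightarrow> SD Z \<Longrightarrow> tensorial CB p (\<lambda>X. dphi X Y Z p)"
  by (rule tensorialI) (auto simp: sections_SD dphi_add_left dphi_scale_left)

lemma tensorial_dphi_mid: "VF X \<Longrightarrow> SD Z \<Longrightarrow> tensorial CB p (\<lambda>Y. dphi X Y Z p)"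
  by (rule tensorialI) (auto simp: sections_SD dphi_add_mid dphi_scale_mid)

text \<open>Replacing F by \<open>J F\<close> reverses the sign of each term but preserves the
  trace.\<close>

lemma trace_dphi:
  assumes S: "is_frame p S" and Z: "SD Z"
  shows "(\<Sum>F\<in>S. dphi F F Z p) = 0"
proof -
  have *: "dphi (J F) (J F) Z p = - dphi F F Z p" if "F \<in> S" for F
  proof -
    have F: "SD F" by (rule is_frame_SD[OF S that])
    \<comment> \<open>A skew form that changes sign under J vanishes on the pair F, J F.\<close>
    have "dphi (J Z) F (J F) p = 0"
      using dphi_skew[of "J Z" F "J F" p] dphi_J_J[of "J Z" F "J F" p] F Z
      by (simp add: J_J_SD dphi_def ip_simps D_minus_right J_minus)
    then have "dphi F (J F) (J Z) p + dphi (J F) (J Z) F p = 0"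
      using dphi_cyclic[of F "J F" "J Z" p] F Z by simp
    then have "dphi F (J F) (J Z) p = dphi (J F) F (J Z) p"
      using dphi_skew[of "J F" F "J Z" p] F Z by simp
    moreover have "dphi F (J F) (J Z) p = - dphi F F Z p" using F Z by (simp add: dphi_J_J)
    moreover have "dphi (J F) (J (J F)) (J Z) p = - dphi (J F) (J F) Z p"
      using F Z by (simp add: dphi_J_J)
    moreover have "dphi (J F) (- F) (J Z) p = - dphi (J F) F (J Z) p"
      using F Z by (simp add: dphi_def J_minus ip_simps)
    ultimately show ?thesis using F by (simp add: J_J_SD)
  qed
  have "(\<Sum>F\<in>S. dphi (J F) (J F) Z p) = (\<Sum>F\<in>S. dphi F F Z p)"
    using trace_J[OF S, of "\<lambda>X Y. dphi X Y Z p"] Z by (simp add: tensorial_dphi_left tensorial_dphi_mid)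
  then show ?thesis using * by (simp add: sum_negf)
qed

text \<open>Differentiate \<open>trace_dphi\<close> along V in a frame fixed near p; the terms in
  which V hits the two frame arguments cancel.\<close>

lemma trace_d2phi:
  assumes S: "is_frame p S" and V: "VF V" and Z: "SD Z"
  shows "(\<Sum>F\<in>S. d2phi V F F Z p) = 0"
proof -
  have SS: "\<And>F. F \<in> S \<Longrightarrow> SD F" by (rule is_frame_SD[OF S])
  obtain U where U: "open U" "p \<in> U" "\<And>q. q \<in> U \<Longrightarrow> is_frame q S"
    by (rule is_frame_nearby[OF S]) (rule that)
  have "(\<Sum>F\<in>S. V p (dphi F F Z)) = V p (\<lambda>q. \<Sum>F\<in>S. dphi F F Z q)"
    using tangent_sum[OF VF_tangent[OF V, of p], of S "\<lambda>F. dphi F F Z"] SS Z by simp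
  also have "\<dots> = V p (\<lambda>q. 0)"
    by (rule tangent_local[OF VF_tangent[OF V] _ _ U(1,2)])
       (use SS Z trace_dphi[OF U(3) Z] in \<open>auto intro!: smooth_intros\<close>)
  also have "\<dots> = 0" by (rule tangent_const[OF VF_tangent[OF V]])
  finally have 1: "(\<Sum>F\<in>S. V p (dphi F F Z)) = 0" .
  \<comment> \<open>The products of frame fields are constant near p, so the connection matrix is
    skew.\<close>
  have sk: "ip (nb V F) E p = - ip (nb V E) F p" if "F \<in> S" "E \<in> S" for E F
  proof -
    have "V p (ip F E) = V p (\<lambda>q. if F = E then 1 else 0)"
      by (rule tangent_local[OF VF_tangent[OF V] _ _ U(1,2)])
         (use SS that is_frame_orthonormal[OF U(3)] in \<open>auto intro!: smooth_intros\<close>)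
    then have "V p (ip F E) = 0" using tangent_const[OF VF_tangent[OF V]] by simp
    then show ?thesis
      using V SS that ip_sym[of F "nb V E" p] by (simp add: nb_metric)
  qed
  have 2: "(\<Sum>F\<in>S. dphi F (nb V F) Z p) = (\<Sum>F\<in>S. \<Sum>E\<in>S. ip (nb V F) E p * dphi F E Z p)"
    using V Z SS by (intro sum.cong refl expand_SD[OF S tensorial_dphi_mid]) auto
  have "(\<Sum>F\<in>S. dphi (D V F) F Z p) = (\<Sum>F\<in>S. \<Sum>E\<in>S. ip (nb V F) E p * dphi E F Z p)"
  proof (rule sum.cong[OF refl])
    fix F assume F: "F \<in> S"
    have "dphi (D V F) F Z p = dphi (nb V F) F Z p" using V Z SS F by (simp add: dphi_D)
    also have "\<dots> = (\<Sum>E\<in>S. ip (nb V F) E p * dphi E F Z p)"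
      using V Z SS F by (intro expand_SD[OF S tensorial_dphi_left[of F Z]]) auto
    finally show "dphi (D V F) F Z p = (\<Sum>E\<in>S. ip (nb V F) E p * dphi E F Z p)" .
  qed
  \<comment> \<open>Renaming the indices turns the differentiated direction into the differentiated
    middle argument, with a sign from \<open>sk\<close>.\<close>
  also have "\<dots> = (\<Sum>F\<in>S. \<Sum>E\<in>S. ip (nb V E) F p * dphi F E Z p)"
    by (rule sum.swap)
  also have "\<dots> = (\<Sum>F\<in>S. \<Sum>E\<in>S. - (ip (nb V F) E p * dphi F E Z p))"
  proof (intro sum.cong refl)
    fix F E assume "F \<in> S" "E \<in> S"
    from sk[OF this] show "ip (nb V E) F p * dphi F E Z p = - (ip (nb V F) E p * dphi F E Z p)" by simp
  qed
  also have "\<dots> = - (\<Sum>F\<in>S. dphi F (nb V F) Z p)"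
    unfolding 2 by (simp add: sum_negf)
  finally have 3: "(\<Sum>F\<in>S. dphi (D V F) F Z p) = - (\<Sum>F\<in>S. dphi F (nb V F) Z p)" .
  have 4: "(\<Sum>F\<in>S. dphi F F (nb V Z) p) = 0" using V Z by (intro trace_dphi[OF S]) simp
  have "(\<Sum>F\<in>S. d2phi V F F Z p) = (\<Sum>F\<in>S. V p (dphi F F Z) - dphi F (nb V F) Z p
      - dphi F F (nb V Z) p - dphi (D V F) F Z p)"
    using V Z SS by (intro sum.cong refl d2phi_eq) auto
  then show ?thesis using 1 3 4 by (simp add: sum_subtractf)
qed

subsection \<open>Ricci and star-Ricci curvature of the contact subbundle\<close>

definition ric :: "'a vfield set \<Rightarrow> 'a vfield \<Rightarrow> 'a vfield \<Rightarrow> 'a \<Rightarrow> real" where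
  "ric S Y W p = (\<Sum>F\<in>S. ip (bar_curv D nb F Y W) F p)"

definition star_ric :: "'a vfield set \<Rightarrow> 'a vfield \<Rightarrow> 'a vfield \<Rightarrow> 'a \<Rightarrow> real" where
  "star_ric S X Y p = (\<Sum>F\<in>S. ip (bar_curv D nb X F (J F)) (J Y) p)"

text \<open>By \<open>bar_curv_skew34\<close>, W moves into the metric slot, where the sign is
  immediate.\<close>

lemma ric_minus_right:
  assumes S: "is_frame p S" and V: "SD Y" "SD W"
  shows "ric S Y (- W) p = - ric S Y W p"
proof -
  have "ip (bar_curv D nb F Y (- W)) F p = - ip (bar_curv D nb F Y W) F p" if "F \<in> S" for F
    using V is_frame_SD[OF S that] bar_curv_skew34[of F Y F "- W" p] bar_curv_skew34[of F Y F W p]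
    by (simp add: ip_minus_right)
  then show ?thesis by (simp add: ric_def sum_negf)
qed

lemma star_ric_minus_right:
  assumes S: "is_frame p S" and V: "SD X" "SD Y"
  shows "star_ric S X (- Y) p = - star_ric S X Y p"
  unfolding star_ric_def using V is_frame_SD[OF S]
  by (simp add: J_minus ip_minus_right sum_negf[symmetric])

lemma tensorial_D_xi_left: "VF W \<Longrightarrow> tensorial CB p (\<lambda>X. ip (D X \<xi>) W p)"
  by (rule tensorialI) (auto simp: sections_SD D_add_left D_scale_left ip_simps)

lemma tensorial_D_xi_right: "VF X \<Longrightarrow> tensorial CB p (\<lambda>W. ip X (J W) p)"
  by (rule tensorialI) (auto simp: sections_SD J_add J_scale ip_simps)

text \<open>Of the three Gauss terms, the Riemann trace is symmetric by pair symmetry and the square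
  of S = \<open>D _ \<xi>\<close> is symmetric too; only the trace of S times S contributes its skew
  part.\<close>

lemma ric_skew_part:
  assumes S: "is_frame p S" and V: "SD Y" "SD W"
  shows "ric S Y W p - ric S W Y p = 2 * (\<Sum>F\<in>S. ip (D F \<xi>) F p) * ip Y (J W) p"
proof -
  have SS: "\<And>F. F \<in> S \<Longrightarrow> SD F" by (rule is_frame_SD[OF S])
  have r: "ric S Y W p = (\<Sum>F\<in>S. Rm F Y W F p) + ip W (D Y \<xi>) p * (\<Sum>F\<in>S. ip (D F \<xi>) F p)
      - ip (D (D Y \<xi>) \<xi>) W p" if V: "SD Y" "SD W" for Y W
  proof -
    have "ip (D (D Y \<xi>) \<xi>) W p = (\<Sum>F\<in>S. ip (D Y \<xi>) F p * ip (D F \<xi>) W p)"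
      using V by (intro expand_SD[OF S tensorial_D_xi_left]) auto
    moreover have "ric S Y W p = (\<Sum>F\<in>S. Rm F Y W F p + ip W (D Y \<xi>) p * ip (D F \<xi>) F p
        - ip (D Y \<xi>) F p * ip (D F \<xi>) W p)"
      unfolding ric_def
    proof (rule sum.cong[OF refl])
      fix F assume "F \<in> S"
      then show "ip (bar_curv D nb F Y W) F p = Rm F Y W F p + ip W (D Y \<xi>) p * ip (D F \<xi>) F p
          - ip (D Y \<xi>) F p * ip (D F \<xi>) W p"
        using V SS gauss_equation[of F Y W F p] ip_sym[of W "D F \<xi>" p] by simp
    qed
    ultimately show ?thesis by (simp add: sum.distrib sum_subtractf sum_distrib_left)
  qed
  have "(\<Sum>F\<in>S. Rm F Y W F p) = (\<Sum>F\<in>S. Rm F W Y F p)"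
  proof (rule sum.cong[OF refl])
    fix F assume "F \<in> S"
    then show "Rm F Y W F p = Rm F W Y F p"
      using V SS Rm_pair[of F Y W F p] Rm_skew12[of F W F Y p] Rm_skew34[of F W F Y p] by simp
  qed
  \<comment> \<open>Moving one factor S across the metric costs
    \<open>2 * ip (D Y \<xi>) (J W)\<close>, which \<open>D_xi_J\<close> makes symmetric.\<close>
  moreover have "ip (D (D Y \<xi>) \<xi>) W p = ip (D (D W \<xi>) \<xi>) Y p"
    using V D_xi_skew[of "D Y \<xi>" W p] D_xi_skew[of "D W \<xi>" Y p] ip_sym[of "D Y \<xi>" "D W \<xi>" p]
      D_xi_J[of W Y p] by simp
  moreover have "ip W (D Y \<xi>) p - ip Y (D W \<xi>) p = 2 * ip Y (J W) p"
    using V D_xi_skew[of Y W p] ip_sym[of W "D Y \<xi>" p] ip_sym[of Y "D W \<xi>" p] by simp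
  ultimately show ?thesis
    using r[OF V] r[OF V(2,1)] by (simp add: algebra_simps flip: right_diff_distrib)
qed

text \<open>Exchange the derivatives F and Z: the exchanged trace vanishes by
  \<open>trace_d2phi\<close>, and the curvature terms of the Ricci identity remain.\<close>

lemma trace_d2phi_mid:
  assumes S: "is_frame p S" and V: "SD Y" "SD Z"
  shows "(\<Sum>F\<in>S. d2phi F Z F Y p) = ric S Z (J Y) p - star_ric S Z (J Y) p"
proof -
  have SS: "\<And>F. F \<in> S \<Longrightarrow> SD F" by (rule is_frame_SD[OF S])
  have "d2phi F Z F Y p = d2phi Z F F Y p
      + (ip (bar_curv D nb F Z (J Y)) F p - ip (bar_curv D nb Z F (J F)) (J (J Y)) p)" if F: "F \<in> S" for F
  proof -
    have "ip (J F) (bar_curv D nb F Z Y) p = - ip (bar_curv D nb F Z (J F)) Y p"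
      using V SS[OF F] bar_curv_skew34[of F Z "J F" Y p] ip_sym[of "J F" "bar_curv D nb F Z Y" p] by simp
    also have "\<dots> = - ip (bar_curv D nb Z F (J F)) (J (J Y)) p"
      using V SS[OF F] by (simp add: bar_curv_skew12[of F Z] J_J_SD ip_simps)
    finally show ?thesis
      using V SS[OF F] d2phi_commute[of F Z F Y p] ip_sym[of F "bar_curv D nb F Z (J Y)" p] by simp
  qed
  then show ?thesis
    using trace_d2phi[OF S SD_VF[OF V(2)] V(1)]
    by (simp add: ric_def star_ric_def sum.distrib sum_subtractf)
qed

text \<open>The cyclic identity moves the repeated F out of the two derivative slots, the position
  that \<open>trace_d2phi_mid\<close> can treat.\<close>

lemma trace_d2phi_left:
  assumes S: "is_frame p S" and V: "SD Y" "SD Z"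
  shows "(\<Sum>F\<in>S. d2phi F F Y Z p) =
    ric S Y (J Z) p - star_ric S Y (J Z) p - (ric S Z (J Y) p - star_ric S Z (J Y) p)"
proof -
  have "(\<Sum>F\<in>S. d2phi F F Y Z p) = (\<Sum>F\<in>S. d2phi F Y F Z p - d2phi F Z F Y p)"
  proof (rule sum.cong[OF refl])
    fix F assume "F \<in> S"
    then show "d2phi F F Y Z p = d2phi F Y F Z p - d2phi F Z F Y p"
      using V is_frame_SD[OF S] d2phi_cyclic[of F F Y Z p] d2phi_skew[of F Y F Z p] by simp
  qed
  then show ?thesis using V by (simp add: sum_subtractf trace_d2phi_mid[OF S])
qed

lemma star_ric_gauss:
  assumes S: "is_frame p S" and V: "SD X" "SD Y"
  shows "star_ric S X Y p = (\<Sum>F\<in>S. Rm X F (J F) (J Y) p)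
    - card S * ip (D X \<xi>) (J Y) p + ip (D (J (D X \<xi>)) \<xi>) (J Y) p"
proof -
  have SS: "\<And>F. F \<in> S \<Longrightarrow> SD F" by (rule is_frame_SD[OF S])
  \<comment> \<open>Passing from F to \<open>J F\<close> preserves this trace t, while
    \<open>D_xi_skew\<close> turns it into -t - 2 * card S.\<close>
  have k: "(\<Sum>F\<in>S. ip (D F \<xi>) (J F) p) = - real (card S)"
  proof -
    have "(\<Sum>F\<in>S. ip (D (J F) \<xi>) (J (J F)) p) = (\<Sum>F\<in>S. ip (D F \<xi>) (J F) p)"
      using trace_J[OF S, of "\<lambda>X Y. ip (D X \<xi>) (J Y) p"] by (simp add: tensorial_D_xi_left tensorial_D_xi_right)
    moreover have "ip (D (J F) \<xi>) (J (J F)) p = - ip (D F \<xi>) (J F) p - 2" if F: "F \<in> S" for F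
      using D_xi_skew[of F "J F" p] SS[OF F] is_frame_orthonormal[OF S F F] by (simp add: J_J_SD ip_simps)
    ultimately show ?thesis by (simp add: sum_subtractf sum_negf)
  qed
  have e: "ip (D (J (D X \<xi>)) \<xi>) (J Y) p = (\<Sum>F\<in>S. ip (J (D X \<xi>)) F p * ip (D F \<xi>) (J Y) p)"
    using V by (intro expand_SD[OF S tensorial_D_xi_left]) auto
  have "star_ric S X Y p = (\<Sum>F\<in>S. Rm X F (J F) (J Y) p + ip (D F \<xi>) (J F) p * ip (D X \<xi>) (J Y) p
      + ip (J (D X \<xi>)) F p * ip (D F \<xi>) (J Y) p)"
    unfolding star_ric_def
  proof (rule sum.cong[OF refl])
    fix F assume "F \<in> S"
    then show "ip (bar_curv D nb X F (J F)) (J Y) p = Rm X F (J F) (J Y) p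
        + ip (D F \<xi>) (J F) p * ip (D X \<xi>) (J Y) p + ip (J (D X \<xi>)) F p * ip (D F \<xi>) (J Y) p"
      using V SS gauss_equation[of X F "J F" "J Y" p] ip_sym[of "J F" "D F \<xi>" p]
        ip_sym[of "J F" "D X \<xi>" p] ip_J_left[of "D X \<xi>" F p] by simp
  qed
  then show ?thesis
    unfolding e by (simp add: sum.distrib k flip: sum_distrib_right)
qed

text \<open>The correction term is \<open>-4(n-1) g(hX, Y)\<close>, with \<open>h\<close> half the Lie derivative of \<open>\<phi>\<close>
  along \<open>\<xi>\<close>.\<close>

lemma star_ric_J_J:
  assumes S: "is_frame p S" and V: "SD X" "SD Y"
  shows "star_ric S (J X) (J Y) p = star_ric S Y X p
    + (real (card S) - 2) * (ip (D (J X) \<xi>) Y p + ip (D Y \<xi>) (J X) p)"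
proof -
  have SS: "\<And>F. F \<in> S \<Longrightarrow> SD F" by (rule is_frame_SD[OF S])
  \<comment> \<open>Function-linearity is known for the first slot of \<open>Rm\<close>; skew
    symmetry and pair symmetry transfer it to the second and third.\<close>
  have tens: "tensorial CB p (\<lambda>A. Rm Y A (J B) (J X) p)" "tensorial CB p (\<lambda>A. Rm Y B (J A) (J X) p)"
    if "SD B" for B
  proof -
    show "tensorial CB p (\<lambda>A. Rm Y A (J B) (J X) p)"
      by (rule tensorialI)
         (use that V tensorial_Rm[of Y "J B" "J X" p] in
           \<open>auto simp: sections_SD tensorial_def Rm_skew12[of _ Y]\<close>)
    show "tensorial CB p (\<lambda>A. Rm Y B (J A) (J X) p)"
      by (rule tensorialI)
         (use that V tensorial_Rm[of "J X" Y B p] in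
           \<open>auto simp: sections_SD tensorial_def Rm_pair[of Y B] J_add J_scale\<close>)
  qed
  \<comment> \<open>Pair symmetry and skew symmetries exchange the roles of Y and \<open>J X\<close>
    at the price of replacing F by \<open>J F\<close>, which the trace absorbs.\<close>
  have "(\<Sum>F\<in>S. Rm (J X) F (J F) (J (J Y)) p) = (\<Sum>F\<in>S. Rm Y (J F) (J (J F)) (J X) p)"
  proof (rule sum.cong[OF refl])
    fix F assume "F \<in> S"
    then have F: "SD F" by (rule SS)
    have m: "Rm A B C (- E) p = - Rm A B C E p" if "VF A" "VF B" "VF C" "VF E" for A B C E
      using that by (simp add: Rm_def bar_curv_D ip_simps)
    have "Rm (J X) F (J F) (- Y) p = Rm Y (J F) (J X) F p"
      using V F m[of "J X" F "J F" Y] Rm_pair[of "J X" F "J F" Y p] Rm_skew12[of Y "J F" "J X" F p] by simp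
    moreover have "Rm Y (J F) (- F) (J X) p = Rm Y (J F) (J X) F p"
      using V F m[of Y "J F" "J X" F] Rm_skew34[of Y "J F" "J X" "- F" p] by simp
    ultimately show "Rm (J X) F (J F) (J (J Y)) p = Rm Y (J F) (J (J F)) (J X) p"
      using V F by (simp add: J_J_SD)
  qed
  also have "\<dots> = (\<Sum>F\<in>S. Rm Y F (J F) (J X) p)"
    using trace_J[OF S, of "\<lambda>A B. Rm Y A (J B) (J X) p"] tens by simp
  finally have R: "(\<Sum>F\<in>S. Rm (J X) F (J F) (J (J Y)) p) = (\<Sum>F\<in>S. Rm Y F (J F) (J X) p)" .
  let ?U = "D (J X) \<xi>" and ?W = "D Y \<xi>"
  have 1: "ip (D (J ?U) \<xi>) (J (J Y)) p = - ip (D (J ?U) \<xi>) Y p" "ip ?U (J (J Y)) p = - ip ?U Y p"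
    using V by (simp_all add: J_J_SD ip_simps)
  \<comment> \<open>After one use of \<open>D_xi_skew\<close> on each side the quadratic terms are
    opposite; the linear remainders account for the -2 beside \<open>card S\<close>.\<close>
  have "ip (D (J ?U) \<xi>) Y p = ip ?W (J ?U) p + 2 * ip ?U Y p"
    using V D_xi_skew[of "J ?U" Y p] by (simp add: ip_J_J_SD)
  moreover have "ip ?W (J ?U) p = - ip (J ?W) ?U p"
    using V ip_J_left[of ?W ?U p] by simp
  moreover have "ip (J ?W) ?U p = ip ?U (J ?W) p" using V by (simp add: ip_sym)
  moreover have "ip (D (J ?W) \<xi>) (J X) p = ip ?U (J ?W) p + 2 * ip ?W (J X) p"
    using V D_xi_skew[of "J ?W" "J X" p] by (simp add: ip_J_J_SD)
  ultimately have "ip (D (J ?U) \<xi>) Y p + ip (D (J ?W) \<xi>) (J X) p = 2 * (ip ?U Y p + ip ?W (J X) p)"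
    by simp
  then show ?thesis
    using star_ric_gauss[OF S, of "J X" "J Y"] star_ric_gauss[OF S, of Y X] V R
    by (simp add: 1 algebra_simps)
qed

text \<open>Both sides are -2 g(hX, Y). Symmetry of this correction term removes it from the skew
  part of the star-Ricci curvature.\<close>

lemma h_symmetric:
  assumes V: "SD X" "SD Y"
  shows "ip (D (J X) \<xi>) Y p + ip (D Y \<xi>) (J X) p = ip (D (J Y) \<xi>) X p + ip (D X \<xi>) (J Y) p"
  using V D_xi_skew[of "J X" Y p] D_xi_skew[of "J Y" X p] D_xi_J[of X Y p] ip_sym[of "J X" "J Y" p] by simp

lemma star_ric_skew_J:
  assumes S: "is_frame p S" and V: "SD X" "SD Y"
  shows "star_ric S (J Y) (J X) p - star_ric S (J X) (J Y) p = star_ric S X Y p - star_ric S Y X p"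
  using star_ric_J_J[OF S V] star_ric_J_J[OF S V(2,1)] h_symmetric[OF V, of p] by simp

text \<open>The left side is the trace of the second derivative of J, commuted with J. Its Ricci
  terms cancel because their skew part is J-invariant; the star-Ricci skew part occurs once directly
  and once through \<open>star_ric_skew_J\<close>, hence the 2.\<close>

lemma commutator_skew:
  assumes S: "is_frame p S" and V: "SD Y" "SD Z"
  shows "(\<Sum>F\<in>S. d2phi F F Y (J Z) p) + (\<Sum>F\<in>S. d2phi F F (J Y) Z p) =
    2 * (star_ric S Y Z p - star_ric S Z Y p)"
proof -
  have "ric S (J Y) (J Z) p - ric S (J Z) (J Y) p = ric S Y Z p - ric S Z Y p"
    using ric_skew_part[OF S V] ric_skew_part[OF S, of "J Y" "J Z"] ip_J_J_SD[of Y "J Z" p] V by simp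
  then show ?thesis
    using trace_d2phi_left[OF S, of Y "J Z"] trace_d2phi_left[OF S, of "J Y" Z] star_ric_skew_J[OF S V]
      ric_minus_right[OF S V] ric_minus_right[OF S V(2,1)] star_ric_minus_right[OF S V]
      star_ric_minus_right[OF S V(2,1)] V
    by (simp add: J_J_SD)
qed

section \<open>The harmonic section equation and the star-Ricci conditions\<close>

lemma some_frame_CB: "is_frame p (some_frame \<A> g CB p)"
  unfolding some_frame_def using is_frame_ex[of p] by (metis someI)

lemma some_frame_TS: "local_orthonormal_frame \<A> g TS p (some_frame \<A> g TS p)"
  unfolding some_frame_def using is_frame_ex[of p] is_frame_adjoin_xi(1) by (metis someI)

text \<open>J is parallel along \<xi>, and \<xi> is geodesic, so the \<xi>-direction adds nothing to
  the Laplacian and its trace reduces to the contact subbundle.\<close>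

lemma d2phi_xi:
  assumes V: "SD Y" "SD Z"
  shows "d2phi \<xi> \<xi> Y Z p = 0"
proof -
  have "dphi \<xi> Y Z = (\<lambda>q. 0)" using V dphi_xi by auto
  then have "\<xi> p (dphi \<xi> Y Z) = 0" using tangent_const[OF VF_tangent[OF xi_VF]] by simp
  moreover have "dphi 0 Y Z p = 0"
    using dphi_add_left[of 0 0 Y Z p] V by simp
  ultimately show ?thesis using V by (simp add: d2phi_eq dphi_xi D_xi_xi)
qed

lemma trace_d2phi_TS:
  assumes S: "is_frame p S" and V: "SD Y" "SD Z"
  shows "(\<Sum>E\<in>some_frame \<A> g TS p. d2phi E E Y Z p) = (\<Sum>F\<in>S. d2phi F F Y Z p)"
proof -
  have "(\<Sum>E\<in>some_frame \<A> g TS p. d2phi E E Y Z p) = (\<Sum>E\<in>insert \<xi> S. d2phi E E Y Z p)"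
    by (rule trace_frame_independent[OF some_frame_TS is_frame_adjoin_xi(1)[OF S] tangent_subspace subset_refl])
       (use V in \<open>auto simp: sections_tangent intro: tensorial_d2phi_left tensorial_d2phi_right\<close>)
  moreover have "finite S" using S by (simp add: local_orthonormal_frame_def)
  ultimately show ?thesis
    using is_frame_adjoin_xi(2)[OF S] V by (simp add: d2phi_xi)
qed

lemma star_ricci_eq: "star_ricci \<A> g \<phi> D X Y p = star_ric (some_frame \<A> g CB p) X Y p"
  by (simp add: star_ricci_def star_ric_def ip_def)

lemma star_ricci_symmetric_iff:
  "star_ricci_symmetric \<A> g \<phi> D \<longleftrightarrow> (\<forall>X Y p. SD X \<longrightarrow> SD Y \<longrightarrow>
     star_ric (some_frame \<A> g CB p) X Y p = star_ric (some_frame \<A> g CB p) Y X p)"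
  unfolding star_ricci_symmetric_def sections_SD star_ricci_eq by blast

lemma star_ricci_J_invariant_iff:
  "star_ricci_J_invariant \<A> g \<phi> D \<longleftrightarrow> (\<forall>X Y p. SD X \<longrightarrow> SD Y \<longrightarrow>
     star_ric (some_frame \<A> g CB p) (J X) (J Y) p = star_ric (some_frame \<A> g CB p) X Y p)"
  unfolding star_ricci_J_invariant_def sections_SD star_ricci_eq by blast

lemma SD_contact_bundle: "SD X \<Longrightarrow> X p \<in> CB p"
  by (simp add: contact_bundle_eq SD_def ip_def)

lemma SD_sum: "(\<And>i. i \<in> I \<Longrightarrow> SD (F i)) \<Longrightarrow> SD (\<Sum>i\<in>I. F i)"
  by (induction I rule: infinite_finite_induct) auto

lemma ip_sum_right:
  assumes "VF Y" "\<And>i. i \<in> I \<Longrightarrow> VF (F i)"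
  shows "ip Y (\<Sum>i\<in>I. F i) p = (\<Sum>i\<in>I. ip Y (F i) p)"
  using assms(2)
  by (induction I rule: infinite_finite_induct)
     (simp_all add: ip_zero_right ip_add_right assms(1) VF_sum)

text \<open>The rough Laplacian is minus the trace and J is skew, so pairing the commutator with Y
  gives minus the left side of \<open>commutator_skew\<close>.\<close>

lemma commutator_ip:
  fixes Z
  defines "W \<equiv> commutator (rough_laplacian \<A> g D nb J) J Z"
  assumes Z: "SD Z"
  shows "W p \<in> CB p"
    and "\<And>Y. SD Y \<Longrightarrow> ip Y W p = - 2 * (star_ric (some_frame \<A> g CB p) Y Z p - star_ric (some_frame \<A> g CB p) Z Y p)"
proof -
  \<comment> \<open>\<open>rough_laplacian\<close> picks a new frame at each point. Freezing the
    frame chosen at p gives a genuine section that agrees with it at p, which is all that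
    \<open>ip _ _ p\<close> sees.\<close>
  let ?L = "\<lambda>Z. - (\<Sum>E\<in>some_frame \<A> g TS p. second_cov D (end_conn nb) E E J Z)"
  have VE: "VF E" if "E \<in> some_frame \<A> g TS p" for E
    using that some_frame_TS unfolding local_orthonormal_frame_def sections_tangent by blast
  have SDsum: "SD (\<Sum>E\<in>some_frame \<A> g TS p. second_cov D (end_conn nb) E E J Z)" if "VF Z" for Z
    by (intro SD_sum) (simp add: VE that)
  have L: "SD (?L Z)" if "VF Z" for Z using SDsum[OF that] by simp
  have lap: "rough_laplacian \<A> g D nb J Z p = ?L Z p" for Z
    by (simp add: rough_laplacian_def sum_fun_apply)
  have Wp: "W p = (?L (J Z) - J (?L Z)) p"
    by (simp add: W_def commutator_def J_apply lap del: uminus_apply fun_Compl_def)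
  have "SD (?L (J Z) - J (?L Z))" using Z L by simp
  then show "W p \<in> CB p"
    unfolding Wp by (rule SD_contact_bundle)
  fix Y assume Y: "SD Y"
  have ipL: "ip Y' (?L Z') p = - (\<Sum>F\<in>some_frame \<A> g CB p. d2phi F F Y' Z' p)" if V: "SD Y'" "SD Z'" for Y' Z'
  proof -
    have "ip Y' (\<Sum>E\<in>some_frame \<A> g TS p. second_cov D (end_conn nb) E E J Z') p =
        (\<Sum>E\<in>some_frame \<A> g TS p. d2phi E E Y' Z' p)"
      unfolding d2phi_def using V VE by (intro ip_sum_right) auto
    then show ?thesis
      using V SDsum[of Z'] trace_d2phi_TS[OF some_frame_CB V]
      by (simp add: ip_minus_right)
  qed
  have "ip Y W p = ip Y (?L (J Z) - J (?L Z)) p" unfolding ip_def Wp ..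
  also have "\<dots> = ip Y (?L (J Z)) p + ip (J Y) (?L Z) p"
    using Y Z L[of Z] L[of "J Z"] ip_J_left[of Y "?L Z" p] by (simp add: ip_diff_right)
  also have "\<dots> = - 2 * (star_ric (some_frame \<A> g CB p) Y Z p - star_ric (some_frame \<A> g CB p) Z Y p)"
    using commutator_skew[OF some_frame_CB Y Z, of p] ipL[of Y "J Z"] ipL[of "J Y" Z] Y Z by simp
  finally show "ip Y W p = - 2 * (star_ric (some_frame \<A> g CB p) Y Z p - star_ric (some_frame \<A> g CB p) Z Y p)" .
qed

theorem second_harmonic_iff_symmetric:
  "second_harmonic_section_eq \<A> g \<phi> D \<longleftrightarrow> star_ricci_symmetric \<A> g \<phi> D"
proof
  assume h: "second_harmonic_section_eq \<A> g \<phi> D"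
  show "star_ricci_symmetric \<A> g \<phi> D"
    unfolding star_ricci_symmetric_iff
  proof (intro allI impI)
    fix Y Z p assume V: "SD Y" "SD Z"
    have "commutator (rough_laplacian \<A> g D nb J) J Z = 0"
      using h V unfolding second_harmonic_section_eq_def sections_SD by blast
    then show "star_ric (some_frame \<A> g CB p) Y Z p = star_ric (some_frame \<A> g CB p) Z Y p"
      using commutator_ip(2)[OF V(2,1), of p] V by (simp add: ip_zero_right)
  qed
next
  assume s: "star_ricci_symmetric \<A> g \<phi> D"
  show "second_harmonic_section_eq \<A> g \<phi> D"
    unfolding second_harmonic_section_eq_def sections_SD
  proof (intro ballI ext)
    fix Z p f assume "Z \<in> Collect SD"
    then have Z: "SD Z" by simp
    let ?W = "commutator (rough_laplacian \<A> g D nb J) J Z"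
    let ?S = "some_frame \<A> g CB p"
    obtain U where U: "open U" "p \<in> U" "\<And>q. q \<in> U \<Longrightarrow> orthonormal_at q ?S"
      "\<And>q v. q \<in> U \<Longrightarrow> v \<in> CB q \<Longrightarrow> v = (\<Sum>E\<in>?S. g q v (E q) *\<^sub>T E q)"
      by (rule frame_coeff[OF some_frame_CB contact_bundle_tangent]) (rule that)
    \<comment> \<open>The value of the commutator lies in the subbundle, so its vanishing can be
      tested on the frame vectors at p, which are values of global sections.\<close>
    have "g p (?W p) (E p) *\<^sub>T E p = 0" if "E \<in> ?S" for E
    proof -
      have E: "SD E" by (rule is_frame_SD[OF some_frame_CB that])
      have "ip E ?W p = 0"
        using commutator_ip(2)[OF Z E, of p] s Z E unfolding star_ricci_symmetric_iff by simp
      then show ?thesis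
        using g_sym[of "?W p" p "E p"] commutator_ip(1)[OF Z, of p] contact_bundle_tangent E
        by (auto simp: ip_def)
    qed
    then have "?W p = 0" using U(4)[OF U(2) commutator_ip(1)[OF Z]] by (metis (no_types, lifting) sum.neutral)
    then show "?W p f = (0 :: 'a vfield) p f" by simp
  qed
qed

text \<open>By \<open>star_ric_J_J\<close>, invariance makes \<rho>(X, Y) - \<rho>(Y, X) equal to a
  symmetric form; being skew as well, it is 0.\<close>

lemma J_invariant_imp_symmetric:
  assumes "star_ricci_J_invariant \<A> g \<phi> D"
  shows "star_ricci_symmetric \<A> g \<phi> D"
  unfolding star_ricci_symmetric_iff
proof (intro allI impI)
  fix X Y p assume V: "SD X" "SD Y"
  note inv = assms[unfolded star_ricci_J_invariant_iff, rule_format]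
  show "star_ric (some_frame \<A> g CB p) X Y p = star_ric (some_frame \<A> g CB p) Y X p"
    using star_ric_J_J[OF some_frame_CB V] star_ric_J_J[OF some_frame_CB V(2,1)]
      h_symmetric[OF V, of p] inv[OF V, of p] inv[OF V(2,1), of p] by simp
qed

lemma is_frame_card_2:
  assumes S: "is_frame p S" and dim: "DIM('e) \<le> 3" and ne: "S \<noteq> {}"
  shows "card S = 2"
proof -
  have fin: "finite S" using S by (simp add: local_orthonormal_frame_def)
  \<comment> \<open>For a single frame field F, \<open>J F\<close> would be a multiple of F, yet it
    is orthogonal to F and of unit length.\<close>
  have "card S \<noteq> 1"
  proof
    assume "card S = 1"
    then obtain F where F: "S = {F}" by (auto simp: card_1_singleton_iff)
    have SF: "SD F" by (rule is_frame_SD[OF S]) (simp add: F)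
    have 1: "ip F F p = 1" using is_frame_orthonormal[OF S, of F F] F by simp
    have "tensorial CB p (\<lambda>X. ip X (J F) p)"
      by (rule tensorialI) (use SF in \<open>auto simp: sections_SD ip_simps\<close>)
    from expand_SD[OF S this, of "J F"] have "ip (J F) (J F) p = ip (J F) F p * ip F (J F) p"
      using F SF by simp
    moreover have "ip (J F) F p = 0"
      using SF ip_J_left[of F F p] ip_sym[of F "J F" p] by simp
    ultimately show False using 1 ip_J_J_SD[OF SF SF, of p] by simp
  qed
  moreover have "card S \<noteq> 0" using fin ne by simp
  moreover have "card S \<le> 2" using is_frame_adjoin_xi(3)[OF S] dim by simp
  ultimately show ?thesis by linarith
qed

text \<open>Each alternative kills the correction term of \<open>star_ric_J_J\<close>: a rank 2
  subbundle makes the factor \<open>card S - 2\<close> vanish, a Killing \<xi> makes the form itself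
  vanish.\<close>

lemma symmetric_imp_J_invariant:
  assumes sym: "star_ricci_symmetric \<A> g \<phi> D" and k: "DIM('e) \<le> 3 \<or> killing_field \<A> g \<xi>"
  shows "star_ricci_J_invariant \<A> g \<phi> D"
  unfolding star_ricci_J_invariant_iff
proof (intro allI impI)
  fix X Y p assume V: "SD X" "SD Y"
  let ?S = "some_frame \<A> g CB p"
  show "star_ric ?S (J X) (J Y) p = star_ric ?S X Y p"
  \<comment> \<open>An empty frame occurs when the manifold has dimension 1; then
    \<open>card ?S - 2\<close> is not 0, but all traces are empty sums.\<close>
  proof (cases "?S = {}")
    case True
    then show ?thesis by (simp add: star_ric_def)
  next
    case ne: False
    have "(real (card ?S) - 2) * (ip (D (J X) \<xi>) Y p + ip (D Y \<xi>) (J X) p) = 0"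
      using k
    proof
      assume "DIM('e) \<le> 3"
      then show ?thesis using is_frame_card_2[OF some_frame_CB _ ne] by simp
    next
      assume K: "killing_field \<A> g \<xi>"
      \<comment> \<open>With torsion-freeness and metricity, the Killing equation says that
        \<open>D _ \<xi>\<close> is skew, which is the vanishing of the form.\<close>
      have "\<xi> p (ip (J X) Y) = ip (lie_bracket \<xi> (J X)) Y p + ip (J X) (lie_bracket \<xi> Y) p"
        using K V unfolding killing_field_def ip_def by simp
      then have "ip (D (J X) \<xi>) Y p + ip (J X) (D Y \<xi>) p = 0"
        using V by (simp add: D_metric D_torsion ip_simps)
      then show ?thesis using V ip_sym[of "J X" "D Y \<xi>" p] by simp
    qed
    then show ?thesis
      using star_ric_J_J[OF some_frame_CB V] sym V unfolding star_ricci_symmetric_iff by simp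
  qed
qed

end

theorem proposition2p2:
  fixes \<A> :: "('a::{t2_space, second_countable_topology}, 'e::euclidean_space) chart set"
    and g :: "'a metric" and \<phi> :: "'a endo" and \<xi> :: "'a vfield" and \<eta> :: "'a \<Rightarrow> 'a tvec \<Rightarrow> real"
    and D :: "'a conn" and n :: nat
  assumes "DIM('e) = 2 * n + 1"
    and "smooth_atlas \<A>"
    and "contact_metric \<A> g \<phi> \<xi> \<eta>"
    and "levi_civita \<A> g D"
  shows "(second_harmonic_section_eq \<A> g \<phi> D \<longleftrightarrow> star_ricci_symmetric \<A> g \<phi> D) \<and>
         (star_ricci_J_invariant \<A> g \<phi> D \<longrightarrow> star_ricci_symmetric \<A> g \<phi> D) \<and>
         (n \<le> 1 \<or> killing_field \<A> g \<xi> \<longrightarrow>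
            (star_ricci_symmetric \<A> g \<phi> D \<longleftrightarrow> star_ricci_J_invariant \<A> g \<phi> D))"
proof -
  interpret contact_metric_manifold \<A> g \<phi> \<xi> \<eta> D
    using assms(2-4) by unfold_locales (auto simp: contact_metric_def almost_contact_metric_def)
  have "n \<le> 1 \<Longrightarrow> DIM('e) \<le> 3" using assms(1) by simp
  then show ?thesis
    using second_harmonic_iff_symmetric J_invariant_imp_symmetric symmetric_imp_J_invariant by blast
qed

end
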